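(* Let $\boldsymbol f$ be a global (defined for all $t\ge0$) solution of the flow $$\partial_t\boldsymbol f=\boldsymbol\kappa-\frac{L}{2A}\boldsymbol\nu$$ of closed plane curves, such that the initial rotation number is $1$ and the initial signed area is positive. Then for each $\ell\in\mathbb N\cup\{0\}$ there exist $C_\ell>0$ and $\lambda_\ell>0$ such that $$I_\ell(t)\le C_\ell e^{-\lambda_\ell t}\qquad(t\ge0).$$
   Context: For a closed plane curve of length $L$ with arc-length parametrization $\boldsymbol f=(f_1,f_2):\mathbb R/L\mathbb Z\to\mathbb R^2$, let $\boldsymbol\nu=(-\partial_sf_2,\partial_sf_1)$ be the unit normal, $\boldsymbol\kappa=\partial_s^2\boldsymbol f$ the curvature vector, $\kappa=\boldsymbol\kappa\cdot\boldsymbol\nu$ the curvature, and $A=-\frac12\int_0^L\boldsymbol f\cdot\boldsymbol\nu\,ds$ the signed area. Rotation number $1$ means $\int_0^L\kappa\,ds=2\pi$. Curves need not be simple or convex. Set $\tilde\kappa=\kappa-\frac1L\int_0^L\kappa\,ds=\kappa-\frac{2\pi}L$ and, for integers $\ell\ge0$, $I_\ell=L^{2\ell+1}\int_0^L|\partial_s^\ell\tilde\kappa|^2\,ds$. A global solution of the flow is a smooth family of immersed closed curves $F:\mathbb R/\mathbb Z\times[0,\infty)\to\mathbb R^2$ such that, at each fixed parameter $p\in\mathbb R/\mathbb Z$, $\partial_tF(p,t)=\boldsymbol\kappa-\frac{L(t)}{2A(t)}\boldsymbol\nu$ evaluated at the point $F(p,t)$ of the curve $F(\cdot,t)$; $\boldsymbol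 f(\cdot,t):\mathbb R/L(t)\mathbb Z\to\mathbb R^2$ is the arc-length parametrization of $F(\cdot,t)$, and $L(t),A(t),I_\ell(t)$ are the quantities of the curve at time $t$. *)

theory Defs
  imports "HOL-Analysis.Analysis"
begin

text \<open>A curve \<open>\<real>/\<int> \<rightarrow> \<real>\<^sup>2\<close> is represented by a 1-periodic map
  \<open>\<gamma> :: real \<Rightarrow> real^2\<close>. The geometric quantities below are meaningful for smooth immersed \<open>\<gamma>\<close>.\<close>

definition curve_length :: "(real \<Rightarrow> real^2) \<Rightarrow> real" where
  "curve_length \<gamma> = integral {0..1} (\<lambda>p. norm (vector_derivative \<gamma> (at p)))"

text \<open>The arc-length coordinate is the oriented integral of the speed from \<open>0\<close> to \<open>p\<close>: the first
  integral vanishes for \<open>p \<le> 0\<close>, the second one for \<open>p \<ge> 0\<close>. For an immersed closed curve it is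
  a bijection of the real line that adds the length of the curve when \<open>p\<close> grows by 1.\<close>

definition arc_coord :: "(real \<Rightarrow> real^2) \<Rightarrow> real \<Rightarrow> real" where
  "arc_coord \<gamma> p = integral {0..p} (\<lambda>q. norm (vector_derivative \<gamma> (at q)))
                  - integral {p..0} (\<lambda>q. norm (vector_derivative \<gamma> (at q)))"

definition arc_param :: "(real \<Rightarrow> real^2) \<Rightarrow> real \<Rightarrow> real^2" where
  "arc_param \<gamma> s = \<gamma> (inv (arc_coord \<gamma>) s)"

text \<open>In the remaining definitions \<open>s\<close> is the arc-length coordinate.\<close>

definition unit_tangent :: "(real \<Rightarrow> real^2) \<Rightarrow> real \<Rightarrow> real^2" where
  "unit_tangent \<gamma> s = vector_derivative (arc_param \<gamma>) (at s)"

definition unit_normal :: "(real \<Rightarrow> real^2) \<Rightarrow> real \<Rightarrow> real^2" where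
  "unit_normal \<gamma> s = vector [- (unit_tangent \<gamma> s $ 2), unit_tangent \<gamma> s $ 1]"

definition curvature_vector :: "(real \<Rightarrow> real^2) \<Rightarrow> real \<Rightarrow> real^2" where
  "curvature_vector \<gamma> s = vector_derivative (unit_tangent \<gamma>) (at s)"

definition curvature :: "(real \<Rightarrow> real^2) \<Rightarrow> real \<Rightarrow> real" where
  "curvature \<gamma> s = curvature_vector \<gamma> s \<bullet> unit_normal \<gamma> s"

definition signed_area :: "(real \<Rightarrow> real^2) \<Rightarrow> real" where
  "signed_area \<gamma> = - (1/2) * integral {0..curve_length \<gamma>} (\<lambda>s. arc_param \<gamma> s \<bullet> unit_normal \<gamma> s)"

definition rotation_number :: "(real \<Rightarrow> real^2) \<Rightarrow> real" where
  "rotation_number \<gamma> = integral {0..curve_length \<gamma>} (curvature \<gamma>) / (2 * pi)"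

definition curvature_deviation :: "(real \<Rightarrow> real^2) \<Rightarrow> real \<Rightarrow> real" where
  "curvature_deviation \<gamma> s =
     curvature \<gamma> s - 1 / curve_length \<gamma> * integral {0..curve_length \<gamma>} (curvature \<gamma>)"

definition curvature_energy :: "nat \<Rightarrow> (real \<Rightarrow> real^2) \<Rightarrow> real" where
  "curvature_energy l \<gamma> = curve_length \<gamma> ^ (2 * l + 1) *
     integral {0..curve_length \<gamma>} (\<lambda>s. \<bar>(deriv ^^ l) (curvature_deviation \<gamma>) s\<bar>\<^sup>2)"

text \<open>\<open>C\<^sup>k\<close> regularity on \<open>\<real> \<times> [0,\<infinity>)\<close>, up to the boundary: the partial derivatives up to order
  \<open>k\<close> exist (the time derivative being one-sided at \<open>t = 0\<close>) and are jointly continuous.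
  Values at negative times are irrelevant.\<close>

primrec Ck_halfplane :: "nat \<Rightarrow> (real \<Rightarrow> real \<Rightarrow> real^2) \<Rightarrow> bool" where
  "Ck_halfplane 0 G \<longleftrightarrow> continuous_on (UNIV \<times> {0..}) (\<lambda>(p, t). G p t)"
| "Ck_halfplane (Suc k) G \<longleftrightarrow>
     continuous_on (UNIV \<times> {0..}) (\<lambda>(p, t). G p t) \<and>
     (\<exists>Gp Gt.
        (\<forall>p. \<forall>t\<ge>0. ((\<lambda>q. G q t) has_vector_derivative Gp p t) (at p)) \<and>
        (\<forall>p. \<forall>t\<ge>0. ((\<lambda>\<tau>. G p \<tau>) has_vector_derivative Gt p t) (at t within {0..})) \<and>
        Ck_halfplane k Gp \<and> Ck_halfplane k Gt)"

definition smooth_immersed_family :: "(real \<Rightarrow> real \<Rightarrow> real^2) \<Rightarrow> bool" where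
  "smooth_immersed_family F \<longleftrightarrow>
     (\<forall>k. Ck_halfplane k F) \<and>
     (\<forall>p. \<forall>t\<ge>0. F (p + 1) t = F p t) \<and>
     (\<forall>p. \<forall>t\<ge>0. vector_derivative (\<lambda>q. F q t) (at p) \<noteq> 0)"

text \<open>The point \<open>F p t\<close> of the curve at time \<open>t\<close> has arc-length coordinate
  \<open>arc_coord (\<lambda>q. F q t) p\<close>. The area is required to be nonzero so that the quotient \<open>L / (2 A)\<close>
  in the equation is a genuine one.\<close>

definition global_flow_solution :: "(real \<Rightarrow> real \<Rightarrow> real^2) \<Rightarrow> bool" where
  "global_flow_solution F \<longleftrightarrow>
     smooth_immersed_family F \<and>
     (\<forall>t\<ge>0. signed_area (\<lambda>q. F q t) \<noteq> 0) \<and>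
     (\<forall>p. \<forall>t\<ge>0. let \<gamma> = (\<lambda>q. F q t); s = arc_coord \<gamma> p in
        ((\<lambda>\<tau>. F p \<tau>) has_vector_derivative
           (curvature_vector \<gamma> s
             - (curve_length \<gamma> / (2 * signed_area \<gamma>)) *\<^sub>R unit_normal \<gamma> s)) (at t within {0..}))"

end

theory Submission imports Defs begin

text \<open>
Write \<open>V = \<kappa> - L / 2A\<close> for the normal velocity, \<open>u = \<kappa> - 2\<pi> / L\<close> for the deviation of the curvature from its
mean, \<open>E\<^sub>l = \<integral> |\<partial>\<^sub>s\<^sup>l u|\<^sup>2 ds\<close> for the energies, and \<open>\<Delta> = L\<^sup>2 - 4\<pi>A\<close> for the isoperimetric deficit. The total
curvature stays equal to \<open>2\<pi>\<close> along the flow, and then \<open>A' = \<Delta> / 2A\<close> and \<open>\<Delta>' = - 2 L E\<^sub>0\<close>.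

The deficit drives the proof. It is nonnegative by the isoperimetric inequality, which Hurwitz' argument gives for
curves with self-intersections too (\<open>isoperimetric_inequality\<close>), so the area increases and stays positive. Conversely
\<open>\<Delta> \<le> L\<^sup>3 E\<^sub>0 / \<pi>\<close> (\<open>isoperimetric_deficit_bound\<close>): the deficit is at most quadratic in \<open>u\<close>. Hence \<open>\<Delta>\<close> decays at least at
the rate \<open>2\<pi> / L\<^sup>2\<close>, a multiple of the area may be added to \<open>\<Delta>\<close> without destroying its monotonicity, the length stays
between two positive constants (\<open>length_bounded\<close>), and \<open>\<Delta>\<close> decays exponentially (\<open>exp_decay_deficit\<close>). Since
\<open>V = u - \<Delta> / 2AL\<close>, the velocity differs from \<open>u\<close> by an exponentially small constant.

From \<open>\<Delta>' = - 2 L E\<^sub>0\<close> the integral of \<open>E\<^sub>0\<close> over \<open>[t, t + 1]\<close> decays exponentially. The evolution equation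
\<open>\<partial>\<^sub>t \<kappa> = \<partial>\<^sub>s\<^sup>2 \<kappa> + \<kappa>\<^sup>2 V\<close> and its derivatives give, once the energies below order \<open>l\<close> are known to decay,
\<open>E\<^sub>l' + E\<^sub>l\<^sub>+\<^sub>1 \<le> (1 + E\<^sub>l)\<^sup>2 (K E\<^sub>l + r)\<close> with a decaying error \<open>r\<close> (\<open>dissipation\<close>). A nonlinear Gronwall lemma
(\<open>exp_decay_of_dissipation\<close>) turns the decay of the integrals of \<open>E\<^sub>l\<close> into pointwise decay, and then the term \<open>E\<^sub>l\<^sub>+\<^sub>1\<close> on the
left shows that the integrals of \<open>E\<^sub>l\<^sub>+\<^sub>1\<close> decay, which starts the next step of the induction on \<open>l\<close>.

All computations are carried out in the fixed parameter \<open>p\<close>, with \<open>\<partial>\<^sub>s\<close> standing for \<open>|\<partial>\<^sub>p F|\<^sup>-\<^sup>1 \<partial>\<^sub>p\<close>, because the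
arc-length parameter changes with time; the price is the commutator \<open>[\<partial>\<^sub>t, \<partial>\<^sub>s] = \<kappa> V \<partial>\<^sub>s\<close>.
\<close>

section \<open>Smooth functions on a half-plane\<close>

lemma has_real_derivative_eq_on:
  fixes f g :: "real \<Rightarrow> real"
  assumes "(f has_real_derivative d) (at t within S)" "t \<in> S" "\<And>x. x \<in> S \<Longrightarrow> g x = f x"
  shows "(g has_real_derivative d) (at t within S)"
  by (rule has_field_derivative_transform_within[OF assms(1) zero_less_one]) (auto simp: assms)

lemma continuous_on_of_derivative:
  fixes g :: "real \<Rightarrow> real"
  assumes "\<And>p. (g has_real_derivative g' p) (at p)"
  shows "continuous_on A g"
  using assms by (auto intro!: continuous_at_imp_continuous_on DERIV_isCont)

lemma derivative_Ici_unique: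
  fixes f :: "real \<Rightarrow> real"
  assumes "(f has_real_derivative d) (at t within {0..})"
    and "(f has_real_derivative e) (at t within {0..})" and "0 \<le> t"
  shows "d = e"
proof -
  have "t islimpt {t<..<t+1}" by (rule islimpt_greaterThanLessThan1) simp
  then have "t islimpt {0..}" by (rule islimpt_subset) (use assms(3) in auto)
  then have "at t within {0..} \<noteq> bot" by (simp add: trivial_limit_within)
  then show ?thesis
    using assms(1,2) vector_derivative_unique_within
    unfolding has_real_derivative_iff_has_vector_derivative by blast
qed

lemma nonincreasing_Ici:
  fixes f :: "real \<Rightarrow> real"
  assumes "\<And>t. 0 \<le> t \<Longrightarrow> (f has_real_derivative f' t) (at t within {0..})"
    and "\<And>t. a \<le> t \<Longrightarrow> t \<le> b \<Longrightarrow> f' t \<le> 0" and "0 \<le> a" "a \<le> b"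
  shows "f b \<le> f a"
proof (rule DERIV_nonpos_imp_decreasing_open[OF \<open>a \<le> b\<close>])
  fix x assume x: "a < x" "x < b"
  then have "x \<in> interior {0..}" using \<open>0 \<le> a\<close> by simp
  then have "at x within {0..} = at x" by (rule at_within_interior)
  with assms(1)[of x] assms(2)[of x] x \<open>0 \<le> a\<close>
  show "\<exists>y. (f has_real_derivative y) (at x) \<and> y \<le> 0" by auto
next
  have "continuous_on {0..} f"
    using assms(1) by (intro DERIV_continuous_on[of _ f f']) auto
  then show "continuous_on {a..b} f"
    by (rule continuous_on_subset) (use \<open>0 \<le> a\<close> in auto)
qed

text \<open>The scalar counterpart of \<^const>\<open>Ck_halfplane\<close>, to which the coordinates of a curve belong and
  which is closed under algebraic operations.\<close>

primrec Ck_scalar :: "nat \<Rightarrow> (real \<Rightarrow> real \<Rightarrow> real) \<Rightarrow> bool" where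
  "Ck_scalar 0 g \<longleftrightarrow> continuous_on (UNIV \<times> {0..}) (\<lambda>(p, t). g p t)"
| "Ck_scalar (Suc k) g \<longleftrightarrow>
     continuous_on (UNIV \<times> {0..}) (\<lambda>(p, t). g p t) \<and>
     (\<exists>gp gt.
        (\<forall>p. \<forall>t\<ge>0. ((\<lambda>q. g q t) has_real_derivative gp p t) (at p)) \<and>
        (\<forall>p. \<forall>t\<ge>0. ((\<lambda>\<tau>. g p \<tau>) has_real_derivative gt p t) (at t within {0..})) \<and>
        Ck_scalar k gp \<and> Ck_scalar k gt)"

lemma Ck_scalar_SucI:
  assumes "continuous_on (UNIV \<times> {0..}) (\<lambda>(p, t). g p t)"
    and "\<And>p t. 0 \<le> t \<Longrightarrow> ((\<lambda>q. g q t) has_real_derivative gp p t) (at p)"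
    and "\<And>p t. 0 \<le> t \<Longrightarrow> ((\<lambda>\<tau>. g p \<tau>) has_real_derivative gt p t) (at t within {0..})"
    and "Ck_scalar k gp" and "Ck_scalar k gt"
  shows "Ck_scalar (Suc k) g"
  using assms unfolding Ck_scalar.simps by blast

lemma Ck_scalar_SucE:
  assumes "Ck_scalar (Suc k) g"
  obtains gp gt where "continuous_on (UNIV \<times> {0..}) (\<lambda>(p, t). g p t)"
    and "\<And>p t. 0 \<le> t \<Longrightarrow> ((\<lambda>q. g q t) has_real_derivative gp p t) (at p)"
    and "\<And>p t. 0 \<le> t \<Longrightarrow> ((\<lambda>\<tau>. g p \<tau>) has_real_derivative gt p t) (at t within {0..})"
    and "Ck_scalar k gp" and "Ck_scalar k gt"
  using assms unfolding Ck_scalar.simps by blast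

lemma Ck_scalar_continuous:
  "Ck_scalar k g \<Longrightarrow> continuous_on (UNIV \<times> {0..}) (\<lambda>(p, t). g p t)"
  by (cases k) auto

lemma Ck_scalar_cong:
  assumes "Ck_scalar k f" and eq: "\<And>p t. 0 \<le> t \<Longrightarrow> g p t = f p t"
  shows "Ck_scalar k g"
proof -
  have cont: "continuous_on (UNIV \<times> {0..}) (\<lambda>(p, t). g p t)"
    using Ck_scalar_continuous[OF assms(1)]
    by (rule continuous_on_eq) (auto simp: eq)
  show ?thesis
  proof (cases k)
    case 0
    then show ?thesis using cont by simp
  next
    case (Suc n)
    then have "Ck_scalar (Suc n) f" using assms(1) by simp
    then obtain fp ft where f:
      "\<And>p t. 0 \<le> t \<Longrightarrow> ((\<lambda>q. f q t) has_real_derivative fp p t) (at p)"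
      "\<And>p t. 0 \<le> t \<Longrightarrow> ((\<lambda>\<tau>. f p \<tau>) has_real_derivative ft p t) (at t within {0..})"
      "Ck_scalar n fp" "Ck_scalar n ft"
      by (rule Ck_scalar_SucE) blast
    have "Ck_scalar (Suc n) g"
    proof (rule Ck_scalar_SucI[OF cont _ _ f(3,4)])
      fix p t :: real assume "0 \<le> t"
      then show "((\<lambda>q. g q t) has_real_derivative fp p t) (at p)" using f(1)[of t p] eq by simp
      show "((\<lambda>\<tau>. g p \<tau>) has_real_derivative ft p t) (at t within {0..})"
        using f(2)[OF \<open>0 \<le> t\<close>, of p]
        by (rule has_real_derivative_eq_on) (use eq \<open>0 \<le> t\<close> in auto)
    qed
    then show ?thesis using Suc by simp
  qed
qed

lemma Ck_scalar_Suc_imp: "Ck_scalar (Suc k) g \<Longrightarrow> Ck_scalar k g"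
proof (induction k arbitrary: g)
  case 0
  then show ?case by simp
next
  case (Suc k)
  from Suc.prems show ?case
    by (rule Ck_scalar_SucE) (rule Ck_scalar_SucI, (rule Suc.IH | assumption)+)
qed

lemma Ck_scalar_const: "Ck_scalar k (\<lambda>p t. c)"
proof (induction k arbitrary: c)
  case 0
  then show ?case by simp
next
  case (Suc k)
  show ?case by (rule Ck_scalar_SucI[OF _ _ _ Suc Suc]) (auto intro!: derivative_eq_intros)
qed

lemma Ck_scalar_add:
  "Ck_scalar k f \<Longrightarrow> Ck_scalar k g \<Longrightarrow> Ck_scalar k (\<lambda>p t. f p t + g p t)"
proof (induction k arbitrary: f g)
  case 0
  then show ?case by (auto simp: case_prod_unfold intro!: continuous_intros)
next
  case (Suc k)
  from Suc.prems(1) obtain fp ft where f: "continuous_on (UNIV \<times> {0..}) (\<lambda>(p, t). f p t)"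
    "\<And>p t. 0 \<le> t \<Longrightarrow> ((\<lambda>q. f q t) has_real_derivative fp p t) (at p)"
    "\<And>p t. 0 \<le> t \<Longrightarrow> ((\<lambda>\<tau>. f p \<tau>) has_real_derivative ft p t) (at t within {0..})"
    "Ck_scalar k fp" "Ck_scalar k ft" by (rule Ck_scalar_SucE) blast
  from Suc.prems(2) obtain gp gt where g: "continuous_on (UNIV \<times> {0..}) (\<lambda>(p, t). g p t)"
    "\<And>p t. 0 \<le> t \<Longrightarrow> ((\<lambda>q. g q t) has_real_derivative gp p t) (at p)"
    "\<And>p t. 0 \<le> t \<Longrightarrow> ((\<lambda>\<tau>. g p \<tau>) has_real_derivative gt p t) (at t within {0..})"
    "Ck_scalar k gp" "Ck_scalar k gt" by (rule Ck_scalar_SucE) blast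
  show ?case
  proof (rule Ck_scalar_SucI)
    show "continuous_on (UNIV \<times> {0..}) (\<lambda>(p, t). f p t + g p t)"
      using f(1) g(1) by (auto simp: case_prod_unfold intro!: continuous_intros)
  qed (rule DERIV_add f(2,3) g(2,3) Suc.IH[OF f(4) g(4)] Suc.IH[OF f(5) g(5)] | assumption)+
qed

lemma Ck_scalar_mult:
  "Ck_scalar k f \<Longrightarrow> Ck_scalar k g \<Longrightarrow> Ck_scalar k (\<lambda>p t. f p t * g p t)"
proof (induction k arbitrary: f g)
  case 0
  then show ?case by (auto simp: case_prod_unfold intro!: continuous_intros)
next
  case (Suc k)
  from Suc.prems(1) obtain fp ft where f: "continuous_on (UNIV \<times> {0..}) (\<lambda>(p, t). f p t)"
    "\<And>p t. 0 \<le> t \<Longrightarrow> ((\<lambda>q. f q t) has_real_derivative fp p t) (at p)"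
    "\<And>p t. 0 \<le> t \<Longrightarrow> ((\<lambda>\<tau>. f p \<tau>) has_real_derivative ft p t) (at t within {0..})"
    "Ck_scalar k fp" "Ck_scalar k ft" by (rule Ck_scalar_SucE) blast
  from Suc.prems(2) obtain gp gt where g: "continuous_on (UNIV \<times> {0..}) (\<lambda>(p, t). g p t)"
    "\<And>p t. 0 \<le> t \<Longrightarrow> ((\<lambda>q. g q t) has_real_derivative gp p t) (at p)"
    "\<And>p t. 0 \<le> t \<Longrightarrow> ((\<lambda>\<tau>. g p \<tau>) has_real_derivative gt p t) (at t within {0..})"
    "Ck_scalar k gp" "Ck_scalar k gt" by (rule Ck_scalar_SucE) blast
  note fk = Suc.prems(1)[THEN Ck_scalar_Suc_imp] and gk = Suc.prems(2)[THEN Ck_scalar_Suc_imp]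
  show ?case
  proof (rule Ck_scalar_SucI)
    show "continuous_on (UNIV \<times> {0..}) (\<lambda>(p, t). f p t * g p t)"
      using f(1) g(1) by (auto simp: case_prod_unfold intro!: continuous_intros)
    fix p t :: real assume "0 \<le> t"
    show "((\<lambda>q. f q t * g q t) has_real_derivative fp p t * g p t + gp p t * f p t) (at p)"
      by (rule DERIV_mult f(2) g(2) \<open>0 \<le> t\<close>)+
    show "((\<lambda>\<tau>. f p \<tau> * g p \<tau>) has_real_derivative ft p t * g p t + gt p t * f p t)
            (at t within {0..})"
      by (rule DERIV_mult f(3) g(3) \<open>0 \<le> t\<close>)+
  qed (rule Ck_scalar_add Suc.IH f(4,5) g(4,5) fk gk)+
qed

lemma Ck_scalar_minus: "Ck_scalar k f \<Longrightarrow> Ck_scalar k (\<lambda>p t. - f p t)"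
  using Ck_scalar_mult[OF Ck_scalar_const[of k "-1"], of f] by simp

lemma Ck_scalar_inverse:
  "Ck_scalar k g \<Longrightarrow> (\<And>p t. 0 \<le> t \<Longrightarrow> g p t \<noteq> 0) \<Longrightarrow> Ck_scalar k (\<lambda>p t. inverse (g p t))"
proof (induction k)
  case 0
  then show ?case by (auto simp: case_prod_unfold intro!: continuous_intros)
next
  case (Suc k)
  from Suc.prems(1) obtain gp gt where g: "continuous_on (UNIV \<times> {0..}) (\<lambda>(p, t). g p t)"
    "\<And>p t. 0 \<le> t \<Longrightarrow> ((\<lambda>q. g q t) has_real_derivative gp p t) (at p)"
    "\<And>p t. 0 \<le> t \<Longrightarrow> ((\<lambda>\<tau>. g p \<tau>) has_real_derivative gt p t) (at t within {0..})"
    "Ck_scalar k gp" "Ck_scalar k gt" by (rule Ck_scalar_SucE) blast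
  have ik: "Ck_scalar k (\<lambda>p t. inverse (g p t))"
    using Suc.IH Suc.prems Ck_scalar_Suc_imp by blast
  show ?case
  proof (rule Ck_scalar_SucI)
    show "continuous_on (UNIV \<times> {0..}) (\<lambda>(p, t). inverse (g p t))"
      using g(1) Suc.prems(2) by (auto simp: case_prod_unfold intro!: continuous_intros)
    fix p t :: real assume t: "0 \<le> t"
    show "((\<lambda>q. inverse (g q t)) has_real_derivative
            - (inverse (g p t) * gp p t * inverse (g p t))) (at p)"
      by (rule DERIV_inverse'[OF g(2)[OF t] Suc.prems(2)[OF t]])
    show "((\<lambda>\<tau>. inverse (g p \<tau>)) has_real_derivative
            - (inverse (g p t) * gt p t * inverse (g p t))) (at t within {0..})"
      by (rule DERIV_inverse'[OF g(3)[OF t] Suc.prems(2)[OF t]])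
  qed (rule Ck_scalar_minus Ck_scalar_mult g(4,5) ik)+
qed

lemma Ck_scalar_sqrt:
  "Ck_scalar k g \<Longrightarrow> (\<And>p t. 0 \<le> t \<Longrightarrow> 0 < g p t) \<Longrightarrow> Ck_scalar k (\<lambda>p t. sqrt (g p t))"
proof (induction k)
  case 0
  then show ?case by (auto simp: case_prod_unfold intro!: continuous_intros)
next
  case (Suc k)
  from Suc.prems(1) obtain gp gt where g: "continuous_on (UNIV \<times> {0..}) (\<lambda>(p, t). g p t)"
    "\<And>p t. 0 \<le> t \<Longrightarrow> ((\<lambda>q. g q t) has_real_derivative gp p t) (at p)"
    "\<And>p t. 0 \<le> t \<Longrightarrow> ((\<lambda>\<tau>. g p \<tau>) has_real_derivative gt p t) (at t within {0..})"
    "Ck_scalar k gp" "Ck_scalar k gt" by (rule Ck_scalar_SucE) blast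
  have "Ck_scalar k (\<lambda>p t. inverse (sqrt (g p t)))"
    using Suc.prems(2)
    by (intro Ck_scalar_inverse Suc.IH[OF Suc.prems(1)[THEN Ck_scalar_Suc_imp]])
       (auto simp: less_imp_neq[symmetric])
  note ik = Ck_scalar_mult[OF this Ck_scalar_const[of k "1/2"]]
  show ?case
  proof (rule Ck_scalar_SucI)
    show "continuous_on (UNIV \<times> {0..}) (\<lambda>(p, t). sqrt (g p t))"
      using g(1) by (auto simp: case_prod_unfold intro!: continuous_intros)
    fix p t :: real assume t: "0 \<le> t"
    note sq = DERIV_real_sqrt[OF Suc.prems(2)[OF t], of p]
    show "((\<lambda>q. sqrt (g q t)) has_real_derivative
            gp p t * (inverse (sqrt (g p t)) * (1/2))) (at p)"
      using DERIV_chain2[OF sq g(2)[OF t]] by (simp add: mult.commute)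
    show "((\<lambda>\<tau>. sqrt (g p \<tau>)) has_real_derivative
            gt p t * (inverse (sqrt (g p t)) * (1/2))) (at t within {0..})"
      using DERIV_chain2[OF sq g(3)[OF t]] by (simp add: mult.commute)
  qed (rule Ck_scalar_mult g(4,5) ik)+
qed

lemma Ck_scalar_component:
  "Ck_halfplane k G \<Longrightarrow> Ck_scalar k (\<lambda>p t. G p t $ i)"
proof (induction k arbitrary: G)
  case 0
  then show ?case by (auto simp: case_prod_unfold intro!: continuous_intros)
next
  case (Suc k)
  from Suc.prems obtain Gp Gt where G: "continuous_on (UNIV \<times> {0..}) (\<lambda>(p, t). G p t)"
    "\<And>p t. 0 \<le> t \<Longrightarrow> ((\<lambda>q. G q t) has_vector_derivative Gp p t) (at p)"
    "\<And>p t. 0 \<le> t \<Longrightarrow> ((\<lambda>\<tau>. G p \<tau>) has_vector_derivative Gt p t) (at t within {0..})"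
    "Ck_halfplane k Gp" "Ck_halfplane k Gt" unfolding Ck_halfplane.simps by blast
  show ?case
  proof (rule Ck_scalar_SucI)
    show "continuous_on (UNIV \<times> {0..}) (\<lambda>(p, t). G p t $ i)"
      using G(1) by (auto simp: case_prod_unfold intro!: continuous_intros)
  qed (auto intro!: Suc.IH G simp: has_real_derivative_iff_has_vector_derivative
         intro!: bounded_linear.has_vector_derivative[OF bounded_linear_vec_nth])
qed

definition smooth_scalar :: "(real \<Rightarrow> real \<Rightarrow> real) \<Rightarrow> bool" where
  "smooth_scalar g \<longleftrightarrow> (\<forall>k. Ck_scalar k g)"

definition dp :: "(real \<Rightarrow> real \<Rightarrow> real) \<Rightarrow> real \<Rightarrow> real \<Rightarrow> real" where
  "dp g p t = deriv (\<lambda>q. g q t) p"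

text \<open>The time derivative is taken within \<open>[0, \<infinity>)\<close> and is thus one-sided at \<open>t = 0\<close>.\<close>

definition dt :: "(real \<Rightarrow> real \<Rightarrow> real) \<Rightarrow> real \<Rightarrow> real \<Rightarrow> real" where
  "dt g p t = (THE d. ((\<lambda>\<tau>. g p \<tau>) has_real_derivative d) (at t within {0..}))"

lemma dp_eqI: "((\<lambda>q. g q t) has_real_derivative d) (at p) \<Longrightarrow> dp g p t = d"
  unfolding dp_def by (rule DERIV_imp_deriv)

lemma dt_eqI:
  "((\<lambda>\<tau>. g p \<tau>) has_real_derivative d) (at t within {0..}) \<Longrightarrow> 0 \<le> t \<Longrightarrow> dt g p t = d"
  unfolding dt_def by (rule the_equality) (auto intro: derivative_Ici_unique)

lemma smooth_scalar_partials:
  assumes "smooth_scalar g"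
  shows has_dp: "0 \<le> t \<Longrightarrow> ((\<lambda>q. g q t) has_real_derivative dp g p t) (at p)"
    and has_dt: "0 \<le> t \<Longrightarrow> ((\<lambda>\<tau>. g p \<tau>) has_real_derivative dt g p t) (at t within {0..})"
    and smooth_dp: "smooth_scalar (dp g)"
    and smooth_dt: "smooth_scalar (dt g)"
    and smooth_continuous: "continuous_on (UNIV \<times> {0..}) (\<lambda>(p, t). g p t)"
proof -
  have main: "(0 \<le> t \<longrightarrow> ((\<lambda>q. g q t) has_real_derivative dp g p t) (at p)
      \<and> ((\<lambda>\<tau>. g p \<tau>) has_real_derivative dt g p t) (at t within {0..}))
      \<and> Ck_scalar k (dp g) \<and> Ck_scalar k (dt g)" for k p t
  proof -
    have "Ck_scalar (Suc k) g" using assms by (simp add: smooth_scalar_def)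
    then obtain gp gt where g:
      "\<And>p t. 0 \<le> t \<Longrightarrow> ((\<lambda>q. g q t) has_real_derivative gp p t) (at p)"
      "\<And>p t. 0 \<le> t \<Longrightarrow> ((\<lambda>\<tau>. g p \<tau>) has_real_derivative gt p t) (at t within {0..})"
      "Ck_scalar k gp" "Ck_scalar k gt" by (rule Ck_scalar_SucE) blast
    have p: "dp g p t = gp p t" if "0 \<le> t" for p t using g(1)[OF that] by (rule dp_eqI)
    have t: "dt g p t = gt p t" if "0 \<le> t" for p t using g(2)[OF that] that by (rule dt_eqI)
    show ?thesis
      using g p t Ck_scalar_cong[OF g(3), of "dp g"] Ck_scalar_cong[OF g(4), of "dt g"] by auto
  qed
  show "0 \<le> t \<Longrightarrow> ((\<lambda>q. g q t) has_real_derivative dp g p t) (at p)"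
    "0 \<le> t \<Longrightarrow> ((\<lambda>\<tau>. g p \<tau>) has_real_derivative dt g p t) (at t within {0..})"
    "smooth_scalar (dp g)" "smooth_scalar (dt g)"
    using main by (auto simp: smooth_scalar_def)
  show "continuous_on (UNIV \<times> {0..}) (\<lambda>(p, t). g p t)"
    using assms Ck_scalar_continuous by (auto simp: smooth_scalar_def)
qed

lemma smooth_const: "smooth_scalar (\<lambda>p t. c)"
  and smooth_add: "smooth_scalar f \<Longrightarrow> smooth_scalar g \<Longrightarrow> smooth_scalar (\<lambda>p t. f p t + g p t)"
  and smooth_mult: "smooth_scalar f \<Longrightarrow> smooth_scalar g \<Longrightarrow> smooth_scalar (\<lambda>p t. f p t * g p t)"
  and smooth_uminus: "smooth_scalar f \<Longrightarrow> smooth_scalar (\<lambda>p t. - f p t)"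
  and smooth_inverse: "smooth_scalar f \<Longrightarrow> (\<And>p t. 0 \<le> t \<Longrightarrow> f p t \<noteq> 0) \<Longrightarrow>
    smooth_scalar (\<lambda>p t. inverse (f p t))"
  and smooth_sqrt: "smooth_scalar f \<Longrightarrow> (\<And>p t. 0 \<le> t \<Longrightarrow> 0 < f p t) \<Longrightarrow>
    smooth_scalar (\<lambda>p t. sqrt (f p t))"
  unfolding smooth_scalar_def
  by (auto intro: Ck_scalar_const Ck_scalar_add Ck_scalar_mult Ck_scalar_minus
      Ck_scalar_inverse Ck_scalar_sqrt)

lemma smooth_diff:
  "smooth_scalar f \<Longrightarrow> smooth_scalar g \<Longrightarrow> smooth_scalar (\<lambda>p t. f p t - g p t)"
  using smooth_add[OF _ smooth_uminus, of f g] by simp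

lemma smooth_divide:
  "smooth_scalar f \<Longrightarrow> smooth_scalar g \<Longrightarrow> (\<And>p t. 0 \<le> t \<Longrightarrow> g p t \<noteq> 0) \<Longrightarrow>
    smooth_scalar (\<lambda>p t. f p t / g p t)"
  using smooth_mult[OF _ smooth_inverse, of f g] by (simp add: divide_inverse)

lemma smooth_power: "smooth_scalar f \<Longrightarrow> smooth_scalar (\<lambda>p t. f p t ^ n)"
  by (induction n) (simp_all add: smooth_const smooth_mult)

lemma continuous_on_slice_p:
  assumes "continuous_on (UNIV \<times> {0..}) (\<lambda>(p, t). g p t :: real)" and "(0::real) \<le> t"
  shows "continuous_on S (\<lambda>p::real. g p t)"
proof -
  have "continuous_on S ((\<lambda>(p, t). g p t) \<circ> (\<lambda>p. (p, t)))"
    by (rule continuous_on_compose)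
       (use assms in \<open>auto intro!: continuous_intros intro: continuous_on_subset\<close>)
  then show ?thesis by (simp add: o_def)
qed

lemma smooth_continuous_on_p: "smooth_scalar g \<Longrightarrow> 0 \<le> t \<Longrightarrow> continuous_on S (\<lambda>p. g p t)"
  by (rule continuous_on_slice_p[OF smooth_continuous])

lemma smooth_integral_derivative:
  assumes "smooth_scalar g" and "0 \<le> t"
  shows "((\<lambda>\<tau>. integral {a..b} (\<lambda>p. g p \<tau>)) has_real_derivative
      integral {a..b} (\<lambda>p. dt g p t)) (at t within {0..})"
proof -
  have swap: "continuous_on ({0..} \<times> cbox a b) (\<lambda>(\<tau>, p). dt g p \<tau>)"
  proof -
    have "continuous_on ({0..} \<times> cbox a b) ((\<lambda>(p, \<tau>). dt g p \<tau>) \<circ> prod.swap)"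
      by (rule continuous_on_compose)
         (auto intro!: continuous_intros
           continuous_on_subset[OF smooth_continuous[OF smooth_dt[OF assms(1)]]] simp: prod.swap_def)
    then show ?thesis by (simp add: o_def case_prod_unfold prod.swap_def)
  qed
  have "((\<lambda>\<tau>. integral (cbox a b) (\<lambda>p. g p \<tau>)) has_real_derivative
      integral (cbox a b) (\<lambda>p. dt g p t)) (at t within {0..})"
    by (rule leibniz_rule_field_derivative[where fx = "\<lambda>\<tau> p. dt g p \<tau>"])
       (use assms swap in \<open>auto intro!: has_dt integrable_continuous_real smooth_continuous_on_p\<close>)
  then show ?thesis by simp
qed

text \<open>Symmetry of second derivatives: differentiate
  \<open>g(b,t) - g(a,t) = \<integral>\<^sub>a\<^sup>b \<partial>\<^sub>pg dp\<close> in \<open>t\<close> under the integral sign and then in \<open>b\<close>. This also covers the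
  one-sided derivatives at \<open>t = 0\<close>.\<close>

lemma smooth_mixed_partials:
  assumes g: "smooth_scalar g" and t: "0 \<le> t"
  shows "((\<lambda>q. dt g q t) has_real_derivative dt (dp g) p t) (at p)"
proof -
  define a where "a = p - 1"
  have ftc: "integral {a..b} (\<lambda>p. dp g p \<tau>) = g b \<tau> - g a \<tau>" if "0 \<le> \<tau>" "a \<le> b" for b \<tau>
    using that g has_dp[OF g]
    by (intro integral_unique fundamental_theorem_of_calculus)
       (auto simp: has_real_derivative_iff_has_vector_derivative[symmetric]
         intro: has_field_derivative_at_within)
  have eq: "dt g b t = dt g a t + integral {a..b} (\<lambda>p. dt (dp g) p t)" if "a \<le> b" for b
  proof -
    have "((\<lambda>\<tau>. integral {a..b} (\<lambda>p. dp g p \<tau>)) has_real_derivative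
        integral {a..b} (\<lambda>p. dt (dp g) p t)) (at t within {0..})"
      by (rule smooth_integral_derivative[OF smooth_dp[OF g] t])
    then have "((\<lambda>\<tau>. g b \<tau> - g a \<tau>) has_real_derivative
        integral {a..b} (\<lambda>p. dt (dp g) p t)) (at t within {0..})"
      by (rule has_real_derivative_eq_on) (use ftc that t in auto)
    moreover have "((\<lambda>\<tau>. g b \<tau> - g a \<tau>) has_real_derivative dt g b t - dt g a t)
        (at t within {0..})"
      by (intro DERIV_diff has_dt g t)
    ultimately show ?thesis using derivative_Ici_unique[OF _ _ t] by fastforce
  qed
  have "((\<lambda>b. integral {a..b} (\<lambda>p. dt (dp g) p t)) has_real_derivative dt (dp g) p t)
      (at p within {a..p+1})"
    by (rule integral_has_real_derivative)
       (auto simp: a_def intro: smooth_continuous_on_p[OF smooth_dt[OF smooth_dp[OF g]] t])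
  then have "((\<lambda>b. dt g a t + integral {a..b} (\<lambda>p. dt (dp g) p t)) has_real_derivative
      dt (dp g) p t) (at p within {a..p+1})"
    by (auto intro!: derivative_eq_intros)
  then have "((\<lambda>b. dt g b t) has_real_derivative dt (dp g) p t) (at p within {a..p+1})"
    by (rule has_real_derivative_eq_on)
       (auto simp: a_def intro: eq[unfolded a_def])
  moreover have "at p within {a..p+1} = at p" by (rule at_within_Icc_at) (auto simp: a_def)
  ultimately show ?thesis by simp
qed

section \<open>Exponential decay from differential inequalities\<close>

definition exp_decay :: "(real \<Rightarrow> real) \<Rightarrow> bool" where
  "exp_decay f \<longleftrightarrow> (\<exists>C>0. \<exists>\<mu>>0. \<forall>t\<ge>0. f t \<le> C * exp (- \<mu> * t))"

lemma exp_decayI: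
  assumes "0 \<le> C" "0 < \<mu>" "\<And>t. 0 \<le> t \<Longrightarrow> f t \<le> C * exp (- \<mu> * t)"
  shows "exp_decay f"
proof -
  have "f t \<le> (C + 1) * exp (- \<mu> * t)" if "0 \<le> t" for t
    using assms(3)[OF that] by (simp add: distrib_right add_increasing2)
  then show ?thesis using assms(1,2) unfolding exp_decay_def by (intro exI[of _ "C + 1"]) auto
qed

lemma exp_decay_mono:
  "exp_decay g \<Longrightarrow> (\<And>t. 0 \<le> t \<Longrightarrow> f t \<le> g t) \<Longrightarrow> exp_decay f"
  unfolding exp_decay_def by (meson order_trans)

lemma exp_decay_common_rate:
  assumes "exp_decay f" "exp_decay g"
  obtains C \<mu> where "0 < C" "0 < \<mu>" "\<And>t. 0 \<le> t \<Longrightarrow> f t \<le> C * exp (- \<mu> * t)"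
    "\<And>t. 0 \<le> t \<Longrightarrow> g t \<le> C * exp (- \<mu> * t)"
proof -
  from assms obtain C1 m1 C2 m2 where h: "0 < C1" "0 < m1" "0 < C2" "0 < m2"
    "\<And>t. 0 \<le> t \<Longrightarrow> f t \<le> C1 * exp (- m1 * t)" "\<And>t. 0 \<le> t \<Longrightarrow> g t \<le> C2 * exp (- m2 * t)"
    unfolding exp_decay_def by blast
  have mono: "a * exp (- m * t) \<le> max C1 C2 * exp (- min m1 m2 * t)"
    if "a \<le> max C1 C2" "min m1 m2 \<le> m" "0 \<le> t" for a m t
    using that h by (intro mult_mono) (auto simp: mult_right_mono)
  show ?thesis
  proof
    show "f t \<le> max C1 C2 * exp (- min m1 m2 * t)" if "0 \<le> t" for t
      using h(5)[OF that] mono[of C1 m1 t] that by simp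
    show "g t \<le> max C1 C2 * exp (- min m1 m2 * t)" if "0 \<le> t" for t
      using h(6)[OF that] mono[of C2 m2 t] that by simp
  qed (use h in auto)
qed

lemma exp_decay_add: "exp_decay f \<Longrightarrow> exp_decay g \<Longrightarrow> exp_decay (\<lambda>t. f t + g t)"
  by (erule (1) exp_decay_common_rate, rule_tac C = "C + C" and \<mu> = \<mu> in exp_decayI)
     (force simp: distrib_right intro: add_mono)+

lemma exp_decay_cmult: "exp_decay f \<Longrightarrow> 0 \<le> c \<Longrightarrow> exp_decay (\<lambda>t. c * f t)"
proof -
  assume "exp_decay f" "0 \<le> c"
  then obtain C \<mu> where h: "0 < C" "0 < \<mu>" "\<And>t. 0 \<le> t \<Longrightarrow> f t \<le> C * exp (- \<mu> * t)"
    unfolding exp_decay_def by blast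
  show ?thesis
    by (rule exp_decayI[of "c * C" \<mu>]) (use h \<open>0 \<le> c\<close> in \<open>auto simp: mult.assoc mult_left_mono\<close>)
qed

lemma exp_decay_bounded:
  assumes "exp_decay f"
  obtains B where "0 < B" "\<And>t. 0 \<le> t \<Longrightarrow> f t \<le> B"
proof -
  from assms obtain C \<mu> where h: "0 < C" "0 < \<mu>" "\<And>t. 0 \<le> t \<Longrightarrow> f t \<le> C * exp (- \<mu> * t)"
    unfolding exp_decay_def by blast
  have "f t \<le> C" if "0 \<le> t" for t
  proof -
    have "C * exp (- \<mu> * t) \<le> C * 1" using h that by (intro mult_left_mono) auto
    then show ?thesis using h(3)[OF that] by simp
  qed
  with that h(1) show ?thesis by blast
qed

lemma exp_decay_of_linear_inequality:
  fixes f :: "real \<Rightarrow> real"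
  assumes "\<And>t. 0 \<le> t \<Longrightarrow> (f has_real_derivative f' t) (at t within {0..})"
    and "\<And>t. 0 \<le> t \<Longrightarrow> f' t \<le> - \<mu> * f t" and "0 < \<mu>" and "0 \<le> f 0"
  shows "exp_decay f"
proof (rule exp_decayI[OF \<open>0 \<le> f 0\<close> \<open>0 < \<mu>\<close>])
  fix t :: real assume "0 \<le> t"
  have "exp (\<mu> * t) * f t \<le> exp (\<mu> * 0) * f 0"
  proof (rule nonincreasing_Ici[where f = "\<lambda>t. exp (\<mu> * t) * f t"
        and f' = "\<lambda>t. exp (\<mu> * t) * (\<mu> * f t + f' t)"])
    fix s :: real assume "0 \<le> s"
    show "((\<lambda>t. exp (\<mu> * t) * f t) has_real_derivative exp (\<mu> * s) * (\<mu> * f s + f' s))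
        (at s within {0..})"
      by (auto intro!: derivative_eq_intros assms(1) \<open>0 \<le> s\<close> simp: algebra_simps)
  next
    fix s :: real assume "0 \<le> s"
    then show "exp (\<mu> * s) * (\<mu> * f s + f' s) \<le> 0"
      using assms(2)[of s] by (simp add: mult_le_0_iff)
  qed (use \<open>0 \<le> t\<close> in auto)
  then show "f t \<le> f 0 * exp (- \<mu> * t)"
    by (simp add: exp_minus field_simps)
qed

text \<open>A nonlinear Gronwall lemma. A quantity \<open>E\<close> that decays and is consumed at rate \<open>y\<close> makes the
  integral of \<open>y\<close> over unit time intervals decay. The factor \<open>(1 + y)\<^sup>2\<close> in the growth bound is removed
  by passing to \<open>z = y / (1 + y)\<close>, which is small only if \<open>y\<close> is small and grows at most linearly in
  \<open>y\<close>. The function \<open>(\<tau> - t) z + (1 + K) E\<close> is then almost nonincreasing on \<open>[t, t + 1]\<close>, which turns the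
  integral bound into a pointwise one.\<close>

lemma exp_decay_of_dissipation:
  fixes y E :: "real \<Rightarrow> real"
  assumes dy: "\<And>t. 0 \<le> t \<Longrightarrow> (y has_real_derivative y' t) (at t within {0..})"
    and dE: "\<And>t. 0 \<le> t \<Longrightarrow> (E has_real_derivative E' t) (at t within {0..})"
    and y0: "\<And>t. 0 \<le> t \<Longrightarrow> 0 \<le> y t" and E0: "\<And>t. 0 \<le> t \<Longrightarrow> 0 \<le> E t"
    and decE: "exp_decay E" and decr: "exp_decay r"
    and diss: "\<And>t. 0 \<le> t \<Longrightarrow> E' t \<le> - y t + r t"
    and growth: "\<And>t. 0 \<le> t \<Longrightarrow> y' t \<le> (1 + y t)\<^sup>2 * (K * y t + r t)"
    and "0 \<le> K"
  shows "exp_decay y"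
proof -
  obtain C \<mu> where C: "0 < C" "0 < \<mu>" and EC: "\<And>t. 0 \<le> t \<Longrightarrow> E t \<le> C * exp (- \<mu> * t)"
    and rC: "\<And>t. 0 \<le> t \<Longrightarrow> r t \<le> C * exp (- \<mu> * t)"
    using exp_decay_common_rate[OF decE decr] by blast
  \<comment> \<open>The correction absorbs the error term \<open>r\<close> in the dissipation inequality.\<close>
  define G where "G t = E t + C / \<mu> * exp (- \<mu> * t)" for t
  define G' where "G' t = E' t - C * exp (- \<mu> * t)" for t
  have dG: "(G has_real_derivative G' t) (at t within {0..})" if "0 \<le> t" for t
    unfolding G_def G'_def using C
    by (auto intro!: derivative_eq_intros dE that)
  have G'y: "G' t \<le> - y t" if "0 \<le> t" for t
    using diss[OF that] rC[OF that] by (simp add: G'_def)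
  have G0: "0 \<le> G t" if "0 \<le> t" for t using E0[OF that] C by (simp add: G_def)
  have GC: "G t \<le> (C + C / \<mu>) * exp (- \<mu> * t)" if "0 \<le> t" for t
    using EC[OF that] by (simp add: G_def distrib_right)
  define z where "z t = y t / (1 + y t)" for t
  define z' where "z' t = y' t / (1 + y t)\<^sup>2" for t
  have dz: "(z has_real_derivative z' t) (at t within {0..})" if "0 \<le> t" for t
    unfolding z_def z'_def using y0[OF that]
    by (auto intro!: derivative_eq_intros dy that simp: power2_eq_square field_simps)
  have z'b: "z' t \<le> K * y t + C * exp (- \<mu> * t)" if "0 \<le> t" for t
  proof -
    have "z' t \<le> K * y t + r t"
      unfolding z'_def using y0[OF that] growth[OF that]
      by (subst pos_divide_le_eq) (auto simp: mult.commute)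
    then show ?thesis using rC[OF that] by simp
  qed
  have zy: "z t \<le> y t" if "0 \<le> t" for t
    using y0[OF that] by (simp add: z_def divide_le_eq mult_left_mono algebra_simps)
  define M where "M = (1 + K) * (C + C / \<mu>) + C"
  have M0: "0 < M" unfolding M_def using C \<open>0 \<le> K\<close> by (intro add_nonneg_pos mult_nonneg_nonneg) auto
  have zM: "z (t + 1) \<le> M * exp (- \<mu> * t)" if t: "0 \<le> t" for t
  proof -
    define c where "c = C * exp (- \<mu> * t)"
    have "(t + 1 - t) * z (t + 1) + (1 + K) * G (t + 1) - c * (t + 1)
        \<le> (t - t) * z t + (1 + K) * G t - c * t"
    proof (rule nonincreasing_Ici[where f = "\<lambda>\<tau>. (\<tau> - t) * z \<tau> + (1 + K) * G \<tau> - c * \<tau>"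
          and f' = "\<lambda>\<tau>. z \<tau> + (\<tau> - t) * z' \<tau> + (1 + K) * G' \<tau> - c"])
      fix \<tau> :: real assume "0 \<le> \<tau>"
      show "((\<lambda>\<tau>. (\<tau> - t) * z \<tau> + (1 + K) * G \<tau> - c * \<tau>) has_real_derivative
          z \<tau> + (\<tau> - t) * z' \<tau> + (1 + K) * G' \<tau> - c) (at \<tau> within {0..})"
        by (auto intro!: derivative_eq_intros dz dG \<open>0 \<le> \<tau>\<close>)
    next
      fix \<tau> :: real assume \<tau>: "t \<le> \<tau>" "\<tau> \<le> t + 1"
      then have \<tau>0: "0 \<le> \<tau>" using t by simp
      have "C * exp (- \<mu> * \<tau>) \<le> c" unfolding c_def using C \<tau> by (simp add: mult_left_mono)
      then have "z' \<tau> \<le> K * y \<tau> + c" using z'b[OF \<tau>0] by simp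
      then have "(\<tau> - t) * z' \<tau> \<le> (\<tau> - t) * (K * y \<tau> + c)"
        using \<tau> by (intro mult_left_mono) auto
      also have "\<dots> \<le> 1 * (K * y \<tau> + c)"
        using \<tau> y0[OF \<tau>0] \<open>0 \<le> K\<close> C by (intro mult_right_mono) (auto simp: c_def)
      finally have "(\<tau> - t) * z' \<tau> \<le> K * y \<tau> + c" by simp
      moreover have "(1 + K) * G' \<tau> \<le> (1 + K) * (- y \<tau>)"
        using G'y[OF \<tau>0] \<open>0 \<le> K\<close> by (intro mult_left_mono) auto
      ultimately show "z \<tau> + (\<tau> - t) * z' \<tau> + (1 + K) * G' \<tau> - c \<le> 0"
        using zy[OF \<tau>0] by (simp add: algebra_simps)
    qed (use t in auto)
    moreover have "0 \<le> (1 + K) * G (t + 1)" using G0[of "t + 1"] t \<open>0 \<le> K\<close> by simp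
    moreover have "(1 + K) * G t \<le> (1 + K) * ((C + C / \<mu>) * exp (- \<mu> * t))"
      using GC[OF t] \<open>0 \<le> K\<close> by (intro mult_left_mono) auto
    ultimately have "z (t + 1) \<le> (1 + K) * ((C + C / \<mu>) * exp (- \<mu> * t)) + c"
      by (simp add: algebra_simps)
    also have "\<dots> = M * exp (- \<mu> * t)" by (simp add: M_def c_def algebra_simps)
    finally show ?thesis .
  qed
  define T where "T = ln (2 * M + 1) / \<mu>"
  have T0: "0 \<le> T" unfolding T_def using M0 C by simp
  have late: "y (t + 1) \<le> 2 * (M * exp (- \<mu> * t))" if "T \<le> t" for t
  proof -
    have t0: "0 \<le> t" using that T0 by simp
    have "2 * M + 1 = exp (\<mu> * T)" unfolding T_def using M0 C by simp
    also have "\<dots> \<le> exp (\<mu> * t)" using that C by simp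
    finally have "M * exp (- \<mu> * t) \<le> 1 / 2" by (simp add: exp_minus field_simps)
    then have "z (t + 1) \<le> 1 / 2" using zM[OF t0] by simp
    moreover have y1: "0 \<le> y (t + 1)" using y0 t0 by simp
    ultimately have "y (t + 1) \<le> 1" by (simp add: z_def field_simps)
    then have "y (t + 1) * (1 + y (t + 1)) \<le> y (t + 1) * 2" using y1 by (intro mult_left_mono) auto
    then have "y (t + 1) \<le> 2 * z (t + 1)" using y1 by (simp add: z_def field_simps)
    then show ?thesis using zM[OF t0] by simp
  qed
  have "continuous_on {0..} y" using dy by (intro DERIV_continuous_on[of _ y y']) auto
  then have "continuous_on {0..T + 1} y" by (rule continuous_on_subset) auto
  then obtain m where m: "m \<in> {0..T + 1}" "\<And>t. t \<in> {0..T + 1} \<Longrightarrow> y t \<le> y m"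
    using continuous_attains_sup[of "{0..T + 1}" y] T0 by fastforce
  define B where "B = y m"
  have B: "0 \<le> B" "\<And>t. 0 \<le> t \<Longrightarrow> t \<le> T + 1 \<Longrightarrow> y t \<le> B"
    using m y0[of m] by (auto simp: B_def)
  show ?thesis
  proof (rule exp_decayI[of "2 * M * exp \<mu> + B * exp (\<mu> * (T + 1))" \<mu>])
    fix t :: real assume t: "0 \<le> t"
    show "y t \<le> (2 * M * exp \<mu> + B * exp (\<mu> * (T + 1))) * exp (- \<mu> * t)"
    proof (cases "t \<le> T + 1")
      case True
      have "\<mu> * t \<le> \<mu> * (T + 1)" using True C by (intro mult_left_mono) auto
      then have "B * 1 \<le> B * (exp (\<mu> * (T + 1)) * exp (- \<mu> * t))"
        using B by (intro mult_left_mono) (auto simp: exp_add[symmetric])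
      moreover have "0 \<le> 2 * M * exp \<mu> * exp (- \<mu> * t)" using M0 by simp
      ultimately show ?thesis using B(2)[OF t True] by (simp add: algebra_simps)
    next
      case False
      have "y t \<le> 2 * (M * exp (- \<mu> * (t - 1)))" using late[of "t - 1"] False by simp
      also have "exp (- \<mu> * (t - 1)) = exp \<mu> * exp (- \<mu> * t)"
        by (simp add: exp_add[symmetric] algebra_simps)
      finally have "y t \<le> 2 * M * exp \<mu> * exp (- \<mu> * t)" by (simp only: mult.assoc)
      moreover have "0 \<le> B * exp (\<mu> * (T + 1)) * exp (- \<mu> * t)" using B by simp
      ultimately show ?thesis unfolding distrib_right by linarith
    qed
  qed (use M0 B C in auto)
qed

section \<open>The isoperimetric inequality for closed curves with self-intersections\<close>

text \<open>The weight \<open>\<phi> = \<mu> tan (\<mu> (s - m))\<close> solves \<open>\<phi>' = \<mu>\<^sup>2 + \<phi>\<^sup>2\<close>, which makes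
  \<open>x'\<^sup>2 - \<mu>\<^sup>2 x\<^sup>2 + (\<phi> x\<^sup>2)'\<close> equal to the square \<open>(x' + \<phi> x)\<^sup>2\<close>. For \<open>\<mu> < \<pi> / (b - a)\<close> the weight is finite on the whole
  interval; the sharp constant is reached in the limit.\<close>

lemma wirtinger_dirichlet_subcritical:
  fixes x x' :: "real \<Rightarrow> real"
  assumes dx: "\<And>s. (x has_real_derivative x' s) (at s)" and cx': "continuous_on UNIV x'"
    and ends: "x a = 0" "x b = 0" and "a < b" and \<mu>: "0 < \<mu>" "\<mu> * (b - a) < pi"
  shows "\<mu>\<^sup>2 * integral {a..b} (\<lambda>s. (x s)\<^sup>2) \<le> integral {a..b} (\<lambda>s. (x' s)\<^sup>2)"
proof -
  define m where "m = (a + b) / 2"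
  define \<phi> where "\<phi> s = \<mu> * tan (\<mu> * (s - m))" for s
  have cos: "cos (\<mu> * (s - m)) \<noteq> 0" if "s \<in> {a..b}" for s
  proof -
    have "\<mu> * (s - m) \<le> \<mu> * ((b - a) / 2)" "\<mu> * (- ((b - a) / 2)) \<le> \<mu> * (s - m)"
      using that \<mu>(1) by (intro mult_left_mono; simp add: m_def field_simps)+
    moreover have "\<mu> * ((b - a) / 2) < pi / 2" "\<mu> * (- ((b - a) / 2)) = - (\<mu> * ((b - a) / 2))"
      using \<mu> by auto
    ultimately have "- (pi / 2) < \<mu> * (s - m)" "\<mu> * (s - m) < pi / 2" by linarith+
    then show ?thesis using cos_gt_zero_pi by force
  qed
  have dphi: "(\<phi> has_real_derivative \<mu>\<^sup>2 + (\<phi> s)\<^sup>2) (at s)" if "s \<in> {a..b}" for s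
  proof -
    have "1 + (tan (\<mu> * (s - m)))\<^sup>2 = inverse ((cos (\<mu> * (s - m)))\<^sup>2)"
      using cos[OF that] by (simp add: tan_def field_simps power2_eq_square)
    then have eq: "inverse ((cos (\<mu> * (s - m)))\<^sup>2) = 1 + (tan (\<mu> * (s - m)))\<^sup>2" ..
    have "\<mu> * (inverse ((cos (\<mu> * (s - m)))\<^sup>2) * \<mu>) = \<mu>\<^sup>2 + (\<phi> s)\<^sup>2"
      unfolding \<phi>_def eq by (simp add: power2_eq_square distrib_left mult_ac)
    moreover have "(\<phi> has_real_derivative \<mu> * (inverse ((cos (\<mu> * (s - m)))\<^sup>2) * \<mu>)) (at s)"
      unfolding \<phi>_def using cos[OF that] by (auto intro!: derivative_eq_intros)
    ultimately show ?thesis by simp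
  qed
  define W where "W s = (\<mu>\<^sup>2 + (\<phi> s)\<^sup>2) * (x s)\<^sup>2 + \<phi> s * (2 * x s * x' s)" for s
  have "(W has_integral (\<phi> b * (x b)\<^sup>2 - \<phi> a * (x a)\<^sup>2)) {a..b}"
    unfolding W_def
    by (rule fundamental_theorem_of_calculus)
       (use \<open>a < b\<close> in \<open>auto simp: has_real_derivative_iff_has_vector_derivative[symmetric]
          intro!: derivative_eq_intros has_field_derivative_at_within[OF dphi]
            has_field_derivative_at_within[OF dx] simp: power2_eq_square algebra_simps\<close>)
  then have W: "(W has_integral 0) {a..b}" using ends by simp
  have cx: "continuous_on S x" for S
    using dx by (rule continuous_on_of_derivative)
  have i1: "(\<lambda>s. (x s)\<^sup>2) integrable_on {a..b}" and i2: "(\<lambda>s. (x' s)\<^sup>2) integrable_on {a..b}"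
    using cx continuous_on_subset[OF cx' subset_UNIV]
    by (auto intro!: integrable_continuous_real continuous_intros)
  have "((\<lambda>s. (x' s)\<^sup>2 - \<mu>\<^sup>2 * (x s)\<^sup>2 + W s) has_integral
      integral {a..b} (\<lambda>s. (x' s)\<^sup>2) - \<mu>\<^sup>2 * integral {a..b} (\<lambda>s. (x s)\<^sup>2) + 0) {a..b}"
    by (intro has_integral_add has_integral_diff has_integral_mult_right integrable_integral i1 i2 W)
  then have "0 \<le> integral {a..b} (\<lambda>s. (x' s)\<^sup>2) - \<mu>\<^sup>2 * integral {a..b} (\<lambda>s. (x s)\<^sup>2) + 0"
  proof (rule has_integral_nonneg)
    fix s
    have "(x' s)\<^sup>2 - \<mu>\<^sup>2 * (x s)\<^sup>2 + W s = (x' s + \<phi> s * x s)\<^sup>2"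
      by (simp add: W_def power2_eq_square algebra_simps)
    then show "0 \<le> (x' s)\<^sup>2 - \<mu>\<^sup>2 * (x s)\<^sup>2 + W s" by simp
  qed
  then show ?thesis by simp
qed

lemma wirtinger_dirichlet:
  fixes x x' :: "real \<Rightarrow> real"
  assumes dx: "\<And>s. (x has_real_derivative x' s) (at s)" and cx': "continuous_on UNIV x'"
    and ends: "x a = 0" "x b = 0" and "a < b"
  shows "(pi / (b - a))\<^sup>2 * integral {a..b} (\<lambda>s. (x s)\<^sup>2) \<le> integral {a..b} (\<lambda>s. (x' s)\<^sup>2)"
proof (rule field_le_mult_one_interval)
  fix z :: real assume z: "0 < z" "z < 1"
  define \<mu> where "\<mu> = sqrt z * (pi / (b - a))"
  have "\<mu> * (b - a) = sqrt z * pi" using \<open>a < b\<close> by (simp add: \<mu>_def)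
  also have "\<dots> < 1 * pi" using z by (intro mult_strict_right_mono) auto
  finally have "\<mu>\<^sup>2 * integral {a..b} (\<lambda>s. (x s)\<^sup>2) \<le> integral {a..b} (\<lambda>s. (x' s)\<^sup>2)"
    using z \<open>a < b\<close> by (intro wirtinger_dirichlet_subcritical assms) (auto simp: \<mu>_def)
  moreover have "\<mu>\<^sup>2 = z * (pi / (b - a))\<^sup>2" using z by (simp add: \<mu>_def power_mult_distrib power_divide)
  ultimately show "z * ((pi / (b - a))\<^sup>2 * integral {a..b} (\<lambda>s. (x s)\<^sup>2))
      \<le> integral {a..b} (\<lambda>s. (x' s)\<^sup>2)" by (simp add: mult.assoc)
qed

lemma integral_over_period:
  fixes h :: "real \<Rightarrow> real"
  assumes h: "continuous_on UNIV h" and per: "\<And>s. h (s + L) = h s" and a: "0 \<le> a" "a \<le> L"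
  shows "integral {a..a + L} h = integral {0..L} h"
proof -
  have int: "h integrable_on {c..d}" for c d
    by (rule integrable_continuous_real[OF continuous_on_subset[OF h]]) auto
  have "integral {0..a} h + integral {a..L} h = integral {0..L} h"
    by (rule Henstock_Kurzweil_Integration.integral_combine[OF _ _ int]) (use a in auto)
  moreover have "integral {a..L} h + integral {L..a + L} h = integral {a..a + L} h"
    by (rule Henstock_Kurzweil_Integration.integral_combine[OF _ _ int]) (use a in auto)
  moreover have "integral {L..a + L} h = integral {0..a} h"
    using integral_shift_real_ivl[of L L "a + L" h] per by simp
  ultimately show ?thesis by simp
qed

text \<open>Hurwitz' argument. Two parameters half a period apart have the same abscissa \<open>x\<close>; measuring \<open>x\<close> from
  there, Wirtinger's inequality on both halves bounds \<open>\<integral>x\<^sup>2\<close> by \<open>\<integral>x'\<^sup>2\<close>, and what remains of \<open>L\<^sup>2 - 4\<pi>A\<close> is the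
  integral of a square.\<close>

theorem isoperimetric_inequality:
  fixes x y x' y' :: "real \<Rightarrow> real"
  assumes dx: "\<And>s. (x has_real_derivative x' s) (at s)"
    and dy: "\<And>s. (y has_real_derivative y' s) (at s)"
    and cx': "continuous_on UNIV x'" and cy': "continuous_on UNIV y'"
    and perx: "\<And>s. x (s + L) = x s" and pery: "\<And>s. y (s + L) = y s"
    and perx': "\<And>s. x' (s + L) = x' s"
    and unit: "\<And>s. (x' s)\<^sup>2 + (y' s)\<^sup>2 = 1" and "0 < L"
  shows "4 * pi * integral {0..L} (\<lambda>s. x s * y' s) \<le> L\<^sup>2"
proof -
  define c where "c = 2 * pi / L"
  have c: "0 < c" using \<open>0 < L\<close> by (simp add: c_def)
  have cx: "continuous_on S x" and cy: "continuous_on S y" for S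
    by (rule continuous_on_of_derivative[OF dx], rule continuous_on_of_derivative[OF dy])
  obtain a where a: "0 \<le> a" "a \<le> L / 2" "x a = x (a + L / 2)"
  proof -
    define g where "g s = x s - x (s + L / 2)" for s
    have "continuous_on {0..L / 2} g"
      unfolding g_def by (intro continuous_intros cx continuous_on_compose2[OF cx[of UNIV]]) auto
    moreover have "g (L / 2) = - g 0" using perx[of 0] by (simp add: g_def)
    ultimately have "\<exists>s\<ge>0. s \<le> L / 2 \<and> g s = 0"
      using IVT'[of g 0 0 "L / 2"] IVT2'[of g "L / 2" 0 0] \<open>0 < L\<close> by (cases "g 0 \<le> 0") auto
    then show ?thesis using that by (auto simp: g_def)
  qed
  define w where "w s = x s - x a" for s
  have dw: "(w has_real_derivative x' s) (at s)" for s
    unfolding w_def by (auto intro!: derivative_eq_intros dx)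
  have cw: "continuous_on S w" for S unfolding w_def by (intro continuous_intros cx)
  have ends: "w a = 0" "w (a + L / 2) = 0" "w (a + L) = 0"
    using a(3) perx[of a] by (simp_all add: w_def)
  have int: "h integrable_on {p..q}" if "continuous_on UNIV h" for h :: "real \<Rightarrow> real" and p q
    by (rule integrable_continuous_real[OF continuous_on_subset[OF that]]) auto
  have comb: "integral {a..a + L / 2} h + integral {a + L / 2..a + L} h = integral {a..a + L} h"
    if "continuous_on UNIV h" for h :: "real \<Rightarrow> real"
    by (rule Henstock_Kurzweil_Integration.integral_combine[OF _ _ int[OF that]])
       (use \<open>0 < L\<close> in auto)
  have cw2: "continuous_on UNIV (\<lambda>s. (w s)\<^sup>2)" and cx'2: "continuous_on UNIV (\<lambda>s. (x' s)\<^sup>2)"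
    by (intro continuous_intros cw cx')+
  have "c\<^sup>2 * integral {a..a + L / 2} (\<lambda>s. (w s)\<^sup>2) \<le> integral {a..a + L / 2} (\<lambda>s. (x' s)\<^sup>2)"
    using wirtinger_dirichlet[OF dw cx' ends(1,2)] \<open>0 < L\<close> by (simp add: c_def mult.commute)
  moreover have "c\<^sup>2 * integral {a + L / 2..a + L} (\<lambda>s. (w s)\<^sup>2)
      \<le> integral {a + L / 2..a + L} (\<lambda>s. (x' s)\<^sup>2)"
    using wirtinger_dirichlet[OF dw cx' ends(2,3)] \<open>0 < L\<close> by (simp add: c_def mult.commute)
  ultimately have "c\<^sup>2 * integral {a..a + L} (\<lambda>s. (w s)\<^sup>2) \<le> integral {a..a + L} (\<lambda>s. (x' s)\<^sup>2)"
    unfolding comb[OF cw2, symmetric] comb[OF cx'2, symmetric] distrib_left by (rule add_mono)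
  moreover have "integral {a..a + L} (\<lambda>s. (w s)\<^sup>2) = integral {0..L} (\<lambda>s. (w s)\<^sup>2)"
    by (rule integral_over_period[OF cw2]) (use perx a \<open>0 < L\<close> in \<open>auto simp: w_def\<close>)
  moreover have "integral {a..a + L} (\<lambda>s. (x' s)\<^sup>2) = integral {0..L} (\<lambda>s. (x' s)\<^sup>2)"
    by (rule integral_over_period[OF cx'2]) (use perx' a \<open>0 < L\<close> in auto)
  ultimately have wirt: "c\<^sup>2 * integral {0..L} (\<lambda>s. (w s)\<^sup>2) \<le> integral {0..L} (\<lambda>s. (x' s)\<^sup>2)"
    by simp
  have y'0: "(y' has_integral 0) {0..L}"
    using fundamental_theorem_of_calculus[of 0 L y y'] \<open>0 < L\<close> dy pery[of 0]
    by (auto simp: has_real_derivative_iff_has_vector_derivative[symmetric]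
        intro: has_field_derivative_at_within)
  have xy: "((\<lambda>s. w s * y' s) has_integral integral {0..L} (\<lambda>s. x s * y' s)) {0..L}"
  proof -
    have "((\<lambda>s. x s * y' s - x a * y' s) has_integral
        integral {0..L} (\<lambda>s. x s * y' s) - x a * 0) {0..L}"
      by (intro has_integral_diff has_integral_mult_right y'0 integrable_integral int
          continuous_intros cx cy')
    then show ?thesis by (simp add: w_def left_diff_distrib)
  qed
  have "((\<lambda>s. 1 - (x' s)\<^sup>2 + c\<^sup>2 * (w s)\<^sup>2 - 2 * c * (w s * y' s)) has_integral
      (L - integral {0..L} (\<lambda>s. (x' s)\<^sup>2) + c\<^sup>2 * integral {0..L} (\<lambda>s. (w s)\<^sup>2)
        - 2 * c * integral {0..L} (\<lambda>s. x s * y' s))) {0..L}"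
    using has_integral_const_real[of "1::real" 0 L] \<open>0 < L\<close>
    by (intro has_integral_diff has_integral_add has_integral_mult_right xy integrable_integral
        int cw2 cx'2) auto
  then have "0 \<le> L - integral {0..L} (\<lambda>s. (x' s)\<^sup>2) + c\<^sup>2 * integral {0..L} (\<lambda>s. (w s)\<^sup>2)
        - 2 * c * integral {0..L} (\<lambda>s. x s * y' s)"
  proof (rule has_integral_nonneg)
    fix s
    have "1 - (x' s)\<^sup>2 + c\<^sup>2 * (w s)\<^sup>2 - 2 * c * (w s * y' s) = (y' s - c * w s)\<^sup>2"
      using unit[of s] by (simp add: power2_eq_square algebra_simps)
    then show "0 \<le> 1 - (x' s)\<^sup>2 + c\<^sup>2 * (w s)\<^sup>2 - 2 * c * (w s * y' s)" by simp
  qed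
  then have "2 * c * integral {0..L} (\<lambda>s. x s * y' s) \<le> L" using wirt by simp
  then have "2 * c * integral {0..L} (\<lambda>s. x s * y' s) * L \<le> L * L"
    using \<open>0 < L\<close> by (intro mult_right_mono) auto
  then show ?thesis using \<open>0 < L\<close> by (simp add: c_def power2_eq_square)
qed

section \<open>Integration along a closed curve\<close>

text \<open>Integrals with respect to arc length are pulled back to the parameter interval, where they carry
  the speed as weight. Accordingly a function whose parameter derivative is \<open>v \<cdot> g'\<close> has arc-length
  derivative \<open>g'\<close>.\<close>

definition arc_integral :: "(real \<Rightarrow> real) \<Rightarrow> (real \<Rightarrow> real) \<Rightarrow> real" where
  "arc_integral v g = integral {0..1} (\<lambda>p. g p * v p)"

locale speed =
  fixes v :: "real \<Rightarrow> real"
  assumes v_pos: "0 < v p" and v_cont: "continuous_on UNIV v"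
begin

lemma v_cont': "continuous_on S v"
  using v_cont by (rule continuous_on_subset) simp

lemma weighted_integrable:
  "continuous_on {0..1} g \<Longrightarrow> (\<lambda>p. g p * v p) integrable_on {0..1}"
  by (intro integrable_continuous_real continuous_intros v_cont')

lemma arc_integral_add:
  "continuous_on {0..1} f \<Longrightarrow> continuous_on {0..1} g \<Longrightarrow>
    arc_integral v (\<lambda>p. f p + g p) = arc_integral v f + arc_integral v g"
  unfolding arc_integral_def distrib_right
  by (intro Henstock_Kurzweil_Integration.integral_add weighted_integrable)

lemma arc_integral_cmult: "arc_integral v (\<lambda>p. c * f p) = c * arc_integral v f"
  unfolding arc_integral_def by (simp add: mult.assoc)

lemma arc_integral_diff:
  "continuous_on {0..1} f \<Longrightarrow> continuous_on {0..1} g \<Longrightarrow>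
    arc_integral v (\<lambda>p. f p - g p) = arc_integral v f - arc_integral v g"
  using arc_integral_add[of f "\<lambda>p. -1 * g p"] arc_integral_cmult[of "-1" g]
  by (simp add: continuous_on_minus)

lemma arc_integral_mono:
  "continuous_on {0..1} f \<Longrightarrow> continuous_on {0..1} g \<Longrightarrow>
    (\<And>p. 0 \<le> p \<Longrightarrow> p \<le> 1 \<Longrightarrow> f p \<le> g p) \<Longrightarrow> arc_integral v f \<le> arc_integral v g"
  unfolding arc_integral_def
  by (intro integral_le weighted_integrable mult_right_mono) (auto simp: less_imp_le[OF v_pos])

lemma arc_integral_nonneg:
  "(\<And>p. 0 \<le> p \<Longrightarrow> p \<le> 1 \<Longrightarrow> 0 \<le> f p) \<Longrightarrow> continuous_on {0..1} f \<Longrightarrow> 0 \<le> arc_integral v f"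
  unfolding arc_integral_def
  by (intro integral_nonneg weighted_integrable mult_nonneg_nonneg) (auto simp: less_imp_le[OF v_pos])

lemma arc_integral_const: "arc_integral v (\<lambda>p. c) = c * arc_integral v (\<lambda>p. 1)"
  using arc_integral_cmult[of c "\<lambda>p. 1"] by simp

lemma arc_integral_one_pos: "0 < arc_integral v (\<lambda>p. 1)"
proof -
  have "0 \<le> integral {0..1} v"
    by (intro integral_nonneg integrable_continuous_real v_cont') (auto simp: less_imp_le[OF v_pos])
  moreover have "integral {0..1} v \<noteq> 0"
  proof
    assume "integral {0..1} v = 0"
    then have "(v has_integral 0) {0..1}"
      using integrable_continuous_real[OF v_cont'[of "{0..1}"]] by (metis integrable_integral)
    then have "v 0 = 0"
      using has_integral_0_cbox_imp_0[of 0 1 v 0] v_cont' less_imp_le[OF v_pos] by auto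
    then show False using v_pos[of 0] by simp
  qed
  ultimately show ?thesis by (simp add: arc_integral_def)
qed

lemma arc_integral_derivative:
  assumes "\<And>p. (g has_real_derivative v p * g' p) (at p)" and "g 1 = g 0"
  shows "arc_integral v g' = 0"
proof -
  have "((\<lambda>p. g' p * v p) has_integral (g 1 - g 0)) {0..1}"
    by (rule fundamental_theorem_of_calculus)
       (use assms(1) in \<open>auto simp: has_real_derivative_iff_has_vector_derivative[symmetric] mult.commute
          intro: has_field_derivative_at_within\<close>)
  then show ?thesis unfolding arc_integral_def using assms(2) by (simp add: integral_unique)
qed

lemma arc_integral_by_parts:
  assumes f: "\<And>p. (f has_real_derivative v p * f' p) (at p)"
    and g: "\<And>p. (g has_real_derivative v p * g' p) (at p)"
    and "f 1 = f 0" "g 1 = g 0" and c: "continuous_on {0..1} f'" "continuous_on {0..1} g'"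
  shows "arc_integral v (\<lambda>p. f p * g' p) = - arc_integral v (\<lambda>p. f' p * g p)"
proof -
  have cf: "continuous_on {0..1} f" and cg: "continuous_on {0..1} g"
    by (rule continuous_on_of_derivative[OF f], rule continuous_on_of_derivative[OF g])
  have "arc_integral v (\<lambda>p. f p * g' p + f' p * g p) = 0"
    by (rule arc_integral_derivative[of "\<lambda>p. f p * g p"])
       (use assms(3,4) in \<open>auto intro!: derivative_eq_intros f g simp: algebra_simps\<close>)
  moreover have "arc_integral v (\<lambda>p. f p * g' p + f' p * g p)
      = arc_integral v (\<lambda>p. f p * g' p) + arc_integral v (\<lambda>p. f' p * g p)"
    by (intro arc_integral_add continuous_intros cf cg c)
  ultimately show ?thesis by simp
qed

lemma oscillation_bound:
  assumes h: "\<And>p. (h has_real_derivative v p * h' p) (at p)" and c: "continuous_on {0..1} h'"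
    and p: "p \<in> {0..1}" and q: "q \<in> {0..1}"
  shows "\<bar>h p - h q\<bar> \<le> arc_integral v (\<lambda>p. \<bar>h' p\<bar>)"
proof -
  have main: "\<bar>h p - h q\<bar> \<le> arc_integral v (\<lambda>p. \<bar>h' p\<bar>)"
    if le: "q \<le> p" and p: "p \<in> {0..1}" and q: "q \<in> {0..1}" for p q
  proof -
    have sub: "{q..p} \<subseteq> {0..1}" using p q by auto
    have "((\<lambda>p. v p * h' p) has_integral (h p - h q)) {q..p}"
      by (rule fundamental_theorem_of_calculus[OF le])
         (use h in \<open>auto simp: has_real_derivative_iff_has_vector_derivative[symmetric]
            intro: has_field_derivative_at_within\<close>)
    then have "h p - h q = integral {q..p} (\<lambda>p. v p * h' p)" by (simp add: integral_unique)
    also have "\<bar>\<dots>\<bar> \<le> integral {q..p} (\<lambda>p. \<bar>h' p\<bar> * v p)"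
      using continuous_on_subset[OF c sub]
      by (intro integral_norm_bound_integral[where 'a = real, unfolded real_norm_def]
          integrable_continuous_real continuous_intros v_cont')
         (auto simp: abs_mult mult.commute less_imp_le[OF v_pos])
    also have "\<dots> \<le> integral {0..1} (\<lambda>p. \<bar>h' p\<bar> * v p)"
      using continuous_on_subset[OF c sub] c sub
      by (intro integral_subset_le integrable_continuous_real continuous_intros v_cont')
         (auto simp: less_imp_le[OF v_pos])
    finally show ?thesis by (simp add: arc_integral_def)
  qed
  show ?thesis using main[of q p] main[of p q] p q by (cases "q \<le> p") (auto simp: abs_minus_commute)
qed

lemma mean_zero_imp_zero:
  assumes c: "continuous_on {0..1} h" and z: "arc_integral v h = 0"
  obtains q where "q \<in> {0..1}" "h q = 0"
proof -
  have "\<exists>p\<in>{0..1}. h p \<le> 0"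
  proof (rule ccontr)
    assume "\<not> ?thesis"
    then have pos: "\<And>p. p \<in> {0..1} \<Longrightarrow> 0 < h p" by (meson not_le)
    obtain m where m: "m \<in> {0..1}" "\<And>p. p \<in> {0..1} \<Longrightarrow> h m \<le> h p"
      using continuous_attains_inf[OF _ _ c] by auto
    have "arc_integral v (\<lambda>p. h m) \<le> arc_integral v h"
      by (rule arc_integral_mono[OF _ c]) (use m(2) in auto)
    then show False
      using pos[OF m(1)] arc_integral_one_pos z arc_integral_const[of "h m"]
      by (auto simp: mult_le_0_iff)
  qed
  moreover have "\<exists>p\<in>{0..1}. 0 \<le> h p"
  proof (rule ccontr)
    assume "\<not> ?thesis"
    then have neg: "\<And>p. p \<in> {0..1} \<Longrightarrow> h p < 0" by (meson not_le)
    obtain m where m: "m \<in> {0..1}" "\<And>p. p \<in> {0..1} \<Longrightarrow> h p \<le> h m"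
      using continuous_attains_sup[OF _ _ c] by auto
    have "arc_integral v h \<le> arc_integral v (\<lambda>p. h m)"
      by (rule arc_integral_mono[OF c]) (use m(2) in auto)
    then show False
      using neg[OF m(1)] arc_integral_one_pos z arc_integral_const[of "h m"]
      by (auto simp: zero_le_mult_iff)
  qed
  ultimately obtain p1 p2 where p: "p1 \<in> {0..1}" "p2 \<in> {0..1}" "h p1 \<le> 0" "0 \<le> h p2" by blast
  have "connected (h ` {0..1})" by (intro connected_continuous_image c) auto
  then have "0 \<in> h ` {0..1}"
    using p connectedD_interval[of "h ` {0..1}" "h p1" "h p2" 0] by auto
  with that show ?thesis by auto
qed

text \<open>The variance of \<open>|g|\<close> with respect to arc length is nonnegative.\<close>

lemma arc_integral_Cauchy_Schwarz:
  assumes c: "continuous_on {0..1} g"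
  shows "(arc_integral v (\<lambda>p. \<bar>g p\<bar>))\<^sup>2 \<le> arc_integral v (\<lambda>p. 1) * arc_integral v (\<lambda>p. (g p)\<^sup>2)"
proof -
  define L where "L = arc_integral v (\<lambda>p. 1)"
  define m where "m = arc_integral v (\<lambda>p. \<bar>g p\<bar>)"
  have L: "0 < L" using arc_integral_one_pos by (simp add: L_def)
  have "0 \<le> arc_integral v (\<lambda>p. (\<bar>g p\<bar> - m / L)\<^sup>2)"
    by (intro arc_integral_nonneg continuous_intros c) auto
  also have "(\<lambda>p. (\<bar>g p\<bar> - m / L)\<^sup>2) = (\<lambda>p. (g p)\<^sup>2 - 2 * (m / L) * \<bar>g p\<bar> + (m / L)\<^sup>2)"
    by (rule ext) (simp add: power2_diff)
  also have "arc_integral v \<dots> = arc_integral v (\<lambda>p. (g p)\<^sup>2) - 2 * (m / L) * m + (m / L)\<^sup>2 * L"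
  proof -
    have "arc_integral v (\<lambda>p. 2 * (m / L) * \<bar>g p\<bar>) = 2 * (m / L) * m"
      unfolding m_def by (rule arc_integral_cmult)
    moreover have "arc_integral v (\<lambda>p. (m / L)\<^sup>2) = (m / L)\<^sup>2 * L"
      unfolding L_def by (rule arc_integral_const)
    moreover have "arc_integral v (\<lambda>p. (g p)\<^sup>2 - 2 * (m / L) * \<bar>g p\<bar> + (m / L)\<^sup>2)
        = arc_integral v (\<lambda>p. (g p)\<^sup>2 - 2 * (m / L) * \<bar>g p\<bar>) + arc_integral v (\<lambda>p. (m / L)\<^sup>2)"
      by (intro arc_integral_add continuous_intros c)
    moreover have "arc_integral v (\<lambda>p. (g p)\<^sup>2 - 2 * (m / L) * \<bar>g p\<bar>)
        = arc_integral v (\<lambda>p. (g p)\<^sup>2) - arc_integral v (\<lambda>p. 2 * (m / L) * \<bar>g p\<bar>)"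
      by (intro arc_integral_diff continuous_intros c)
    ultimately show ?thesis by simp
  qed
  finally have "m\<^sup>2 / L \<le> arc_integral v (\<lambda>p. (g p)\<^sup>2)"
    using L by (simp add: power2_eq_square field_simps)
  then show ?thesis unfolding L_def[symmetric] m_def[symmetric] using L
    by (simp add: field_simps)
qed

lemma mean_zero_sup_bound:
  assumes h: "\<And>p. (h has_real_derivative v p * h' p) (at p)" and c: "continuous_on {0..1} h'"
    and z: "arc_integral v h = 0" and p: "p \<in> {0..1}"
  shows "(h p)\<^sup>2 \<le> arc_integral v (\<lambda>p. 1) * arc_integral v (\<lambda>p. (h' p)\<^sup>2)"
proof -
  have ch: "continuous_on {0..1} h"
    using h by (rule continuous_on_of_derivative)
  obtain q where q: "q \<in> {0..1}" "h q = 0" using mean_zero_imp_zero[OF ch z] .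
  have "\<bar>h p\<bar> \<le> arc_integral v (\<lambda>p. \<bar>h' p\<bar>)" using oscillation_bound[OF h c p q(1)] q(2) by simp
  then have "\<bar>h p\<bar>\<^sup>2 \<le> (arc_integral v (\<lambda>p. \<bar>h' p\<bar>))\<^sup>2" by (rule power_mono) simp
  then show ?thesis using arc_integral_Cauchy_Schwarz[OF c] by simp
qed

text \<open>An interpolated sup bound, obtained by applying the oscillation bound to \<open>h\<^sup>2\<close>. The free
  parameter \<open>\<alpha>\<close> takes the place of the product \<open>\<parallel>h\<parallel> \<parallel>h'\<parallel>\<close>.\<close>

lemma mean_zero_interpolated_sup_bound:
  assumes h: "\<And>p. (h has_real_derivative v p * h' p) (at p)" and c: "continuous_on {0..1} h'"
    and z: "arc_integral v h = 0" and p: "p \<in> {0..1}" and "0 < \<alpha>"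
  shows "(h p)\<^sup>2 \<le> \<alpha> * arc_integral v (\<lambda>p. (h p)\<^sup>2) + arc_integral v (\<lambda>p. (h' p)\<^sup>2) / \<alpha>"
proof -
  have ch: "continuous_on {0..1} h"
    using h by (rule continuous_on_of_derivative)
  obtain q where q: "q \<in> {0..1}" "h q = 0" using mean_zero_imp_zero[OF ch z] .
  have "\<bar>(h p)\<^sup>2 - (h q)\<^sup>2\<bar> \<le> arc_integral v (\<lambda>p. \<bar>2 * h p * h' p\<bar>)"
    by (rule oscillation_bound[OF _ _ p q(1), of "\<lambda>p. (h p)\<^sup>2"])
       (auto intro!: derivative_eq_intros h continuous_intros ch c)
  also have "\<dots> \<le> arc_integral v (\<lambda>p. \<alpha> * (h p)\<^sup>2 + (1 / \<alpha>) * (h' p)\<^sup>2)"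
  proof (rule arc_integral_mono)
    fix p
    have "0 \<le> (\<alpha> * \<bar>h p\<bar> - \<bar>h' p\<bar>)\<^sup>2 / \<alpha>" using \<open>0 < \<alpha>\<close> by simp
    also have "\<dots> = \<alpha> * (h p)\<^sup>2 + (1 / \<alpha>) * (h' p)\<^sup>2 - 2 * \<bar>h p\<bar> * \<bar>h' p\<bar>"
      using \<open>0 < \<alpha>\<close> by (simp add: power2_diff field_simps power2_eq_square)
    finally show "\<bar>2 * h p * h' p\<bar> \<le> \<alpha> * (h p)\<^sup>2 + (1 / \<alpha>) * (h' p)\<^sup>2" by (simp add: abs_mult)
  qed (intro continuous_intros ch c)+
  also have "\<dots> = \<alpha> * arc_integral v (\<lambda>p. (h p)\<^sup>2) + (1 / \<alpha>) * arc_integral v (\<lambda>p. (h' p)\<^sup>2)"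
    by (subst arc_integral_add) (intro continuous_intros ch c | simp only: arc_integral_cmult)+
  finally show ?thesis using q(2) by simp
qed

end

section \<open>The geometry of a closed curve in terms of its parameter\<close>

lemma has_vector_derivative_vector2:
  fixes f :: "real \<Rightarrow> real^2"
  assumes "((\<lambda>x. f x $ 1) has_real_derivative d1) (at x)"
    and "((\<lambda>x. f x $ 2) has_real_derivative d2) (at x)"
  shows "(f has_vector_derivative vector [d1, d2]) (at x)"
proof -
  have "((\<lambda>x. f x \<bullet> i) has_derivative (\<lambda>h. h *\<^sub>R vector [d1, d2] \<bullet> i)) (at x)"
    if "i \<in> Basis" for i :: "real^2"
  proof -
    from that obtain j where "i = axis j 1" by (auto simp: Basis_vec_def)
    moreover have "j = 1 \<or> j = 2" by (rule exhaust_2)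
    ultimately show ?thesis
      using assms by (auto simp: inner_axis has_field_derivative_def mult.commute[of _ d1]
          mult.commute[of _ d2])
  qed
  then show ?thesis
    unfolding has_vector_derivative_def by (subst has_derivative_componentwise_within) blast
qed

lemma norm_vector2: "norm (vector [x, y] :: real^2) = sqrt (x\<^sup>2 + y\<^sup>2)"
  by (simp add: norm_eq_sqrt_inner inner_vec_def sum_2 power2_eq_square)

text \<open>The data of an immersed closed curve in an arbitrary parameter: speed \<open>v\<close>, unit tangent
  \<open>(a, b)\<close> and curvature \<open>k\<close>, linked by the Frenet equations.\<close>

locale closed_curve = speed v for v :: "real \<Rightarrow> real" +
  fixes \<gamma> :: "real \<Rightarrow> real^2" and a b k :: "real \<Rightarrow> real"
  assumes dx: "((\<lambda>q. \<gamma> q $ 1) has_real_derivative v p * a p) (at p)"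
    and dy: "((\<lambda>q. \<gamma> q $ 2) has_real_derivative v p * b p) (at p)"
    and unit: "(a p)\<^sup>2 + (b p)\<^sup>2 = 1"
    and da: "(a has_real_derivative v p * (- k p * b p)) (at p)"
    and db: "(b has_real_derivative v p * (k p * a p)) (at p)"
    and k_cont: "continuous_on UNIV k"
    and \<gamma>_per: "\<gamma> (p + 1) = \<gamma> p" and v_per: "v (p + 1) = v p"
    and a_per: "a (p + 1) = a p" and b_per: "b (p + 1) = b p"
begin

abbreviation "ai \<equiv> arc_integral v"
abbreviation "len \<equiv> ai (\<lambda>p. 1)"
abbreviation "S \<equiv> arc_coord \<gamma>"
abbreviation "\<sigma> \<equiv> inv (arc_coord \<gamma>)"

lemma vector_derivative_\<gamma>: "vector_derivative \<gamma> (at p) = vector [v p * a p, v p * b p]"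
  by (intro vector_derivative_at has_vector_derivative_vector2 dx dy)

lemma norm_vector_derivative_\<gamma>: "norm (vector_derivative \<gamma> (at p)) = v p"
proof -
  have "(v p * a p)\<^sup>2 + (v p * b p)\<^sup>2 = (v p)\<^sup>2 * ((a p)\<^sup>2 + (b p)\<^sup>2)"
    by (simp add: power_mult_distrib algebra_simps)
  then show ?thesis
    using v_pos[of p] by (simp add: vector_derivative_\<gamma> norm_vector2 unit)
qed

lemma curve_length_eq: "curve_length \<gamma> = len"
  unfolding curve_length_def norm_vector_derivative_\<gamma> arc_integral_def by simp

lemma len_pos: "0 < len" by (rule arc_integral_one_pos)

lemma dS: "(S has_real_derivative v p) (at p)"
proof -
  \<comment> \<open>From a base point \<open>c\<close> to the left of \<open>0\<close> and \<open>p\<close> the arc coordinate is a single integral up to a constant.\<close>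
  define c where "c = min p 0 - 1"
  have int: "v integrable_on {s..t}" for s t by (intro integrable_continuous_real v_cont')
  have eq: "S q = integral {c..q} v - integral {c..0} v" if "c \<le> q" for q
  proof (cases "0 \<le> q")
    case True
    have "integral {c..0} v + integral {0..q} v = integral {c..q} v"
      by (rule Henstock_Kurzweil_Integration.integral_combine[OF _ True int]) (simp add: c_def)
    then show ?thesis using True unfolding arc_coord_def norm_vector_derivative_\<gamma> by (cases "q = 0") auto
  next
    case False
    have "integral {c..q} v + integral {q..0} v = integral {c..0} v"
      by (rule Henstock_Kurzweil_Integration.integral_combine[OF that _ int]) (use False in simp)
    then show ?thesis using False unfolding arc_coord_def norm_vector_derivative_\<gamma> by auto
  qed
  have "((\<lambda>q. integral {c..q} v) has_real_derivative v p) (at p within {c..p + 1})"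
    by (rule integral_has_real_derivative[OF v_cont']) (simp add: c_def)
  then have "((\<lambda>q. integral {c..q} v - integral {c..0} v) has_real_derivative v p)
      (at p within {c..p + 1})"
    by (auto intro!: derivative_eq_intros)
  then have "(S has_real_derivative v p) (at p within {c..p + 1})"
    by (rule has_real_derivative_eq_on) (auto simp: eq, simp add: c_def)
  moreover have "at p within {c..p + 1} = at p" by (rule at_within_Icc_at) (auto simp: c_def)
  ultimately show ?thesis by simp
qed

lemma S_0: "S 0 = 0" and S_1: "S 1 = len"
  unfolding arc_coord_def norm_vector_derivative_\<gamma> arc_integral_def by simp_all

lemma S_strict_mono: "p < q \<Longrightarrow> S p < S q"
  using dS v_pos by (meson DERIV_pos_imp_increasing)

lemma S_cont: "continuous_on A S" and S_isCont: "isCont S p"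
  by (rule continuous_on_of_derivative[OF dS], rule DERIV_isCont[OF dS])

lemma S_per: "S (p + 1) = S p + len"
proof -
  have "((\<lambda>p. S (p + 1) - S p) has_real_derivative 0) (at p)" for p
  proof -
    have "((\<lambda>p. S (p + 1)) has_real_derivative v (p + 1) * 1) (at p)"
      by (rule DERIV_chain2[OF dS]) (auto intro!: derivative_eq_intros)
    from DERIV_diff[OF this dS[of p]] show ?thesis by (simp add: v_per)
  qed
  then have "S (p + 1) - S p = S (0 + 1) - S 0" by (intro DERIV_isconst_all) auto
  then show ?thesis by (simp add: S_0 S_1)
qed

lemma S_bij: "bij S"
proof (rule bijI)
  show "inj S" by (rule strict_mono_imp_inj_on) (simp add: strict_mono_def S_strict_mono)
  have per: "S (p + real n) = S p + real n * len" for p n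
  proof (induction n)
    case (Suc n)
    show ?case using Suc S_per[of "p + real n"] by (simp add: algebra_simps)
  qed simp
  show "surj S"
    unfolding surj_def
  proof
    fix s
    obtain n where n: "\<bar>s\<bar> < real n * len" using len_pos reals_Archimedean3 by blast
    have "S (real n) = real n * len" "S (- real n) = - (real n * len)"
      using per[of 0 n] per[of "- real n" n] by (simp_all add: S_0)
    then have "\<exists>p\<ge>- real n. p \<le> real n \<and> S p = s"
      using n by (intro IVT' S_cont) auto
    then show "\<exists>p. s = S p" by blast
  qed
qed

lemma \<sigma>_S [simp]: "\<sigma> (S p) = p" and S_\<sigma> [simp]: "S (\<sigma> s) = s"
  using S_bij by (simp_all add: bij_is_inj bij_is_surj surj_f_inv_f)

lemma d\<sigma>: "(\<sigma> has_real_derivative inverse (v (\<sigma> s))) (at s)"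
proof (rule DERIV_inverse_function[where f = S and a = "s - 1" and b = "s + 1"])
  show "(S has_real_derivative v (\<sigma> s)) (at (\<sigma> s))" by (rule dS)
  have "isCont \<sigma> (S (\<sigma> s))"
    by (rule isCont_inverse_function2[where f = S and a = "\<sigma> s - 1" and b = "\<sigma> s + 1"])
       (simp_all add: S_isCont)
  then show "isCont \<sigma> s" by simp
qed (use v_pos[of "\<sigma> s"] in auto)

lemma \<sigma>_per: "\<sigma> (s + len) = \<sigma> s + 1"
  using \<sigma>_S[of "\<sigma> s + 1"] by (simp add: S_per)

lemma arc_derivative:
  assumes "\<And>p. (g has_real_derivative v p * g' p) (at p)"
  shows "((\<lambda>s. g (\<sigma> s)) has_real_derivative g' (\<sigma> s)) (at s)"
  by (rule DERIV_cong[OF DERIV_chain2[OF assms d\<sigma>]]) (use v_pos[of "\<sigma> s"] in simp)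

lemma cont_\<sigma>: "continuous_on UNIV g \<Longrightarrow> continuous_on A (\<lambda>s. g (\<sigma> s))"
  by (rule continuous_on_compose2[of UNIV g A \<sigma>])
    (auto intro: continuous_on_of_derivative[OF d\<sigma>])

lemma integral_\<sigma>:
  assumes "continuous_on UNIV g"
  shows "integral {0..len} (\<lambda>s. g (\<sigma> s)) = ai g"
proof -
  have "((\<lambda>p. v p *\<^sub>R g (\<sigma> (S p))) has_integral (integral {S 0..S 1} (\<lambda>s. g (\<sigma> s)))) {0..1}"
  proof (rule has_integral_substitution[where c = 0 and d = len])
    have "S p \<in> {0..len}" if "p \<in> {0..1}" for p
      using that S_strict_mono[of 0 p] S_strict_mono[of p 1] len_pos
      by (cases "p = 0"; cases "p = 1") (auto simp: S_0 S_1)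
    then show "S ` {0..1} \<subseteq> {0..len}" by blast
  qed (auto simp: S_0 S_1 less_imp_le[OF len_pos] intro: cont_\<sigma> assms
      has_field_derivative_at_within dS)
  then show ?thesis by (simp add: arc_integral_def S_0 S_1 integral_unique mult.commute)
qed

lemma unit_tangent_eq: "unit_tangent \<gamma> s = vector [a (\<sigma> s), b (\<sigma> s)]"
  unfolding unit_tangent_def arc_param_def
  by (intro vector_derivative_at has_vector_derivative_vector2
      arc_derivative[of "\<lambda>p. \<gamma> p $ 1"] arc_derivative[of "\<lambda>p. \<gamma> p $ 2"] dx dy)

lemma unit_normal_eq: "unit_normal \<gamma> s = vector [- b (\<sigma> s), a (\<sigma> s)]"
  unfolding unit_normal_def unit_tangent_eq by simp

lemma curvature_vector_eq:
  "curvature_vector \<gamma> s = vector [- k (\<sigma> s) * b (\<sigma> s), k (\<sigma> s) * a (\<sigma> s)]"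
  unfolding curvature_vector_def unit_tangent_eq[abs_def]
  by (intro vector_derivative_at has_vector_derivative_vector2)
     (use arc_derivative[OF da] arc_derivative[OF db] in auto)

lemma curvature_eq: "curvature \<gamma> s = k (\<sigma> s)"
proof -
  have "curvature \<gamma> s = k (\<sigma> s) * ((a (\<sigma> s))\<^sup>2 + (b (\<sigma> s))\<^sup>2)"
    unfolding curvature_def curvature_vector_eq unit_normal_eq
    by (simp add: inner_vec_def sum_2 power2_eq_square algebra_simps)
  then show ?thesis by (simp add: unit)
qed

lemma x_cont: "continuous_on A (\<lambda>p. \<gamma> p $ 1)" and y_cont: "continuous_on A (\<lambda>p. \<gamma> p $ 2)"
  and a_cont: "continuous_on A a" and b_cont: "continuous_on A b"
  by (rule continuous_on_of_derivative[OF dx], rule continuous_on_of_derivative[OF dy],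
      rule continuous_on_of_derivative[OF da], rule continuous_on_of_derivative[OF db])

lemma k_cont': "continuous_on A k"
  using k_cont by (rule continuous_on_subset) simp

lemmas conts = x_cont y_cont a_cont b_cont k_cont'

lemma integral_curvature: "integral {0..curve_length \<gamma>} (curvature \<gamma>) = ai k"
  unfolding curvature_eq[abs_def] curve_length_eq by (rule integral_\<sigma>[OF k_cont])

lemma signed_area_eq: "signed_area \<gamma> = 1 / 2 * ai (\<lambda>p. \<gamma> p $ 1 * b p - \<gamma> p $ 2 * a p)"
proof -
  have "(\<lambda>s. arc_param \<gamma> s \<bullet> unit_normal \<gamma> s)
      = (\<lambda>s. (\<lambda>p. - 1 * (\<gamma> p $ 1 * b p - \<gamma> p $ 2 * a p)) (\<sigma> s))"
    by (rule ext) (simp add: arc_param_def unit_normal_eq inner_vec_def sum_2)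
  then have "integral {0..len} (\<lambda>s. arc_param \<gamma> s \<bullet> unit_normal \<gamma> s)
      = ai (\<lambda>p. - 1 * (\<gamma> p $ 1 * b p - \<gamma> p $ 2 * a p))"
    by (simp only:, intro integral_\<sigma> continuous_intros conts)
  then show ?thesis unfolding signed_area_def curve_length_eq arc_integral_cmult by simp
qed

lemma signed_area_eq': "signed_area \<gamma> = ai (\<lambda>p. \<gamma> p $ 1 * b p)"
proof -
  have "ai (\<lambda>p. \<gamma> p $ 1 * b p) = - ai (\<lambda>p. a p * \<gamma> p $ 2)"
    using \<gamma>_per[of 0] by (intro arc_integral_by_parts dx dy conts) auto
  moreover have "ai (\<lambda>p. \<gamma> p $ 1 * b p - \<gamma> p $ 2 * a p)
      = ai (\<lambda>p. \<gamma> p $ 1 * b p) - ai (\<lambda>p. \<gamma> p $ 2 * a p)"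
    by (intro arc_integral_diff continuous_intros conts)
  ultimately show ?thesis by (simp add: signed_area_eq mult.commute)
qed

lemma isoperimetric: "4 * pi * signed_area \<gamma> \<le> len\<^sup>2"
proof -
  have "4 * pi * integral {0..len} (\<lambda>s. \<gamma> (\<sigma> s) $ 1 * b (\<sigma> s)) \<le> len\<^sup>2"
    by (rule isoperimetric_inequality[of "\<lambda>s. \<gamma> (\<sigma> s) $ 1" "\<lambda>s. a (\<sigma> s)" "\<lambda>s. \<gamma> (\<sigma> s) $ 2"])
       (use arc_derivative[OF dx] arc_derivative[OF dy] in
         \<open>auto simp: \<sigma>_per \<gamma>_per a_per b_per unit len_pos intro: cont_\<sigma> conts\<close>)
  also have "integral {0..len} (\<lambda>s. \<gamma> (\<sigma> s) $ 1 * b (\<sigma> s)) = signed_area \<gamma>"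
    unfolding signed_area_eq' by (rule integral_\<sigma>) (intro continuous_intros conts)
  finally show ?thesis .
qed

text \<open>A converse to the isoperimetric inequality. With \<open>r = L / 2\<pi>\<close> and \<open>u = \<kappa> - 1/r\<close> the vector
  \<open>g = \<gamma> + r\<nu>\<close>, constant for a circle, has arc-length derivative \<open>- r u \<tau>\<close> and thus oscillates by at most
  \<open>r \<integral>|u|\<close>. The deficit equals \<open>- L \<integral> u \<gamma>\<cdot>\<nu>\<close>, and there \<open>\<gamma>\<close> may be replaced by \<open>g - g(0)\<close> because
  \<open>u\<close> is orthogonal to the constants and to both components of \<open>\<nu>\<close>. Hence the deficit is quadratic in \<open>u\<close>.\<close>

lemma isoperimetric_deficit_bound:
  assumes rot: "ai k = 2 * pi"
  shows "len\<^sup>2 - 4 * pi * signed_area \<gamma> \<le> len ^ 3 / pi * ai (\<lambda>p. (k p - 2 * pi / len)\<^sup>2)"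
proof -
  define x y where "x p = \<gamma> p $ 1" and "y p = \<gamma> p $ 2" for p
  define u where "u p = k p - 2 * pi / len" for p
  define r where "r = len / (2 * pi)"
  have r: "0 < r" using len_pos by (simp add: r_def)
  have rk: "r * k p = r * u p + 1" for p using len_pos by (simp add: u_def r_def field_simps)
  have cx: "continuous_on A x" and cy: "continuous_on A y" and cu: "continuous_on A u" for A
    unfolding x_def[abs_def] y_def[abs_def] u_def[abs_def] by (intro continuous_intros conts)+
  note cs = cx cy cu conts
  have ders: "(x has_real_derivative v p * a p) (at p)" "(y has_real_derivative v p * b p) (at p)" for p
    unfolding x_def[abs_def] y_def[abs_def] by (rule dx dy)+
  have ends: "x 1 = x 0" "y 1 = y 0" "a 1 = a 0" "b 1 = b 0"
    using \<gamma>_per[of 0] a_per[of 0] b_per[of 0] by (simp_all add: x_def y_def)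
  define m where "m = ai (\<lambda>p. \<bar>u p\<bar>)"
  have osc: "\<bar>g p - g 0\<bar> \<le> r * m"
    if g: "\<And>p. (g has_real_derivative v p * (- r * u p * e p)) (at p)" and "p \<in> {0..1}"
      and e: "\<And>p. \<bar>e p\<bar> \<le> 1" "continuous_on {0..1} e" for g e p
  proof -
    have "\<bar>g p - g 0\<bar> \<le> ai (\<lambda>p. \<bar>- r * u p * e p\<bar>)"
      by (rule oscillation_bound[OF g _ that(2)]) (auto intro!: continuous_intros cs e)
    also have "\<dots> \<le> ai (\<lambda>p. r * \<bar>u p\<bar>)"
      using r e(1) by (intro arc_integral_mono continuous_intros cs e)
        (auto simp: abs_mult intro!: mult_left_le)
    finally show ?thesis by (simp only: arc_integral_cmult m_def)
  qed
  have le1: "\<bar>a p\<bar> \<le> 1" "\<bar>b p\<bar> \<le> 1" for p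
    using unit[of p] zero_le_power2[of "a p"] zero_le_power2[of "b p"]
    unfolding abs_square_le_1[symmetric] by linarith+
  define g1 g2 where "g1 p = x p - r * b p" and "g2 p = y p + r * a p" for p
  have dg1: "(g1 has_real_derivative v p * (- r * u p * a p)) (at p)" for p
  proof -
    have "(g1 has_real_derivative v p * a p - r * (v p * (k p * a p))) (at p)"
      unfolding g1_def by (intro DERIV_diff DERIV_cmult ders db)
    moreover have "v p * a p - r * (v p * (k p * a p)) = v p * a p - (r * k p) * (v p * a p)" by simp
    moreover have "\<dots> = v p * (- r * u p * a p)" unfolding rk by (simp add: algebra_simps)
    ultimately show ?thesis by simp
  qed
  have dg2: "(g2 has_real_derivative v p * (- r * u p * b p)) (at p)" for p
  proof -
    have "(g2 has_real_derivative v p * b p + r * (v p * (- k p * b p))) (at p)"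
      unfolding g2_def by (intro DERIV_add DERIV_cmult ders da)
    moreover have "v p * b p + r * (v p * (- k p * b p)) = v p * b p - (r * k p) * (v p * b p)" by simp
    moreover have "\<dots> = v p * (- r * u p * b p)" unfolding rk by (simp add: algebra_simps)
    ultimately show ?thesis by simp
  qed
  have ia: "ai a = 0" and ib: "ai b = 0" and ika: "ai (\<lambda>p. k p * a p) = 0"
    and ikb: "ai (\<lambda>p. k p * b p) = 0"
    using arc_integral_derivative[OF ders(1)] arc_integral_derivative[OF ders(2)]
      arc_integral_derivative[OF db] arc_integral_derivative[OF da]
      arc_integral_cmult[of "-1" "\<lambda>p. k p * b p"] ends by auto
  have iu: "ai u = 0"
    unfolding u_def[abs_def] using rot len_pos arc_integral_const[of "2 * pi / len"]
    by (subst arc_integral_diff) (auto intro: conts)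
  have iua: "ai (\<lambda>p. u p * a p) = 0" and iub: "ai (\<lambda>p. u p * b p) = 0"
  proof -
    have "ai (\<lambda>p. u p * e p) = ai (\<lambda>p. k p * e p) - 2 * pi / len * ai e"
      if "continuous_on {0..1} e" for e
      unfolding u_def left_diff_distrib arc_integral_cmult[symmetric]
      by (intro arc_integral_diff continuous_intros conts that)
    then show "ai (\<lambda>p. u p * a p) = 0" "ai (\<lambda>p. u p * b p) = 0"
      by (simp_all add: conts ia ib ika ikb)
  qed
  have "ai (\<lambda>p. 1 - k p * (x p * b p - y p * a p)) = 0"
  proof (rule arc_integral_derivative[of "\<lambda>p. x p * a p + y p * b p"])
    fix p
    have "((\<lambda>p. x p * a p + y p * b p) has_real_derivative
        (v p * a p * a p + v p * (- k p * b p) * x p) + (v p * b p * b p + v p * (k p * a p) * y p))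
        (at p)"
      by (intro DERIV_add DERIV_mult ders da db)
    moreover have "(v p * a p * a p + v p * (- k p * b p) * x p) + (v p * b p * b p + v p * (k p * a p) * y p)
        = v p * (((a p)\<^sup>2 + (b p)\<^sup>2) - k p * (x p * b p - y p * a p))"
      by (simp add: algebra_simps power2_eq_square)
    ultimately show "((\<lambda>p. x p * a p + y p * b p) has_real_derivative
        v p * (1 - k p * (x p * b p - y p * a p))) (at p)" by (simp only: unit)
  qed (simp add: ends)
  then have "len = ai (\<lambda>p. k p * (x p * b p - y p * a p))"
    by (subst (asm) arc_integral_diff) (auto intro!: continuous_intros cs)
  also have "\<dots> = ai (\<lambda>p. u p * (x p * b p - y p * a p) + 2 * pi / len * (x p * b p - y p * a p))"
    unfolding u_def distrib_right[symmetric] by simp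
  also have "\<dots> = ai (\<lambda>p. u p * (x p * b p - y p * a p))
      + ai (\<lambda>p. 2 * pi / len * (x p * b p - y p * a p))"
    by (intro arc_integral_add continuous_intros cs)
  also have "ai (\<lambda>p. 2 * pi / len * (x p * b p - y p * a p)) = 2 * pi / len * (2 * signed_area \<gamma>)"
    unfolding arc_integral_cmult signed_area_eq x_def y_def by simp
  finally have "len * len = len * (ai (\<lambda>p. u p * (x p * b p - y p * a p))
      + 2 * pi / len * (2 * signed_area \<gamma>))" by (rule arg_cong)
  then have deficit: "len\<^sup>2 - 4 * pi * signed_area \<gamma> = len * ai (\<lambda>p. u p * (x p * b p - y p * a p))"
    unfolding distrib_left using len_pos by (simp add: power2_eq_square)
  have "(\<lambda>p. u p * (x p * b p - y p * a p)) =
     (\<lambda>p. u p * ((g1 p - g1 0) * b p - (g2 p - g2 0) * a p)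
        + (g1 0 * (u p * b p) - g2 0 * (u p * a p) + r * u p))"
  proof
    fix p
    have e: "x p * b p - y p * a p = g1 p * b p - g2 p * a p + r * ((a p)\<^sup>2 + (b p)\<^sup>2)"
      by (simp add: g1_def g2_def algebra_simps power2_eq_square)
    show "u p * (x p * b p - y p * a p) = u p * ((g1 p - g1 0) * b p - (g2 p - g2 0) * a p)
        + (g1 0 * (u p * b p) - g2 0 * (u p * a p) + r * u p)"
      unfolding e unit by (simp add: algebra_simps)
  qed
  then have "ai (\<lambda>p. u p * (x p * b p - y p * a p))
      = ai (\<lambda>p. u p * ((g1 p - g1 0) * b p - (g2 p - g2 0) * a p)
        + (g1 0 * (u p * b p) - g2 0 * (u p * a p) + r * u p))" by simp
  also have "\<dots> = ai (\<lambda>p. u p * ((g1 p - g1 0) * b p - (g2 p - g2 0) * a p))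
      + (g1 0 * ai (\<lambda>p. u p * b p) - g2 0 * ai (\<lambda>p. u p * a p) + r * ai u)"
  proof -
    have cg: "continuous_on {0..1} g1" "continuous_on {0..1} g2"
      unfolding g1_def[abs_def] g2_def[abs_def] by (intro continuous_intros cs)+
    have "ai (\<lambda>p. g1 0 * (u p * b p) - g2 0 * (u p * a p) + r * u p)
        = ai (\<lambda>p. g1 0 * (u p * b p) - g2 0 * (u p * a p)) + ai (\<lambda>p. r * u p)"
      by (intro arc_integral_add continuous_intros cs)
    moreover have "ai (\<lambda>p. g1 0 * (u p * b p) - g2 0 * (u p * a p))
        = ai (\<lambda>p. g1 0 * (u p * b p)) - ai (\<lambda>p. g2 0 * (u p * a p))"
      by (intro arc_integral_diff continuous_intros cs)
    moreover have "ai (\<lambda>p. u p * ((g1 p - g1 0) * b p - (g2 p - g2 0) * a p)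
        + (g1 0 * (u p * b p) - g2 0 * (u p * a p) + r * u p))
      = ai (\<lambda>p. u p * ((g1 p - g1 0) * b p - (g2 p - g2 0) * a p))
        + ai (\<lambda>p. g1 0 * (u p * b p) - g2 0 * (u p * a p) + r * u p)"
      by (intro arc_integral_add continuous_intros cs cg)
    ultimately show ?thesis by (simp only: arc_integral_cmult)
  qed
  also have "\<dots> = ai (\<lambda>p. u p * ((g1 p - g1 0) * b p - (g2 p - g2 0) * a p))"
    by (simp add: iu iua iub)
  also have "\<dots> \<le> ai (\<lambda>p. 2 * r * m * \<bar>u p\<bar>)"
  proof (rule arc_integral_mono)
    show "continuous_on {0..1} (\<lambda>p. u p * ((g1 p - g1 0) * b p - (g2 p - g2 0) * a p))"
      unfolding g1_def[abs_def] g2_def[abs_def] by (intro continuous_intros cs)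
    show "continuous_on {0..1} (\<lambda>p. 2 * r * m * \<bar>u p\<bar>)" by (intro continuous_intros cs)
    fix p :: real assume p: "0 \<le> p" "p \<le> 1"
    have "\<bar>g1 p - g1 0\<bar> \<le> r * m" by (rule osc[OF dg1]) (use p le1 in \<open>auto intro: conts\<close>)
    then have 1: "\<bar>(g1 p - g1 0) * b p\<bar> \<le> r * m * 1"
      unfolding abs_mult by (intro mult_mono le1) auto
    have "\<bar>g2 p - g2 0\<bar> \<le> r * m" by (rule osc[OF dg2]) (use p le1 in \<open>auto intro: conts\<close>)
    then have 2: "\<bar>(g2 p - g2 0) * a p\<bar> \<le> r * m * 1"
      unfolding abs_mult by (intro mult_mono le1) auto
    have "u p * ((g1 p - g1 0) * b p - (g2 p - g2 0) * a p)
        \<le> \<bar>u p\<bar> * \<bar>(g1 p - g1 0) * b p - (g2 p - g2 0) * a p\<bar>"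
      by (metis abs_ge_self abs_mult)
    also have "\<dots> \<le> \<bar>u p\<bar> * (2 * r * m)"
      using 1 2 by (intro mult_left_mono) auto
    finally show "u p * ((g1 p - g1 0) * b p - (g2 p - g2 0) * a p) \<le> 2 * r * m * \<bar>u p\<bar>"
      by (simp add: mult.commute)
  qed
  also have "\<dots> = 2 * r * m\<^sup>2" by (simp only: arc_integral_cmult m_def power2_eq_square mult.assoc)
  also have "\<dots> \<le> 2 * r * (len * ai (\<lambda>p. (u p)\<^sup>2))"
    using arc_integral_Cauchy_Schwarz[of u] r cu by (intro mult_left_mono) (auto simp: m_def)
  finally have "len * ai (\<lambda>p. u p * (x p * b p - y p * a p))
      \<le> len * (2 * r * (len * ai (\<lambda>p. (u p)\<^sup>2)))" using len_pos by (intro mult_left_mono) auto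
  also have "\<dots> = len ^ 3 / pi * ai (\<lambda>p. (u p)\<^sup>2)"
    by (simp add: r_def power3_eq_cube field_simps)
  finally show ?thesis unfolding deficit by (simp add: u_def)
qed

text \<open>Since \<open>h\<close> lists the arc-length derivatives of the curvature deviation, the \<open>l\<close>-fold derivative in the definition of the
  energy never has to be expanded.\<close>

lemma curvature_energy_eq:
  assumes h0: "\<And>p. h 0 p = k p - ai k / len"
    and dh: "\<And>l p. (h l has_real_derivative v p * h (Suc l) p) (at p)"
  shows "curvature_energy l \<gamma> = len ^ (2 * l + 1) * ai (\<lambda>p. (h l p)\<^sup>2)"
proof -
  have eq: "(deriv ^^ l) (curvature_deviation \<gamma>) = (\<lambda>s. h l (\<sigma> s))" for l
  proof (induction l)
    case 0
    show ?case
      by (rule ext) (simp add: curvature_deviation_def curvature_eq h0 integral_curvature[unfolded curve_length_eq]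
          curve_length_eq)
  next
    case (Suc l)
    show ?case by (rule ext) (simp add: Suc DERIV_imp_deriv[OF arc_derivative[OF dh]])
  qed
  have "continuous_on UNIV (h l)"
    using dh[of l] by (rule continuous_on_of_derivative)
  then have "integral {0..len} (\<lambda>s. (h l (\<sigma> s))\<^sup>2) = ai (\<lambda>p. (h l p)\<^sup>2)"
    by (intro integral_\<sigma> continuous_intros)
  then show ?thesis unfolding curvature_energy_def eq curve_length_eq by simp
qed

end

section \<open>Evolution equations of the flow\<close>

locale area_length_flow =
  fixes F :: "real \<Rightarrow> real \<Rightarrow> real^2"
  assumes solution: "global_flow_solution F"
    and initial_rotation: "rotation_number (\<lambda>p. F p 0) = 1"
    and initial_area: "0 < signed_area (\<lambda>p. F p 0)"
begin

definition "X p t = F p t $ 1"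
definition "Y p t = F p t $ 2"
definition "v p t = sqrt ((dp X p t)\<^sup>2 + (dp Y p t)\<^sup>2)"
definition "D g p t = dp g p t / v p t"
definition "a = D X"
definition "b = D Y"

text \<open>The Frenet equations \<open>\<partial>\<^sub>s a = - \<kappa> b\<close>, \<open>\<partial>\<^sub>s b = \<kappa> a\<close> and \<open>a\<^sup>2 + b\<^sup>2 = 1\<close> give the curvature as
  \<open>a \<partial>\<^sub>s b - b \<partial>\<^sub>s a\<close>; in this form it is visibly smooth in time as well.\<close>

primrec kap :: "nat \<Rightarrow> real \<Rightarrow> real \<Rightarrow> real" where
  "kap 0 = (\<lambda>p t. a p t * D b p t - b p t * D a p t)"
| "kap (Suc l) = D (kap l)"

declare kap.simps [simp del]

abbreviation "\<kappa> \<equiv> kap 0"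

definition "L t = curve_length (\<lambda>q. F q t)"
definition "A t = signed_area (\<lambda>q. F q t)"
definition "h t = L t / (2 * A t)"
definition "V p t = \<kappa> p t - h t"
definition "J g t = arc_integral (\<lambda>p. v p t) (\<lambda>p. g p t)"

lemma smooth_X: "smooth_scalar X" and smooth_Y: "smooth_scalar Y"
  using solution Ck_scalar_component
  unfolding global_flow_solution_def smooth_immersed_family_def smooth_scalar_def X_def[abs_def] Y_def[abs_def]
  by blast+

lemma speed_squared_pos:
  assumes "0 \<le> t"
  shows "0 < (dp X p t)\<^sup>2 + (dp Y p t)\<^sup>2"
proof -
  have "((\<lambda>q. F q t) has_vector_derivative vector [dp X p t, dp Y p t]) (at p)"
    using has_dp[OF smooth_X assms, of p] has_dp[OF smooth_Y assms, of p]
    by (intro has_vector_derivative_vector2) (simp_all add: X_def Y_def)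
  then have "vector_derivative (\<lambda>q. F q t) (at p) = vector [dp X p t, dp Y p t]"
    by (rule vector_derivative_at)
  then have "(vector [dp X p t, dp Y p t] :: real^2) \<noteq> 0"
    using solution assms
    unfolding global_flow_solution_def smooth_immersed_family_def by metis
  then have "dp X p t \<noteq> 0 \<or> dp Y p t \<noteq> 0"
    by (auto simp: vec_eq_iff forall_2)
  then show ?thesis by (metis sum_power2_gt_zero_iff)
qed

lemma v_positive: "0 \<le> t \<Longrightarrow> 0 < v p t" and v_nonzero: "0 \<le> t \<Longrightarrow> v p t \<noteq> 0"
  using speed_squared_pos[of t p] by (auto simp: v_def)

lemma smooth_v: "smooth_scalar v"
  unfolding v_def[abs_def]
  by (intro smooth_sqrt smooth_add smooth_power smooth_dp smooth_X smooth_Y speed_squared_pos)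

lemma smooth_D: "smooth_scalar g \<Longrightarrow> smooth_scalar (D g)"
  unfolding D_def[abs_def] by (intro smooth_divide smooth_dp smooth_v v_nonzero)

lemma smooth_a: "smooth_scalar a" and smooth_b: "smooth_scalar b"
  unfolding a_def b_def by (intro smooth_D smooth_X smooth_Y)+

lemma smooth_kap: "smooth_scalar (kap l)"
  by (induction l)
     (simp_all add: kap.simps smooth_D smooth_diff smooth_mult smooth_a smooth_b)

lemma has_D: "smooth_scalar g \<Longrightarrow> 0 \<le> t \<Longrightarrow> ((\<lambda>q. g q t) has_real_derivative v p t * D g p t) (at p)"
  using has_dp[of g t p] v_nonzero[of t p] by (simp add: D_def)

lemma D_eqI: "0 \<le> t \<Longrightarrow> ((\<lambda>q. g q t) has_real_derivative v p t * d) (at p) \<Longrightarrow> D g p t = d"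
  using dp_eqI[of g t "v p t * d" p] v_nonzero[of t p] by (simp add: D_def)

lemma d_X: "0 \<le> t \<Longrightarrow> ((\<lambda>q. X q t) has_real_derivative v p t * a p t) (at p)"
  and d_Y: "0 \<le> t \<Longrightarrow> ((\<lambda>q. Y q t) has_real_derivative v p t * b p t) (at p)"
  and d_kap: "0 \<le> t \<Longrightarrow> ((\<lambda>q. kap l q t) has_real_derivative v p t * kap (Suc l) p t) (at p)"
  using has_D[OF smooth_X] has_D[OF smooth_Y] has_D[OF smooth_kap] by (simp_all add: a_def b_def kap.simps)

lemma unit_length: "0 \<le> t \<Longrightarrow> (a p t)\<^sup>2 + (b p t)\<^sup>2 = 1"
  using speed_squared_pos[of t p] v_nonzero[of t p]
  by (simp add: a_def b_def D_def power_divide add_divide_distrib[symmetric]) (simp add: v_def)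

lemma D_a: "0 \<le> t \<Longrightarrow> D a p t = - \<kappa> p t * b p t"
  and D_b: "0 \<le> t \<Longrightarrow> D b p t = \<kappa> p t * a p t"
proof -
  assume t: "0 \<le> t"
  have "((\<lambda>q. (a q t)\<^sup>2 + (b q t)\<^sup>2) has_real_derivative
      2 * a p t * (v p t * D a p t) + 2 * b p t * (v p t * D b p t)) (at p)"
    using has_D[OF smooth_a t, of p] has_D[OF smooth_b t, of p]
    by (auto intro!: derivative_eq_intros)
  moreover have "((\<lambda>q. (a q t)\<^sup>2 + (b q t)\<^sup>2) has_real_derivative 0) (at p)"
    using unit_length[OF t] by simp
  ultimately have "2 * a p t * (v p t * D a p t) + 2 * b p t * (v p t * D b p t) = 0"
    by (rule DERIV_unique)
  then have "2 * v p t * (a p t * D a p t + b p t * D b p t) = 0" by (simp add: algebra_simps)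
  then have o: "a p t * D a p t + b p t * D b p t = 0" using v_nonzero[OF t, of p] by simp
  have u: "a p t * a p t + b p t * b p t = 1"
    using unit_length[OF t, of p] by (simp add: power2_eq_square)
  have "D a p t = (a p t * a p t + b p t * b p t) * D a p t - a p t * (a p t * D a p t + b p t * D b p t)"
    unfolding u o by simp
  then show "D a p t = - \<kappa> p t * b p t" by (simp add: kap.simps algebra_simps)
  have "D b p t = (a p t * a p t + b p t * b p t) * D b p t - b p t * (a p t * D a p t + b p t * D b p t)"
    unfolding u o by simp
  then show "D b p t = \<kappa> p t * a p t" by (simp add: kap.simps algebra_simps)
qed

lemma d_a: "0 \<le> t \<Longrightarrow> ((\<lambda>q. a q t) has_real_derivative v p t * (- \<kappa> p t * b p t)) (at p)"
  and d_b: "0 \<le> t \<Longrightarrow> ((\<lambda>q. b q t) has_real_derivative v p t * (\<kappa> p t * a p t)) (at p)"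
  and d_V: "0 \<le> t \<Longrightarrow> ((\<lambda>q. V q t) has_real_derivative v p t * kap 1 p t) (at p)"
  using has_D[OF smooth_a, of t p] has_D[OF smooth_b, of t p] D_a[of t p] D_b[of t p] d_kap[of t 0 p]
  by (auto simp: V_def intro!: derivative_eq_intros)

definition periodic :: "(real \<Rightarrow> real \<Rightarrow> real) \<Rightarrow> bool" where
  "periodic g \<longleftrightarrow> (\<forall>p. \<forall>t\<ge>0. g (p + 1) t = g p t)"

lemma periodic_dp:
  assumes "smooth_scalar g" "periodic g"
  shows "periodic (dp g)"
  unfolding periodic_def
proof (intro allI impI)
  fix p t :: real assume t: "0 \<le> t"
  have "((\<lambda>q. g (q + 1) t) has_real_derivative dp g (p + 1) t * 1) (at p)"
    by (rule DERIV_chain2[OF has_dp[OF assms(1) t]]) (auto intro!: derivative_eq_intros)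
  then have "((\<lambda>q. g q t) has_real_derivative dp g (p + 1) t) (at p)"
    using assms(2) t by (simp add: periodic_def)
  then show "dp g (p + 1) t = dp g p t" by (rule dp_eqI[symmetric])
qed

lemma periodic_X: "periodic X" and periodic_Y: "periodic Y"
  using solution
  unfolding global_flow_solution_def smooth_immersed_family_def periodic_def X_def Y_def by simp_all

lemma periodic_v: "periodic v"
  using periodic_dp[OF smooth_X periodic_X] periodic_dp[OF smooth_Y periodic_Y]
  by (simp add: periodic_def v_def)

lemma periodic_D: "smooth_scalar g \<Longrightarrow> periodic g \<Longrightarrow> periodic (D g)"
  using periodic_dp[of g] periodic_v by (simp add: periodic_def D_def)

lemma periodic_a: "periodic a" and periodic_b: "periodic b"
  unfolding a_def b_def by (intro periodic_D smooth_X smooth_Y periodic_X periodic_Y)+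

lemma periodic_kap: "periodic (kap l)"
proof (induction l)
  case 0
  show ?case
    using periodic_a periodic_b periodic_D[OF smooth_a periodic_a] periodic_D[OF smooth_b periodic_b]
    by (simp add: periodic_def kap.simps)
next
  case (Suc l)
  then show ?case by (simp add: periodic_D smooth_kap kap.simps)
qed

lemma ends_equal: "periodic g \<Longrightarrow> 0 \<le> t \<Longrightarrow> g 1 t = g 0 t"
  unfolding periodic_def by (metis add.left_neutral)

lemma periodic_V: "periodic V"
  using periodic_kap[of 0] by (simp add: periodic_def V_def)

lemma cont_X: "0 \<le> t \<Longrightarrow> continuous_on S (\<lambda>p. X p t)"
  and cont_Y: "0 \<le> t \<Longrightarrow> continuous_on S (\<lambda>p. Y p t)"
  and cont_a: "0 \<le> t \<Longrightarrow> continuous_on S (\<lambda>p. a p t)"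
  and cont_b: "0 \<le> t \<Longrightarrow> continuous_on S (\<lambda>p. b p t)"
  and cont_kap: "0 \<le> t \<Longrightarrow> continuous_on S (\<lambda>p. kap l p t)"
  by (intro smooth_continuous_on_p smooth_X smooth_Y smooth_a smooth_b smooth_kap; assumption)+

lemma cont_V: "0 \<le> t \<Longrightarrow> continuous_on S (\<lambda>p. V p t)"
  unfolding V_def by (intro continuous_intros cont_kap)

lemmas conts = cont_X cont_Y cont_a cont_b cont_kap cont_V

lemma closed_curve_at:
  assumes t: "0 \<le> t"
  shows "closed_curve (\<lambda>p. v p t) (\<lambda>q. F q t) (\<lambda>p. a p t) (\<lambda>p. b p t) (\<lambda>p. \<kappa> p t)"
proof
  fix p
  show "0 < v p t" by (rule v_positive[OF t])
  show "((\<lambda>q. F q t $ 1) has_real_derivative v p t * a p t) (at p)"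
    using d_X[OF t] by (simp add: X_def)
  show "((\<lambda>q. F q t $ 2) has_real_derivative v p t * b p t) (at p)"
    using d_Y[OF t] by (simp add: Y_def)
  show "F (p + 1) t = F p t" using solution t
    unfolding global_flow_solution_def smooth_immersed_family_def by simp
  show "v (p + 1) t = v p t" "a (p + 1) t = a p t" "b (p + 1) t = b p t"
    using periodic_v periodic_a periodic_b t by (simp_all add: periodic_def)
  show "((\<lambda>p. a p t) has_real_derivative v p t * (- \<kappa> p t * b p t)) (at p)"
    "((\<lambda>p. b p t) has_real_derivative v p t * (\<kappa> p t * a p t)) (at p)"
    by (rule d_a[OF t], rule d_b[OF t])
qed (use t smooth_continuous_on_p[OF smooth_v] in
      \<open>auto intro: unit_length conts\<close>)

lemma speed_at: "0 \<le> t \<Longrightarrow> speed (\<lambda>p. v p t)"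
  using closed_curve_at[of t] by (simp add: closed_curve_def)

lemma J_add: "0 \<le> t \<Longrightarrow> continuous_on {0..1} (\<lambda>p. f p t) \<Longrightarrow> continuous_on {0..1} (\<lambda>p. g p t) \<Longrightarrow>
    J (\<lambda>p t. f p t + g p t) t = J f t + J g t"
  and J_diff: "0 \<le> t \<Longrightarrow> continuous_on {0..1} (\<lambda>p. f p t) \<Longrightarrow> continuous_on {0..1} (\<lambda>p. g p t) \<Longrightarrow>
    J (\<lambda>p t. f p t - g p t) t = J f t - J g t"
  and J_mono: "0 \<le> t \<Longrightarrow> continuous_on {0..1} (\<lambda>p. f p t) \<Longrightarrow> continuous_on {0..1} (\<lambda>p. g p t) \<Longrightarrow>
    (\<And>p. p \<in> {0..1} \<Longrightarrow> f p t \<le> g p t) \<Longrightarrow> J f t \<le> J g t"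
  and J_nonneg: "0 \<le> t \<Longrightarrow> (\<And>p. 0 \<le> f p t) \<Longrightarrow> continuous_on {0..1} (\<lambda>p. f p t) \<Longrightarrow> 0 \<le> J f t"
  unfolding J_def using speed.arc_integral_add[OF speed_at] speed.arc_integral_diff[OF speed_at]
  by (simp_all add: speed.arc_integral_mono[OF speed_at] speed.arc_integral_nonneg[OF speed_at])

lemma J_cmult: "J (\<lambda>p t. c t * f p t) t = c t * J f t"
  unfolding J_def arc_integral_def by (simp add: mult.assoc)

lemma J_cong: "0 \<le> t \<Longrightarrow> (\<And>p. f p t = g p t) \<Longrightarrow> J f t = J g t"
  unfolding J_def by simp

lemma J_derivative_zero:
  assumes "0 \<le> t" "\<And>p. ((\<lambda>q. g q t) has_real_derivative v p t * g' p t) (at p)" "periodic g"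
  shows "J g' t = 0"
  unfolding J_def
  by (rule speed.arc_integral_derivative[OF speed_at[OF assms(1)], of "\<lambda>p. g p t"])
     (use assms ends_equal in auto)

lemma J_by_parts:
  assumes "0 \<le> t" "\<And>p. ((\<lambda>q. f q t) has_real_derivative v p t * f' p t) (at p)"
    "\<And>p. ((\<lambda>q. g q t) has_real_derivative v p t * g' p t) (at p)" "periodic f" "periodic g"
    "continuous_on {0..1} (\<lambda>p. f' p t)" "continuous_on {0..1} (\<lambda>p. g' p t)"
  shows "J (\<lambda>p t. f p t * g' p t) t = - J (\<lambda>p t. f' p t * g p t) t"
  unfolding J_def
  by (rule speed.arc_integral_by_parts[OF speed_at[OF assms(1)]]) (use assms ends_equal in auto)

lemma L_eq: "0 \<le> t \<Longrightarrow> L t = J (\<lambda>p t. 1) t"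
  unfolding L_def J_def by (rule closed_curve.curve_length_eq[OF closed_curve_at])

lemma L_pos: "0 \<le> t \<Longrightarrow> 0 < L t"
  unfolding L_eq J_def by (rule speed.arc_integral_one_pos[OF speed_at])

lemma J_const: "0 \<le> t \<Longrightarrow> J (\<lambda>p t. c t) t = c t * L t"
  using J_cmult[of c "\<lambda>p t. 1" t] by (simp add: L_eq)

lemma A_nonzero: "0 \<le> t \<Longrightarrow> A t \<noteq> 0"
  using solution unfolding global_flow_solution_def A_def by simp

lemma A_eq: "0 \<le> t \<Longrightarrow> A t = 1 / 2 * J (\<lambda>p t. X p t * b p t - Y p t * a p t) t"
  using closed_curve.signed_area_eq[OF closed_curve_at] by (simp add: A_def J_def X_def Y_def)

lemma isoperimetric_at: "0 \<le> t \<Longrightarrow> 4 * pi * A t \<le> (L t)\<^sup>2"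
  using closed_curve.isoperimetric[OF closed_curve_at, of t] by (simp add: A_def L_eq J_def)

lemma dt_X: "0 \<le> t \<Longrightarrow> dt X p t = - V p t * b p t"
  and dt_Y: "0 \<le> t \<Longrightarrow> dt Y p t = V p t * a p t"
proof -
  assume t: "0 \<le> t"
  interpret cc: closed_curve "\<lambda>p. v p t" "\<lambda>q. F q t" "\<lambda>p. a p t" "\<lambda>p. b p t" "\<lambda>p. \<kappa> p t"
    by (rule closed_curve_at[OF t])
  have "((\<lambda>\<tau>. F p \<tau>) has_vector_derivative
     (curvature_vector (\<lambda>q. F q t) (cc.S p) - h t *\<^sub>R unit_normal (\<lambda>q. F q t) (cc.S p)))
     (at t within {0..})"
    using solution t unfolding global_flow_solution_def Let_def h_def L_def A_def by blast
  then have d: "((\<lambda>\<tau>. F p \<tau>) has_vector_derivative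
     (vector [- \<kappa> p t * b p t, \<kappa> p t * a p t] - h t *\<^sub>R vector [- b p t, a p t])) (at t within {0..})"
    by (simp only: cc.curvature_vector_eq cc.unit_normal_eq cc.\<sigma>_S)
  have "((\<lambda>\<tau>. F p \<tau> $ i) has_real_derivative
     (vector [- \<kappa> p t * b p t, \<kappa> p t * a p t] - h t *\<^sub>R vector [- b p t, a p t] :: real^2) $ i)
     (at t within {0..})" for i
    unfolding has_real_derivative_iff_has_vector_derivative
    by (rule bounded_linear.has_vector_derivative[OF bounded_linear_vec_nth d])
  from this[of 1] this[of 2]
  have "(X p has_real_derivative - V p t * b p t) (at t within {0..})"
    "(Y p has_real_derivative V p t * a p t) (at t within {0..})"
    by (simp_all add: X_def[abs_def] Y_def[abs_def] V_def algebra_simps)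
  then show "dt X p t = - V p t * b p t" "dt Y p t = V p t * a p t"
    by (simp_all add: dt_eqI t)
qed

lemma dt_dp_X: "0 \<le> t \<Longrightarrow> dt (dp X) p t = v p t * (- kap 1 p t * b p t - V p t * \<kappa> p t * a p t)"
  and dt_dp_Y: "0 \<le> t \<Longrightarrow> dt (dp Y) p t = v p t * (kap 1 p t * a p t - V p t * \<kappa> p t * b p t)"
proof -
  assume t: "0 \<le> t"
  have "((\<lambda>q. - V q t * b q t) has_real_derivative
      v p t * (- kap 1 p t * b p t - V p t * \<kappa> p t * a p t)) (at p)"
    by (rule derivative_eq_intros d_V d_b t refl)+ (simp add: algebra_simps)
  moreover have "((\<lambda>q. - V q t * b q t) has_real_derivative dt (dp X) p t) (at p)"
    using smooth_mixed_partials[OF smooth_X t] by (simp add: dt_X t)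
  ultimately show "dt (dp X) p t = v p t * (- kap 1 p t * b p t - V p t * \<kappa> p t * a p t)"
    by (rule DERIV_unique[symmetric])
  have "((\<lambda>q. V q t * a q t) has_real_derivative
      v p t * (kap 1 p t * a p t - V p t * \<kappa> p t * b p t)) (at p)"
    by (rule derivative_eq_intros d_V d_a t refl)+ (simp add: algebra_simps)
  moreover have "((\<lambda>q. V q t * a q t) has_real_derivative dt (dp Y) p t) (at p)"
    using smooth_mixed_partials[OF smooth_Y t] by (simp add: dt_Y t)
  ultimately show "dt (dp Y) p t = v p t * (kap 1 p t * a p t - V p t * \<kappa> p t * b p t)"
    by (rule DERIV_unique[symmetric])
qed

text \<open>Differentiating \<open>v\<^sup>2 = |\<partial>\<^sub>p F|\<^sup>2\<close> in time: the tangential part of \<open>\<partial>\<^sub>p (V \<nu>)\<close> is \<open>- \<kappa> V v \<tau>\<close>.\<close>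

lemma dt_v: "0 \<le> t \<Longrightarrow> dt v p t = - \<kappa> p t * V p t * v p t"
proof -
  assume t: "0 \<le> t"
  have xp: "dp X p t = v p t * a p t" and yp: "dp Y p t = v p t * b p t"
    using v_nonzero[OF t] by (simp_all add: a_def b_def D_def)
  have "((\<lambda>\<tau>. (dp X p \<tau>)\<^sup>2 + (dp Y p \<tau>)\<^sup>2) has_real_derivative
      2 * dp X p t * dt (dp X) p t + 2 * dp Y p t * dt (dp Y) p t) (at t within {0..})"
    by (rule derivative_eq_intros has_dt[OF smooth_dp[OF smooth_X] t]
        has_dt[OF smooth_dp[OF smooth_Y] t] refl)+ simp
  moreover have "((\<lambda>\<tau>. (v p \<tau>)\<^sup>2) has_real_derivative 2 * v p t * dt v p t) (at t within {0..})"
    by (rule derivative_eq_intros has_dt[OF smooth_v t] refl)+ simp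
  then have "((\<lambda>\<tau>. (dp X p \<tau>)\<^sup>2 + (dp Y p \<tau>)\<^sup>2) has_real_derivative 2 * v p t * dt v p t)
      (at t within {0..})"
    by (rule has_real_derivative_eq_on) (use t in \<open>auto simp: v_def\<close>)
  ultimately have "2 * v p t * dt v p t
      = 2 * dp X p t * dt (dp X) p t + 2 * dp Y p t * dt (dp Y) p t"
    using derivative_Ici_unique t by blast
  also have "\<dots> = 2 * v p t * (- \<kappa> p t * V p t * v p t * ((a p t)\<^sup>2 + (b p t)\<^sup>2))"
    unfolding dt_dp_X[OF t] dt_dp_Y[OF t] xp yp
    by (simp add: algebra_simps power2_eq_square)
  finally show ?thesis
    unfolding unit_length[OF t] mult_1_right mult_cancel_left using v_nonzero[OF t, of p] by simp
qed

text \<open>The commutator \<open>[\<partial>\<^sub>t, \<partial>\<^sub>s] = \<kappa> V \<partial>\<^sub>s\<close>, in the form used below: if \<open>\<partial>\<^sub>t g = w\<close> and \<open>w\<close> has the arc-length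
  derivative \<open>w'\<close> at \<open>p\<close>.\<close>

lemma dt_D:
  assumes g: "smooth_scalar g" and t: "0 \<le> t" and w: "\<And>q. dt g q t = w q"
    and dw: "(w has_real_derivative v p t * w') (at p)"
  shows "dt (D g) p t = w' + \<kappa> p t * V p t * D g p t"
proof -
  have "((\<lambda>\<tau>. v p \<tau> * D g p \<tau>) has_real_derivative
      dt v p t * D g p t + dt (D g) p t * v p t) (at t within {0..})"
    by (intro DERIV_mult has_dt smooth_v smooth_D g t)
  then have "((\<lambda>\<tau>. dp g p \<tau>) has_real_derivative
      dt v p t * D g p t + dt (D g) p t * v p t) (at t within {0..})"
    by (rule has_real_derivative_eq_on) (use t v_nonzero in \<open>auto simp: D_def\<close>)
  then have "dt (dp g) p t = dt v p t * D g p t + dt (D g) p t * v p t"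
    by (rule dt_eqI[OF _ t])
  moreover have "dt (dp g) p t = v p t * w'"
    using DERIV_unique[OF smooth_mixed_partials[OF g t, of p, unfolded w] dw] .
  ultimately have "v p t * dt (D g) p t = v p t * (w' + \<kappa> p t * V p t * D g p t)"
    unfolding dt_v[OF t] by (simp add: algebra_simps)
  then show ?thesis using v_nonzero[OF t, of p] by simp
qed

lemma dt_a: "0 \<le> t \<Longrightarrow> dt a p t = - kap 1 p t * b p t"
  and dt_b: "0 \<le> t \<Longrightarrow> dt b p t = kap 1 p t * a p t"
proof -
  assume t: "0 \<le> t"
  have "((\<lambda>q. - V q t * b q t) has_real_derivative
      v p t * (- kap 1 p t * b p t - V p t * \<kappa> p t * a p t)) (at p)"
    by (rule derivative_eq_intros d_V d_b t refl)+ (simp add: algebra_simps)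
  from dt_D[OF smooth_X t dt_X[OF t] this] show "dt a p t = - kap 1 p t * b p t"
    by (simp add: a_def[symmetric] algebra_simps)
  have "((\<lambda>q. V q t * a q t) has_real_derivative
      v p t * (kap 1 p t * a p t - V p t * \<kappa> p t * b p t)) (at p)"
    by (rule derivative_eq_intros d_V d_a t refl)+ (simp add: algebra_simps)
  from dt_D[OF smooth_Y t dt_Y[OF t] this] show "dt b p t = kap 1 p t * a p t"
    by (simp add: b_def[symmetric] algebra_simps)
qed

text \<open>Differentiating the Frenet equations in time yields \<open>\<partial>\<^sub>t \<kappa>\<close> multiplied by \<open>b\<close> and by \<open>a\<close>; one of the two
  may vanish, so both are combined through \<open>a\<^sup>2 + b\<^sup>2 = 1\<close>.\<close>

lemma dt_curvature:
  assumes t: "0 \<le> t"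
  shows "dt \<kappa> p t = kap 2 p t + (\<kappa> p t)\<^sup>2 * V p t"
proof -
  have k2: "kap (Suc (Suc 0)) = kap 2" by (simp only: numeral_2_eq_2)
  define Q where "Q = kap 2 p t + (\<kappa> p t)\<^sup>2 * V p t"
  have "((\<lambda>q. - kap 1 q t * b q t) has_real_derivative
      v p t * (- kap 2 p t * b p t - kap 1 p t * \<kappa> p t * a p t)) (at p)"
    by (rule derivative_eq_intros d_kap d_b t refl)+ (simp add: k2 algebra_simps)
  from dt_D[OF smooth_a t dt_a[OF t] this]
  have "dt (D a) p t = - kap 2 p t * b p t - kap 1 p t * \<kappa> p t * a p t - (\<kappa> p t)\<^sup>2 * V p t * b p t"
    by (simp add: D_a[OF t] algebra_simps power2_eq_square)
  moreover have "dt (D a) p t = - (dt \<kappa> p t * b p t + kap 1 p t * a p t * \<kappa> p t)"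
  proof (rule dt_eqI[OF _ t])
    have "((\<lambda>\<tau>. - (\<kappa> p \<tau> * b p \<tau>)) has_real_derivative
        - (dt \<kappa> p t * b p t + dt b p t * \<kappa> p t)) (at t within {0..})"
      by (intro DERIV_minus DERIV_mult has_dt smooth_kap smooth_b t)
    then show "(D a p has_real_derivative
        - (dt \<kappa> p t * b p t + kap 1 p t * a p t * \<kappa> p t)) (at t within {0..})"
      unfolding dt_b[OF t]
      by (rule has_real_derivative_eq_on) (use t D_a in \<open>auto\<close>)
  qed
  ultimately have eb: "dt \<kappa> p t * b p t = Q * b p t"
    by (simp add: Q_def algebra_simps)
  have "((\<lambda>q. kap 1 q t * a q t) has_real_derivative
      v p t * (kap 2 p t * a p t - kap 1 p t * \<kappa> p t * b p t)) (at p)"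
    by (rule derivative_eq_intros d_kap d_a t refl)+ (simp add: k2 algebra_simps)
  from dt_D[OF smooth_b t dt_b[OF t] this]
  have "dt (D b) p t = kap 2 p t * a p t - kap 1 p t * \<kappa> p t * b p t + (\<kappa> p t)\<^sup>2 * V p t * a p t"
    by (simp add: D_b[OF t] algebra_simps power2_eq_square)
  moreover have "dt (D b) p t = dt \<kappa> p t * a p t + - kap 1 p t * b p t * \<kappa> p t"
  proof (rule dt_eqI[OF _ t])
    have "((\<lambda>\<tau>. \<kappa> p \<tau> * a p \<tau>) has_real_derivative
        dt \<kappa> p t * a p t + dt a p t * \<kappa> p t) (at t within {0..})"
      by (intro DERIV_mult has_dt smooth_kap smooth_a t)
    then show "(D b p has_real_derivative
        dt \<kappa> p t * a p t + - kap 1 p t * b p t * \<kappa> p t) (at t within {0..})"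
      unfolding dt_a[OF t]
      by (rule has_real_derivative_eq_on) (use t D_b in \<open>auto\<close>)
  qed
  ultimately have ea: "dt \<kappa> p t * a p t = Q * a p t"
    by (simp add: Q_def algebra_simps)
  have "dt \<kappa> p t = dt \<kappa> p t * ((a p t)\<^sup>2 + (b p t)\<^sup>2)" by (simp only: unit_length[OF t] mult_1_right)
  also have "\<dots> = (dt \<kappa> p t * a p t) * a p t + (dt \<kappa> p t * b p t) * b p t"
    by (simp only: power2_eq_square distrib_left mult.assoc)
  also have "\<dots> = Q * ((a p t)\<^sup>2 + (b p t)\<^sup>2)"
    unfolding ea eb by (simp only: power2_eq_square distrib_left mult.assoc)
  finally show ?thesis by (simp only: unit_length[OF t] mult_1_right Q_def)
qed

text \<open>The arc-length element shrinks at the rate \<open>\<kappa> V\<close>.\<close>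

lemma J_has_derivative:
  assumes g: "smooth_scalar g" and t: "0 \<le> t"
  shows "(J g has_real_derivative J (\<lambda>p t. dt g p t - \<kappa> p t * V p t * g p t) t) (at t within {0..})"
proof -
  have gv: "smooth_scalar (\<lambda>p t. g p t * v p t)" by (intro smooth_mult g smooth_v)
  have "dt (\<lambda>p t. g p t * v p t) p t = (dt g p t - \<kappa> p t * V p t * g p t) * v p t" for p
  proof -
    have "dt (\<lambda>p t. g p t * v p t) p t = dt g p t * v p t + dt v p t * g p t"
      by (intro dt_eqI[OF _ t] DERIV_mult has_dt g smooth_v t)
    then show ?thesis by (simp add: dt_v[OF t] algebra_simps)
  qed
  then show ?thesis
    using smooth_integral_derivative[OF gv t, of 0 1]
    unfolding J_def[abs_def] arc_integral_def by simp
qed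

section \<open>Length, area and isoperimetric deficit along the flow\<close>

text \<open>The measure \<open>\<kappa> ds\<close> changes by the exact term \<open>\<partial>\<^sub>s\<^sup>2 \<kappa> ds\<close>, because the reaction term \<open>\<kappa>\<^sup>2 V\<close> cancels against
  the shrinking of \<open>ds\<close>.\<close>

lemma total_curvature: "0 \<le> t \<Longrightarrow> J \<kappa> t = 2 * pi"
proof -
  assume t: "0 \<le> t"
  have dJ: "(J \<kappa> has_real_derivative 0) (at s within {0..})" if s: "0 \<le> s" for s
  proof -
    have "J (\<lambda>p t. dt \<kappa> p t - \<kappa> p t * V p t * \<kappa> p t) s = J (kap 2) s"
      by (rule J_cong[OF s]) (simp add: dt_curvature[OF s] power2_eq_square)
    also have "\<dots> = 0"
      using d_kap[OF s, of "Suc 0"]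
      by (intro J_derivative_zero[of s "kap 1"] s periodic_kap)
         (simp add: numeral_2_eq_2)
    finally show ?thesis using J_has_derivative[OF smooth_kap s, of 0] by simp
  qed
  have "J \<kappa> t \<le> J \<kappa> 0"
    by (rule nonincreasing_Ici[OF dJ]) (use t in auto)
  moreover have "- J \<kappa> t \<le> - J \<kappa> 0"
    by (rule nonincreasing_Ici[of "\<lambda>t. - J \<kappa> t" "\<lambda>_. - 0"], rule DERIV_minus, rule dJ) (use t in auto)
  moreover have "J \<kappa> 0 = 2 * pi"
    using initial_rotation closed_curve.integral_curvature[OF closed_curve_at, of 0]
    by (simp add: rotation_number_def J_def)
  ultimately show ?thesis by simp
qed

lemma J_V: "0 \<le> t \<Longrightarrow> J V t = 2 * pi - h t * L t"
  using J_diff[of t \<kappa> "\<lambda>p t. h t"] J_const[of t h]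
  by (simp add: V_def[abs_def] total_curvature conts)

lemma J_\<kappa>V: "0 \<le> t \<Longrightarrow> J (\<lambda>p t. \<kappa> p t * V p t) t = J (\<lambda>p t. (\<kappa> p t)\<^sup>2) t - 2 * pi * h t"
proof -
  assume t: "0 \<le> t"
  have "J (\<lambda>p t. \<kappa> p t * V p t) t = J (\<lambda>p t. (\<kappa> p t)\<^sup>2 - h t * \<kappa> p t) t"
    by (rule J_cong[OF t]) (simp add: V_def power2_eq_square algebra_simps)
  also have "\<dots> = J (\<lambda>p t. (\<kappa> p t)\<^sup>2) t - J (\<lambda>p t. h t * \<kappa> p t) t"
    by (intro J_diff t continuous_intros conts)
  finally show ?thesis by (simp only: J_cmult total_curvature[OF t]) simp
qed

lemma L_has_derivative:
  "0 \<le> t \<Longrightarrow> (L has_real_derivative - J (\<lambda>p t. \<kappa> p t * V p t) t) (at t within {0..})"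
proof -
  assume t: "0 \<le> t"
  have "J (\<lambda>p t. dt (\<lambda>p t. 1) p t - \<kappa> p t * V p t * 1) t = J (\<lambda>p t. - 1 * (\<kappa> p t * V p t)) t"
    by (rule J_cong[OF t]) (simp add: dt_eqI[OF DERIV_const t])
  also have "\<dots> = - J (\<lambda>p t. \<kappa> p t * V p t) t"
    using J_cmult[of "\<lambda>t. -1" "\<lambda>p t. \<kappa> p t * V p t" t] by simp
  finally have "(J (\<lambda>p t. 1) has_real_derivative - J (\<lambda>p t. \<kappa> p t * V p t) t) (at t within {0..})"
    using J_has_derivative[OF smooth_const t, of 1] by simp
  then show ?thesis by (rule has_real_derivative_eq_on) (use t L_eq in auto)
qed

text \<open>The integrand \<open>X b - Y a\<close> of the area satisfies
  \<open>\<partial>\<^sub>t (X b - Y a) - \<kappa> V (X b - Y a) = \<partial>\<^sub>s (V (X a + Y b)) - 2 V\<close>, and the exact term integrates to zero.\<close>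

lemma A_has_derivative:
  "0 \<le> t \<Longrightarrow> (A has_real_derivative - J V t) (at t within {0..})"
proof -
  assume t: "0 \<le> t"
  define g where "g p t = X p t * b p t - Y p t * a p t" for p t
  define w where "w p t = V p t * (X p t * a p t + Y p t * b p t)" for p t
  define w' where "w' p t = kap 1 p t * (X p t * a p t + Y p t * b p t)
      + V p t * (1 - \<kappa> p t * g p t)" for p t
  have g: "smooth_scalar g"
    unfolding g_def[abs_def] by (intro smooth_diff smooth_mult smooth_X smooth_Y smooth_a smooth_b)
  have dtg: "dt g p t = - V p t + kap 1 p t * (X p t * a p t + Y p t * b p t)" for p
  proof (rule dt_eqI[OF _ t])
    have "(g p has_real_derivative
        (dt X p t * b p t + dt b p t * X p t) - (dt Y p t * a p t + dt a p t * Y p t))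
        (at t within {0..})"
      unfolding g_def[abs_def]
      by (intro DERIV_diff DERIV_mult has_dt smooth_X smooth_Y smooth_a smooth_b t)
    moreover have "(dt X p t * b p t + dt b p t * X p t) - (dt Y p t * a p t + dt a p t * Y p t)
        = - V p t * ((a p t)\<^sup>2 + (b p t)\<^sup>2) + kap 1 p t * (X p t * a p t + Y p t * b p t)"
      unfolding dt_X[OF t] dt_Y[OF t] dt_a[OF t] dt_b[OF t]
      by (simp add: algebra_simps power2_eq_square)
    ultimately show "(g p has_real_derivative
        - V p t + kap 1 p t * (X p t * a p t + Y p t * b p t)) (at t within {0..})"
      by (simp only: unit_length[OF t] mult_1_right)
  qed
  have dw: "((\<lambda>q. w q t) has_real_derivative v p t * w' p t) (at p)" for p
  proof -
    have "((\<lambda>q. w q t) has_real_derivative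
        v p t * kap 1 p t * (X p t * a p t + Y p t * b p t)
        + ((v p t * a p t * a p t + v p t * (- \<kappa> p t * b p t) * X p t)
         + (v p t * b p t * b p t + v p t * (\<kappa> p t * a p t) * Y p t)) * V p t) (at p)"
      unfolding w_def by (intro DERIV_mult DERIV_add d_V d_X d_Y d_a d_b t)
    moreover have "v p t * kap 1 p t * (X p t * a p t + Y p t * b p t)
        + ((v p t * a p t * a p t + v p t * (- \<kappa> p t * b p t) * X p t)
         + (v p t * b p t * b p t + v p t * (\<kappa> p t * a p t) * Y p t)) * V p t
        = v p t * (kap 1 p t * (X p t * a p t + Y p t * b p t)
          + V p t * (((a p t)\<^sup>2 + (b p t)\<^sup>2) - \<kappa> p t * g p t))"
      by (simp add: g_def algebra_simps power2_eq_square)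
    ultimately show ?thesis by (simp only: w'_def unit_length[OF t])
  qed
  have "periodic w" using periodic_V periodic_X periodic_Y periodic_a periodic_b
    by (simp add: periodic_def w_def)
  then have w0: "J w' t = 0" by (intro J_derivative_zero[of t w] t dw)
  have "J (\<lambda>p t. dt g p t - \<kappa> p t * V p t * g p t) t = J (\<lambda>p t. w' p t - 2 * V p t) t"
    by (rule J_cong[OF t]) (simp add: dtg w'_def algebra_simps)
  also have "\<dots> = J w' t - J (\<lambda>p t. 2 * V p t) t"
    unfolding w'_def[abs_def] g_def by (intro J_diff t continuous_intros conts)
  also have "\<dots> = - 2 * J V t"
    using J_cmult[of "\<lambda>t. 2" V t] by (simp add: w0)
  finally have "((\<lambda>t. 1 / 2 * J g t) has_real_derivative 1 / 2 * (- 2 * J V t)) (at t within {0..})"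
    using J_has_derivative[OF g t] by (intro DERIV_cmult) simp
  then have "(A has_real_derivative 1 / 2 * (- 2 * J V t)) (at t within {0..})"
    by (rule has_real_derivative_eq_on) (use t A_eq in \<open>auto simp: g_def[abs_def]\<close>)
  then show ?thesis by simp
qed

definition "deficit t = (L t)\<^sup>2 - 4 * pi * A t"
definition "mean t = 2 * pi / L t"

text \<open>The mean depends on time only, so subtracting it changes no arc-length derivative of positive order.\<close>

definition "dev l p t = (if l = 0 then \<kappa> p t - mean t else kap l p t)"
definition "energy l t = J (\<lambda>p t. (dev l p t)\<^sup>2) t"

lemma dev_0: "dev 0 p t = \<kappa> p t - mean t" and dev_Suc: "dev (Suc l) = kap (Suc l)"
  by (simp_all add: dev_def fun_eq_iff)

lemma d_dev: "0 \<le> t \<Longrightarrow> ((\<lambda>q. dev l q t) has_real_derivative v p t * dev (Suc l) p t) (at p)"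
  using d_kap[of t l p]
  by (cases l) (auto simp: dev_0 dev_Suc intro!: derivative_eq_intros)

lemma cont_dev: "0 \<le> t \<Longrightarrow> continuous_on S (\<lambda>p. dev l p t)"
  by (rule continuous_on_of_derivative[OF d_dev])

lemma curvature_energy_energy:
  "0 \<le> t \<Longrightarrow> curvature_energy l (\<lambda>p. F p t) = L t ^ (2 * l + 1) * energy l t"
proof -
  assume t: "0 \<le> t"
  have "curvature_energy l (\<lambda>p. F p t) =
      arc_integral (\<lambda>p. v p t) (\<lambda>p. 1) ^ (2 * l + 1) * arc_integral (\<lambda>p. v p t) (\<lambda>p. (dev l p t)\<^sup>2)"
    using total_curvature[OF t] L_eq[OF t]
    by (intro closed_curve.curvature_energy_eq[OF closed_curve_at[OF t], of "\<lambda>l p. dev l p t"] d_dev t)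
       (simp add: dev_0 mean_def J_def)
  then show ?thesis using L_eq[OF t] by (simp add: J_def energy_def)
qed

lemma J_dev: "0 \<le> t \<Longrightarrow> J (dev l) t = 0"
proof (cases l)
  case 0
  assume t: "0 \<le> t"
  have "J (dev 0) t = J \<kappa> t - J (\<lambda>p t. mean t) t"
    unfolding dev_0[abs_def] by (intro J_diff t continuous_intros conts)
  then show ?thesis using total_curvature[OF t] J_const[OF t, of mean] L_pos[OF t] 0
    by (simp add: mean_def)
next
  case (Suc m)
  assume t: "0 \<le> t"
  show ?thesis unfolding Suc dev_Suc
    by (intro J_derivative_zero[of t "kap m"] t d_kap periodic_kap)
qed

lemma energy_0_eq: "0 \<le> t \<Longrightarrow> energy 0 t = J (\<lambda>p t. (\<kappa> p t)\<^sup>2) t - 4 * pi\<^sup>2 / L t"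
proof -
  assume t: "0 \<le> t"
  have "energy 0 t = J (\<lambda>p t. (\<kappa> p t)\<^sup>2 - (2 * mean t * \<kappa> p t - (mean t)\<^sup>2)) t"
    unfolding energy_def dev_0
    by (rule J_cong[OF t]) (simp add: power2_diff algebra_simps)
  also have "\<dots> = J (\<lambda>p t. (\<kappa> p t)\<^sup>2) t - J (\<lambda>p t. 2 * mean t * \<kappa> p t - (mean t)\<^sup>2) t"
    by (intro J_diff t continuous_intros conts)
  also have "J (\<lambda>p t. 2 * mean t * \<kappa> p t - (mean t)\<^sup>2) t
      = J (\<lambda>p t. 2 * mean t * \<kappa> p t) t - J (\<lambda>p t. (mean t)\<^sup>2) t"
    by (intro J_diff t continuous_intros conts)
  also have "J (\<lambda>p t. 2 * mean t * \<kappa> p t) t = 2 * mean t * (2 * pi)"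
    by (simp only: J_cmult[of "\<lambda>t. 2 * mean t"] total_curvature[OF t])
  also have "J (\<lambda>p t. (mean t)\<^sup>2) t = (mean t)\<^sup>2 * L t" by (rule J_const[OF t])
  finally show ?thesis using L_pos[OF t] by (simp add: mean_def power2_eq_square field_simps)
qed

lemma energy_nonneg: "0 \<le> t \<Longrightarrow> 0 \<le> energy l t"
  unfolding energy_def by (intro J_nonneg continuous_intros cont_dev) auto

lemma deficit_nonneg: "0 \<le> t \<Longrightarrow> 0 \<le> deficit t"
  using isoperimetric_at by (simp add: deficit_def)

lemma deficit_le_energy: "0 \<le> t \<Longrightarrow> deficit t \<le> L t ^ 3 / pi * energy 0 t"
  using closed_curve.isoperimetric_deficit_bound[OF closed_curve_at, of t] total_curvature[of t] L_eq[of t]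
  by (simp add: deficit_def A_def energy_def J_def dev_0 mean_def)

lemma A_derivative_deficit: "0 \<le> t \<Longrightarrow> - J V t = deficit t / (2 * A t)"
  using A_nonzero[of t] by (simp add: J_V h_def deficit_def field_simps power2_eq_square)

lemma deficit_has_derivative:
  "0 \<le> t \<Longrightarrow> (deficit has_real_derivative - 2 * L t * energy 0 t) (at t within {0..})"
proof -
  assume t: "0 \<le> t"
  have "(deficit has_real_derivative
      2 * L t * (- J (\<lambda>p t. \<kappa> p t * V p t) t) - 4 * pi * (- J V t)) (at t within {0..})"
    unfolding deficit_def[abs_def]
    by (rule derivative_eq_intros L_has_derivative[OF t] A_has_derivative[OF t] refl)+
       simp
  moreover have "2 * L t * (- J (\<lambda>p t. \<kappa> p t * V p t) t) - 4 * pi * (- J V t) = - 2 * L t * energy 0 t"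
    unfolding J_\<kappa>V[OF t] J_V[OF t] energy_0_eq[OF t]
    using L_pos[OF t] by (simp add: field_simps power2_eq_square)
  ultimately show ?thesis by simp
qed

lemma A_pos: "0 \<le> t \<Longrightarrow> 0 < A t"
proof (rule ccontr)
  assume t: "0 \<le> t" and "\<not> 0 < A t"
  then have "A t \<le> 0" by simp
  moreover have "continuous_on {0..} A"
    by (rule DERIV_continuous_on[OF A_has_derivative]) auto
  then have "continuous_on {0..t} A" by (rule continuous_on_subset) auto
  ultimately have "\<exists>s\<ge>0. s \<le> t \<and> A s = 0"
    using initial_area t by (intro IVT2') (auto simp: A_def)
  then show False using A_nonzero by blast
qed

lemma A_lower_bound: "0 \<le> t \<Longrightarrow> A 0 \<le> A t"
proof -
  assume t: "0 \<le> t"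
  have "- A t \<le> - A 0"
    by (rule nonincreasing_Ici[of "\<lambda>t. - A t" "\<lambda>t. - (- J V t)"], rule DERIV_minus[OF A_has_derivative])
       (use t A_derivative_deficit deficit_nonneg A_pos in \<open>auto simp: less_imp_le\<close>)
  then show ?thesis by simp
qed

lemma deficit_derivative_bound: "0 \<le> t \<Longrightarrow> - 2 * L t * energy 0 t \<le> - (2 * pi * deficit t / (L t)\<^sup>2)"
proof -
  assume t: "0 \<le> t"
  have "2 * pi * deficit t / (L t)\<^sup>2 \<le> 2 * pi * (L t ^ 3 / pi * energy 0 t) / (L t)\<^sup>2"
    using deficit_le_energy[OF t] by (intro divide_right_mono mult_left_mono) auto
  also have "\<dots> = 2 * L t * energy 0 t"
    using L_pos[OF t] by (simp add: power3_eq_cube power2_eq_square)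
  finally show ?thesis by simp
qed

lemma deficit_antimono: "0 \<le> t \<Longrightarrow> deficit t \<le> deficit 0"
  by (rule nonincreasing_Ici[OF deficit_has_derivative])
     (auto intro!: mult_nonneg_nonneg energy_nonneg less_imp_le[OF L_pos])

text \<open>The lower bound comes from the isoperimetric inequality. For the upper bound, the deficit shrinks at a rate of at least
  \<open>2\<pi> \<Delta> / L\<^sup>2\<close> while the area grows by \<open>\<Delta> / 2A\<close>, and \<open>A / L\<^sup>2 \<ge> A(0) / L(0)\<^sup>2\<close> because the deficit decreases and
  the area increases. So \<open>\<Delta> + m A\<close> is nonincreasing for \<open>m = 4\<pi> A(0) / L(0)\<^sup>2\<close>, which bounds \<open>A\<close> and then
  \<open>L\<^sup>2 = \<Delta> + 4\<pi>A\<close>.\<close>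

lemma length_bounded:
  obtains l0 l1 where "0 < l0" "\<And>t. 0 \<le> t \<Longrightarrow> l0 \<le> L t" "\<And>t. 0 \<le> t \<Longrightarrow> L t \<le> l1"
proof -
  define m where "m = 4 * pi * A 0 / (L 0)\<^sup>2"
  have A0: "0 < A 0" by (rule A_pos) simp
  have L0: "0 < L 0" by (rule L_pos) simp
  have m: "0 < m" using A0 L0 by (simp add: m_def)
  have ratio: "m \<le> 4 * pi * A t / (L t)\<^sup>2" if t: "0 \<le> t" for t
  proof -
    have "A 0 * deficit t \<le> A t * deficit 0"
      using A_lower_bound[OF t] deficit_antimono[OF t] deficit_nonneg[OF t] A0
      by (intro mult_mono) auto
    then have "A 0 * (L t)\<^sup>2 \<le> A t * (L 0)\<^sup>2" by (simp add: deficit_def algebra_simps)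
    then show ?thesis using L_pos[OF t] L0 by (simp add: m_def field_simps)
  qed
  have mono: "deficit t + m * A t \<le> deficit 0 + m * A 0" if t: "0 \<le> t" for t
  proof (rule nonincreasing_Ici[where f = "\<lambda>t. deficit t + m * A t"
        and f' = "\<lambda>t. - 2 * L t * energy 0 t + m * (- J V t)"])
    fix s :: real assume s: "0 \<le> s"
    then show "((\<lambda>t. deficit t + m * A t) has_real_derivative
        - 2 * L s * energy 0 s + m * (- J V s)) (at s within {0..})"
      by (intro DERIV_add DERIV_cmult deficit_has_derivative A_has_derivative)
  next
    fix s :: real assume s: "0 \<le> s"
    have "m * (- J V s) \<le> 4 * pi * A s / (L s)\<^sup>2 * (deficit s / (2 * A s))"
      unfolding A_derivative_deficit[OF s]
      using ratio[OF s] deficit_nonneg[OF s] A_pos[OF s] by (intro mult_right_mono) auto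
    also have "\<dots> = 2 * pi * deficit s / (L s)\<^sup>2" using A_pos[OF s] by simp
    finally show "- 2 * L s * energy 0 s + m * (- J V s) \<le> 0"
      using deficit_derivative_bound[OF s] by simp
  qed (use t in auto)
  show ?thesis
  proof
    show "0 < sqrt (4 * pi * A 0)" using A0 by simp
    show "sqrt (4 * pi * A 0) \<le> L t" if t: "0 \<le> t" for t
    proof (rule real_le_lsqrt)
      have "4 * pi * A 0 \<le> 4 * pi * A t" using A_lower_bound[OF t] by simp
      also note isoperimetric_at[OF t]
      finally show "4 * pi * A 0 \<le> (L t)\<^sup>2" .
    qed (use L_pos[OF t] in auto)
    show "L t \<le> sqrt (deficit 0 + 4 * pi * ((deficit 0 + m * A 0) / m))" if t: "0 \<le> t" for t
    proof (rule real_le_rsqrt)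
      have "m * A t \<le> deficit 0 + m * A 0" using mono[OF t] deficit_nonneg[OF t] by simp
      then have "A t \<le> (deficit 0 + m * A 0) / m" using m by (simp add: field_simps)
      then have "4 * pi * A t \<le> 4 * pi * ((deficit 0 + m * A 0) / m)"
        by (rule mult_left_mono) simp
      then show "(L t)\<^sup>2 \<le> deficit 0 + 4 * pi * ((deficit 0 + m * A 0) / m)"
        using deficit_antimono[OF t] unfolding deficit_def[of t] by linarith
    qed
  qed
qed

lemma exp_decay_deficit: "exp_decay deficit"
proof -
  obtain l0 l1 where l: "0 < l0" "\<And>t. 0 \<le> t \<Longrightarrow> l0 \<le> L t" "\<And>t. 0 \<le> t \<Longrightarrow> L t \<le> l1"
    by (rule length_bounded) blast
  show ?thesis
  proof (rule exp_decay_of_linear_inequality[OF deficit_has_derivative, of "2 * pi / l1\<^sup>2"])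
    fix t :: real assume t: "0 \<le> t"
    have "(L t)\<^sup>2 \<le> l1\<^sup>2" using l(3)[OF t] L_pos[OF t] by (intro power_mono) auto
    then have "2 * pi * deficit t / l1\<^sup>2 \<le> 2 * pi * deficit t / (L t)\<^sup>2"
      using L_pos[OF t] l(3)[OF t] deficit_nonneg[OF t] by (intro divide_left_mono mult_pos_pos) auto
    then show "- 2 * L t * energy 0 t \<le> - (2 * pi / l1\<^sup>2) * deficit t"
      using deficit_derivative_bound[OF t] by simp
  next
    have "0 < l1" using l(1) l(2)[of 0] l(3)[of 0] by simp
    then show "0 < 2 * pi / l1\<^sup>2" by simp
  qed (auto intro: deficit_nonneg)
qed

text \<open>The amount by which the coefficient \<open>L / 2A\<close> of the flow exceeds the mean curvature, that is, its value for the
  circle of the same length.\<close>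

definition "excess t = h t - mean t"

lemma V_eq: "V p t = dev 0 p t - excess t"
  by (simp add: V_def dev_0 excess_def)

lemma \<kappa>_eq: "\<kappa> p t = dev 0 p t + mean t"
  by (simp add: dev_0)

lemma excess_eq: "0 \<le> t \<Longrightarrow> excess t = deficit t / (2 * A t * L t)"
  using A_pos[of t] L_pos[of t]
  by (simp add: excess_def h_def mean_def deficit_def field_simps power2_eq_square)

lemma excess_nonneg: "0 \<le> t \<Longrightarrow> 0 \<le> excess t"
  using A_pos[of t] L_pos[of t] deficit_nonneg[of t] by (simp add: excess_eq)

lemma exp_decay_excess: "exp_decay excess"
proof -
  obtain l0 l1 where l: "0 < l0" "\<And>t. 0 \<le> t \<Longrightarrow> l0 \<le> L t" "\<And>t. 0 \<le> t \<Longrightarrow> L t \<le> l1"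
    by (rule length_bounded) blast
  have A0: "0 < A 0" by (rule A_pos) simp
  show ?thesis
  proof (rule exp_decay_mono[OF exp_decay_cmult[OF exp_decay_deficit, of "1 / (2 * A 0 * l0)"]])
    fix t :: real assume t: "0 \<le> t"
    have "2 * A 0 * l0 \<le> 2 * A t * L t"
      using A_lower_bound[OF t] l(1) l(2)[OF t] A0 A_pos[OF t] by (intro mult_mono) auto
    then show "excess t \<le> 1 / (2 * A 0 * l0) * deficit t"
      unfolding excess_eq[OF t] using deficit_nonneg[OF t] l(1) A0 A_pos[OF t] L_pos[OF t]
      by (simp add: divide_left_mono)
  qed (use l A0 in auto)
qed

lemma mean_nonneg: "0 \<le> t \<Longrightarrow> 0 \<le> mean t"
  using L_pos[of t] by (simp add: mean_def)

lemma mean_bounded: obtains B where "0 < B" "\<And>t. 0 \<le> t \<Longrightarrow> mean t \<le> B"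
proof -
  obtain l0 l1 where l: "0 < l0" "\<And>t. 0 \<le> t \<Longrightarrow> l0 \<le> L t" "\<And>t. 0 \<le> t \<Longrightarrow> L t \<le> l1"
    by (rule length_bounded) blast
  have "mean t \<le> 2 * pi / l0" if "0 \<le> t" for t
    unfolding mean_def using l(1) l(2)[OF that] by (intro divide_left_mono) auto
  with that[of "2 * pi / l0"] l(1) show ?thesis by simp
qed

section \<open>Evolution of the higher energies\<close>

text \<open>The remainder in \<open>\<partial>\<^sub>t \<partial>\<^sub>s\<^sup>l \<kappa> = \<partial>\<^sub>s\<^sup>l\<^sup>+\<^sup>2 \<kappa> + R\<^sub>l\<close>. The recursion is the commutator of \<open>\<partial>\<^sub>t\<close> and \<open>\<partial>\<^sub>s\<close>.\<close>

primrec R :: "nat \<Rightarrow> real \<Rightarrow> real \<Rightarrow> real" where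
  "R 0 = (\<lambda>p t. (\<kappa> p t)\<^sup>2 * V p t)"
| "R (Suc l) = (\<lambda>p t. D (R l) p t + \<kappa> p t * V p t * kap (Suc l) p t)"

text \<open>Polynomials in \<open>V\<close> and the derivatives of \<open>\<kappa>\<close> in which every monomial contains exactly \<open>i\<close>
  derivatives. For \<open>i \<ge> 1\<close> a derivative of order \<open>i\<close> therefore occurs at most linearly, with coefficients
  of order zero, and every monomial contains some derivative of positive order, which makes it small.\<close>

inductive weighted :: "nat \<Rightarrow> (real \<Rightarrow> real \<Rightarrow> real) \<Rightarrow> bool" where
  weighted_kap: "weighted l (kap l)"
| weighted_V: "weighted 0 V"
| weighted_add: "weighted i f \<Longrightarrow> weighted i g \<Longrightarrow> weighted i (\<lambda>p t. f p t + g p t)"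
| weighted_mult: "weighted i f \<Longrightarrow> weighted j g \<Longrightarrow> weighted (i + j) (\<lambda>p t. f p t * g p t)"
| weighted_cong: "weighted i f \<Longrightarrow> (\<And>p t. 0 \<le> t \<Longrightarrow> g p t = f p t) \<Longrightarrow> weighted i g"

lemma weighted_derivative:
  assumes "weighted i f"
  shows "weighted (Suc i) (D f)
    \<and> (\<forall>p. \<forall>t\<ge>0. ((\<lambda>q. f q t) has_real_derivative v p t * D f p t) (at p)) \<and> periodic f"
  using assms
proof induction
  case (weighted_kap l)
  show ?case using weighted.weighted_kap[of "Suc l"] d_kap[of _ l] periodic_kap[of l]
    by (auto simp: kap.simps(2))
next
  case weighted_V
  have eq: "D V p t = kap 1 p t" if "0 \<le> t" for p t using d_V[OF that] by (rule D_eqI[OF that])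
  have "weighted (Suc 0) (D V)"
    by (rule weighted_cong[OF weighted.weighted_kap]) (simp add: eq)
  then show ?case using d_V eq periodic_V by simp
next
  case (weighted_add i f g)
  have d: "((\<lambda>q. f q t + g q t) has_real_derivative v p t * (D f p t + D g p t)) (at p)"
    if "0 \<le> t" for p t
    using weighted_add.IH that by (auto intro!: derivative_eq_intros simp: algebra_simps)
  have eq: "D (\<lambda>p t. f p t + g p t) p t = D f p t + D g p t" if "0 \<le> t" for p t
    by (intro D_eqI d that)
  have "weighted (Suc i) (\<lambda>p t. D f p t + D g p t)"
    using weighted_add.IH weighted.weighted_add by blast
  then have "weighted (Suc i) (D (\<lambda>p t. f p t + g p t))"
    by (rule weighted_cong) (simp add: eq)
  then show ?case using d eq weighted_add.IH by (simp add: periodic_def)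
next
  case (weighted_mult i f j g)
  have d: "((\<lambda>q. f q t * g q t) has_real_derivative v p t * (D f p t * g p t + f p t * D g p t)) (at p)"
    if "0 \<le> t" for p t
  proof -
    have "((\<lambda>q. f q t * g q t) has_real_derivative
        v p t * D f p t * g p t + v p t * D g p t * f p t) (at p)"
      using weighted_mult.IH that by (intro DERIV_mult) auto
    then show ?thesis by (simp add: algebra_simps)
  qed
  have eq: "D (\<lambda>p t. f p t * g p t) p t = D f p t * g p t + f p t * D g p t" if "0 \<le> t" for p t
    by (intro D_eqI d that)
  have "weighted (Suc i + j) (\<lambda>p t. D f p t * g p t)" "weighted (i + Suc j) (\<lambda>p t. f p t * D g p t)"
    using weighted_mult weighted.weighted_mult by blast+
  then have "weighted (Suc (i + j)) (\<lambda>p t. D f p t * g p t + f p t * D g p t)"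
    using weighted.weighted_add by simp
  then have "weighted (Suc (i + j)) (D (\<lambda>p t. f p t * g p t))"
    by (rule weighted_cong) (simp add: eq)
  then show ?case using d eq weighted_mult.IH by (simp add: periodic_def)
next
  case (weighted_cong i f g)
  have d: "((\<lambda>q. g q t) has_real_derivative v p t * D f p t) (at p)" if "0 \<le> t" for p t
    using weighted_cong.IH that by (simp add: weighted_cong.hyps(2))
  have eq: "D g p t = D f p t" if "0 \<le> t" for p t by (intro D_eqI d that)
  have "weighted (Suc i) (D g)"
    using weighted_cong.IH eq weighted.weighted_cong by blast
  then show ?case using d eq weighted_cong.IH by (simp add: periodic_def weighted_cong.hyps(2))
qed

lemma weighted_D: "weighted i f \<Longrightarrow> weighted (Suc i) (D f)"
  and d_weighted: "weighted i f \<Longrightarrow> 0 \<le> t \<Longrightarrow> ((\<lambda>q. f q t) has_real_derivative v p t * D f p t) (at p)"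
  and periodic_weighted: "weighted i f \<Longrightarrow> periodic f"
  using weighted_derivative by blast+

lemma cont_weighted: "weighted i f \<Longrightarrow> 0 \<le> t \<Longrightarrow> continuous_on S (\<lambda>p. f p t)"
  by (rule continuous_on_of_derivative[OF d_weighted])

lemma weighted_R: "weighted l (R l)"
proof (induction l)
  case 0
  have "weighted (0 + 0 + 0) (\<lambda>p t. \<kappa> p t * \<kappa> p t * V p t)"
    by (intro weighted.intros)
  then show ?case by (simp add: power2_eq_square)
next
  case (Suc l)
  have "weighted (0 + 0 + Suc l) (\<lambda>p t. \<kappa> p t * V p t * kap (Suc l) p t)"
    by (intro weighted.intros)
  then show ?case using weighted_D[OF Suc] weighted_add by simp
qed

lemma dt_kap:
  assumes t: "0 \<le> t"
  shows "dt (kap l) p t = kap (Suc (Suc l)) p t + R l p t"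
proof (induction l arbitrary: p)
  case 0
  show ?case using dt_curvature[OF t] by (simp add: numeral_2_eq_2)
next
  case (Suc l)
  have "((\<lambda>q. kap (Suc (Suc l)) q t + R l q t) has_real_derivative
      v p t * (kap (Suc (Suc (Suc l))) p t + D (R l) p t)) (at p)"
    unfolding distrib_left by (intro DERIV_add d_kap d_weighted[OF weighted_R] t)
  from dt_D[OF smooth_kap t Suc.IH this]
  have "dt (D (kap l)) p t = kap (Suc (Suc (Suc l))) p t + D (R l) p t + \<kappa> p t * V p t * D (kap l) p t" .
  then show ?case by (simp add: kap.simps(2))
qed

text \<open>The top derivative contained in \<open>R (Suc l)\<close> is moved onto \<open>\<partial>\<^sub>s\<^sup>l\<^sup>+\<^sup>1 \<kappa>\<close> by an integration by parts. What remains is \<open>R l\<close>, of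
  one order less than the energy itself, paired with the derivative that the dissipation controls.\<close>

lemma energy_Suc_has_derivative:
  assumes t: "0 \<le> t"
  shows "(energy (Suc l) has_real_derivative
      - 2 * energy (Suc (Suc l)) t - 2 * J (\<lambda>p t. kap (Suc (Suc l)) p t * R l p t) t
      + J (\<lambda>p t. (kap (Suc l) p t)\<^sup>2 * (\<kappa> p t * V p t)) t) (at t within {0..})"
proof -
  note cR = cont_weighted[OF weighted_R t] and cDR = cont_weighted[OF weighted_D[OF weighted_R] t]
  define k1 k2 k3 where "k1 = kap (Suc l)" and "k2 = kap (Suc (Suc l))" and "k3 = kap (Suc (Suc (Suc l)))"
  note k_defs = k1_def k2_def k3_def
  have ck: "continuous_on S (\<lambda>p. k1 p t)" "continuous_on S (\<lambda>p. k2 p t)"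
    "continuous_on S (\<lambda>p. k3 p t)" for S
    unfolding k_defs by (intro cont_kap t)+
  have "smooth_scalar (\<lambda>p t. (k1 p t)\<^sup>2)" unfolding k_defs by (intro smooth_power smooth_kap)
  note deriv = J_has_derivative[OF this t]
  have dk: "dt (\<lambda>p t. (k1 p t)\<^sup>2) p t = 2 * k1 p t * (k3 p t + R (Suc l) p t)" for p
  proof (rule dt_eqI[OF _ t])
    have "((\<lambda>\<tau>. (k1 p \<tau>)\<^sup>2) has_real_derivative 2 * k1 p t * dt (kap (Suc l)) p t) (at t within {0..})"
      unfolding k_defs by (rule derivative_eq_intros has_dt[OF smooth_kap t] refl)+ simp
    then show "((\<lambda>\<tau>. (k1 p \<tau>)\<^sup>2) has_real_derivative 2 * k1 p t * (k3 p t + R (Suc l) p t))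
        (at t within {0..})" unfolding dt_kap[OF t] k_defs .
  qed
  have "J (\<lambda>p t. dt (\<lambda>p t. (k1 p t)\<^sup>2) p t - \<kappa> p t * V p t * (k1 p t)\<^sup>2) t
      = J (\<lambda>p t. 2 * (k1 p t * k3 p t) + 2 * (k1 p t * D (R l) p t) + (k1 p t)\<^sup>2 * (\<kappa> p t * V p t)) t"
    by (rule J_cong[OF t])
       (simp add: dk k1_def[symmetric], simp add: power2_eq_square algebra_simps)
  also have "\<dots> = J (\<lambda>p t. 2 * (k1 p t * k3 p t) + 2 * (k1 p t * D (R l) p t)) t
      + J (\<lambda>p t. (k1 p t)\<^sup>2 * (\<kappa> p t * V p t)) t"
    by (intro J_add t continuous_intros conts ck cDR)
  also have "J (\<lambda>p t. 2 * (k1 p t * k3 p t) + 2 * (k1 p t * D (R l) p t)) t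
      = J (\<lambda>p t. 2 * (k1 p t * k3 p t)) t + J (\<lambda>p t. 2 * (k1 p t * D (R l) p t)) t"
    by (intro J_add t continuous_intros conts ck cDR)
  also have "J (\<lambda>p t. 2 * (k1 p t * k3 p t)) t = 2 * J (\<lambda>p t. k1 p t * k3 p t) t"
    by (rule J_cmult)
  also have "J (\<lambda>p t. 2 * (k1 p t * D (R l) p t)) t = 2 * J (\<lambda>p t. k1 p t * D (R l) p t) t"
    by (rule J_cmult)
  also have "J (\<lambda>p t. k1 p t * k3 p t) t = - J (\<lambda>p t. k2 p t * k2 p t) t"
    unfolding k_defs by (intro J_by_parts t d_kap periodic_kap conts)
  also have "J (\<lambda>p t. k1 p t * D (R l) p t) t = - J (\<lambda>p t. k2 p t * R l p t) t"
    unfolding k_defs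
    by (intro J_by_parts t d_kap d_weighted[OF weighted_R] periodic_kap
        periodic_weighted[OF weighted_R] conts cDR)
  finally show ?thesis
    using deriv by (simp add: energy_def[abs_def] dev_Suc k_defs power2_eq_square)
qed

text \<open>The change of the mean turns \<open>\<integral> \<kappa>\<^sup>3 V\<close> into \<open>\<integral> (\<kappa>\<^sup>2 - c\<^sup>2) \<kappa> V\<close> with \<open>c = 2\<pi> / L\<close>. Written in \<open>u = \<kappa> - c\<close>, this
  integrand has no constant term, and its linear term integrates to zero.\<close>

lemma energy_0_has_derivative:
  assumes t: "0 \<le> t"
  shows "(energy 0 has_real_derivative
      - 2 * energy 1 t + J (\<lambda>p t. (dev 0 p t)^4 + (3 * mean t - excess t) * (dev 0 p t)^3
        + (2 * (mean t)\<^sup>2 - 3 * mean t * excess t) * (dev 0 p t)\<^sup>2) t) (at t within {0..})"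
proof -
  define W where "W p t = (dev 0 p t)^4 + (3 * mean t - excess t) * (dev 0 p t)^3
        + (2 * (mean t)\<^sup>2 - 3 * mean t * excess t) * (dev 0 p t)\<^sup>2" for p t
  have k2: "kap (Suc (Suc 0)) = kap 2" by (simp only: numeral_2_eq_2)
  have "smooth_scalar (\<lambda>p t. (\<kappa> p t)\<^sup>2)" by (intro smooth_power smooth_kap)
  note deriv = J_has_derivative[OF this t]
  have dk: "dt (\<lambda>p t. (\<kappa> p t)\<^sup>2) p t = 2 * \<kappa> p t * (kap 2 p t + (\<kappa> p t)\<^sup>2 * V p t)" for p
  proof (rule dt_eqI[OF _ t])
    have "((\<lambda>\<tau>. (\<kappa> p \<tau>)\<^sup>2) has_real_derivative 2 * \<kappa> p t * dt \<kappa> p t) (at t within {0..})"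
      by (rule derivative_eq_intros has_dt[OF smooth_kap t] refl)+ simp
    then show "((\<lambda>\<tau>. (\<kappa> p \<tau>)\<^sup>2) has_real_derivative 2 * \<kappa> p t * (kap 2 p t + (\<kappa> p t)\<^sup>2 * V p t))
        (at t within {0..})" unfolding dt_curvature[OF t] .
  qed
  have "J (\<lambda>p t. dt (\<lambda>p t. (\<kappa> p t)\<^sup>2) p t - \<kappa> p t * V p t * (\<kappa> p t)\<^sup>2) t
      = J (\<lambda>p t. 2 * (\<kappa> p t * kap 2 p t) + (\<kappa> p t)^3 * V p t) t"
    by (rule J_cong[OF t]) (simp add: dk, simp add: power2_eq_square power3_eq_cube algebra_simps)
  also have "\<dots> = J (\<lambda>p t. 2 * (\<kappa> p t * kap 2 p t)) t + J (\<lambda>p t. (\<kappa> p t)^3 * V p t) t"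
    by (intro J_add t continuous_intros conts)
  also have "J (\<lambda>p t. 2 * (\<kappa> p t * kap 2 p t)) t = 2 * J (\<lambda>p t. \<kappa> p t * kap 2 p t) t"
    by (rule J_cmult)
  also have "J (\<lambda>p t. \<kappa> p t * kap 2 p t) t = - J (\<lambda>p t. kap 1 p t * kap 1 p t) t"
    using d_kap[OF t, of "Suc 0"] d_kap[OF t, of 0] unfolding k2 One_nat_def
    by (intro J_by_parts t periodic_kap conts) 
  also have "J (\<lambda>p t. kap 1 p t * kap 1 p t) t = energy 1 t"
    by (simp add: energy_def dev_Suc power2_eq_square)
  finally have dJ: "(J (\<lambda>p t. (\<kappa> p t)\<^sup>2) has_real_derivative
      - 2 * energy 1 t + J (\<lambda>p t. (\<kappa> p t)^3 * V p t) t) (at t within {0..})"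
    using deriv by simp
  have "((\<lambda>t. 4 * pi\<^sup>2 / L t) has_real_derivative (mean t)\<^sup>2 * J (\<lambda>p t. \<kappa> p t * V p t) t)
      (at t within {0..})"
    using L_pos[OF t]
    by (auto intro!: derivative_eq_intros L_has_derivative[OF t]
        simp: mean_def power2_eq_square field_simps)
  from DERIV_diff[OF dJ this]
  have "(energy 0 has_real_derivative
      - 2 * energy 1 t + J (\<lambda>p t. (\<kappa> p t)^3 * V p t) t
      - (mean t)\<^sup>2 * J (\<lambda>p t. \<kappa> p t * V p t) t) (at t within {0..})"
    by (rule has_real_derivative_eq_on) (use t energy_0_eq in auto)
  moreover have "J (\<lambda>p t. (\<kappa> p t)^3 * V p t) t - (mean t)\<^sup>2 * J (\<lambda>p t. \<kappa> p t * V p t) t = J W t"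
  proof -
    have "J (\<lambda>p t. (\<kappa> p t)^3 * V p t) t - J (\<lambda>p t. (mean t)\<^sup>2 * (\<kappa> p t * V p t)) t
        = J (\<lambda>p t. (\<kappa> p t)^3 * V p t - (mean t)\<^sup>2 * (\<kappa> p t * V p t)) t"
      by (rule J_diff[symmetric]) (intro t continuous_intros conts)+
    also have "\<dots> = J (\<lambda>p t. W p t - 2 * (mean t)\<^sup>2 * excess t * dev 0 p t) t"
      by (rule J_cong[OF t])
         (simp add: W_def V_eq \<kappa>_eq power2_eq_square power3_eq_cube power4_eq_xxxx algebra_simps)
    also have "\<dots> = J W t - J (\<lambda>p t. 2 * (mean t)\<^sup>2 * excess t * dev 0 p t) t"
      unfolding W_def[abs_def] by (intro J_diff t continuous_intros cont_dev)
    also have "J (\<lambda>p t. 2 * (mean t)\<^sup>2 * excess t * dev 0 p t) t = 0"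
      unfolding J_cmult[of "\<lambda>t. 2 * (mean t)\<^sup>2 * excess t"] J_dev[OF t] by simp
    finally show ?thesis by (simp add: J_cmult[of "\<lambda>t. (mean t)\<^sup>2"])
  qed
  ultimately show ?thesis unfolding W_def by (simp only: add_diff_eq[symmetric])
qed

section \<open>Differential inequalities for the energies\<close>

lemma dev_sup_bound:
  "0 \<le> t \<Longrightarrow> p \<in> {0..1} \<Longrightarrow> (dev l p t)\<^sup>2 \<le> L t * energy (Suc l) t"
  using speed.mean_zero_sup_bound[OF speed_at, of t "\<lambda>p. dev l p t" "\<lambda>p. dev (Suc l) p t" p]
  by (simp add: d_dev cont_dev J_dev[unfolded J_def] L_eq energy_def J_def)

lemma dev_interpolated_sup_bound:
  "0 \<le> t \<Longrightarrow> p \<in> {0..1} \<Longrightarrow> 0 < \<alpha> \<Longrightarrow>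
    (dev l p t)\<^sup>2 \<le> \<alpha> * energy l t + energy (Suc l) t / \<alpha>"
  using speed.mean_zero_interpolated_sup_bound[OF speed_at,
      of t "\<lambda>p. dev l p t" "\<lambda>p. dev (Suc l) p t" p \<alpha>]
  by (simp add: d_dev cont_dev J_dev[unfolded J_def] energy_def J_def)

definition energy_rate :: "nat \<Rightarrow> real \<Rightarrow> real" where
  "energy_rate l t = (case l of
     0 \<Rightarrow> - 2 * energy 1 t + J (\<lambda>p t. (dev 0 p t)^4 + (3 * mean t - excess t) * (dev 0 p t)^3
        + (2 * (mean t)\<^sup>2 - 3 * mean t * excess t) * (dev 0 p t)\<^sup>2) t
   | Suc m \<Rightarrow> - 2 * energy (Suc (Suc m)) t - 2 * J (\<lambda>p t. kap (Suc (Suc m)) p t * R m p t) t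
        + J (\<lambda>p t. (kap (Suc m) p t)\<^sup>2 * (\<kappa> p t * V p t)) t)"

lemma energy_has_rate:
  "0 \<le> t \<Longrightarrow> (energy l has_real_derivative energy_rate l t) (at t within {0..})"
  using energy_0_has_derivative energy_Suc_has_derivative by (cases l) (auto simp: energy_rate_def)

lemma excess_bounded: obtains B where "0 < B" "\<And>t. 0 \<le> t \<Longrightarrow> excess t \<le> B"
  using exp_decay_bounded[OF exp_decay_excess] that by blast

text \<open>The quartic term is controlled by the interpolated sup bound with \<open>\<alpha> = 2 (1 + energy 0)\<close>, which leaves at most
  the share \<open>energy 1\<close> of the dissipation; the cubic term lies between the quartic and the quadratic one.\<close>

lemma dissipation_0:
  obtains K where "0 \<le> K"
    "\<And>t. 0 \<le> t \<Longrightarrow> energy_rate 0 t + energy 1 t \<le> (1 + energy 0 t)\<^sup>2 * (K * energy 0 t)"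
proof -
  obtain B where B: "0 < B" "\<And>t. 0 \<le> t \<Longrightarrow> mean t \<le> B" by (rule mean_bounded) blast
  obtain B' where B': "0 < B'" "\<And>t. 0 \<le> t \<Longrightarrow> excess t \<le> B'" by (rule excess_bounded) blast
  define M where "M = 3 * B + B' + 2 * B\<^sup>2"
  define N where "N = M\<^sup>2 / 4 + M"
  have M: "0 < M" unfolding M_def using B(1) B'(1) by (intro add_pos_pos) auto
  have N: "0 < N" unfolding N_def using M by (intro add_nonneg_pos) auto
  show ?thesis
  proof (rule that[of "4 + N"])
    fix t :: real assume t: "0 \<le> t"
    define e0 e1 where "e0 = energy 0 t" and "e1 = energy 1 t"
    have e: "0 \<le> e0" "0 \<le> e1" unfolding e0_def e1_def by (intro energy_nonneg t)+
    define S where "S = 2 * (1 + e0) * e0 + e1 / (2 * (1 + e0))"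
    have S: "(dev 0 p t)\<^sup>2 \<le> S" if "p \<in> {0..1}" for p
      using dev_interpolated_sup_bound[OF t that, of "2 * (1 + e0)" 0] e
      by (simp add: S_def e0_def e1_def)
    have m: "0 \<le> mean t" "mean t \<le> B" and x: "0 \<le> excess t" "excess t \<le> B'"
      using mean_nonneg[OF t] B(2)[OF t] excess_nonneg[OF t] B'(2)[OF t] by auto
    have "(mean t)\<^sup>2 \<le> B\<^sup>2" using m by (intro power_mono) auto
    then have c2: "2 * (mean t)\<^sup>2 - 3 * mean t * excess t \<le> M"
      using mult_nonneg_nonneg[OF m(1) x(1)] B(1) B'(1) by (simp add: M_def)
    have "0 \<le> B\<^sup>2" by simp
    then have c3: "\<bar>3 * mean t - excess t\<bar> \<le> M" using m x unfolding M_def by linarith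
    have "J (\<lambda>p t. (dev 0 p t)^4 + (3 * mean t - excess t) * (dev 0 p t)^3
        + (2 * (mean t)\<^sup>2 - 3 * mean t * excess t) * (dev 0 p t)\<^sup>2) t
      \<le> J (\<lambda>p t. (\<lambda>_. 2 * S + N) t * (dev 0 p t)\<^sup>2) t"
    proof (rule J_mono[OF t])
      fix p :: real assume p: "p \<in> {0..1}"
      define u where "u = dev 0 p t"
      have "(3 * mean t - excess t) * u^3 \<le> \<bar>(3 * mean t - excess t) * u^3\<bar>" by simp
      also have "\<dots> \<le> M * \<bar>u\<bar>^3"
        unfolding abs_mult power_abs[symmetric] using c3 by (intro mult_right_mono) auto
      also have "\<dots> = (M * \<bar>u\<bar>) * u\<^sup>2" by (simp add: power3_eq_cube power2_eq_square)
      also have "\<dots> \<le> (u\<^sup>2 + M\<^sup>2 / 4) * u\<^sup>2"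
      proof (rule mult_right_mono)
        have "0 \<le> (\<bar>u\<bar> - M / 2)\<^sup>2" by simp
        also have "\<dots> = u\<^sup>2 + M\<^sup>2 / 4 - M * \<bar>u\<bar>"
          by (simp add: power2_diff power_divide)
        finally show "M * \<bar>u\<bar> \<le> u\<^sup>2 + M\<^sup>2 / 4" by simp
      qed simp
      finally have 3: "(3 * mean t - excess t) * u^3 \<le> (u\<^sup>2 + M\<^sup>2 / 4) * u\<^sup>2" .
      have 2: "(2 * (mean t)\<^sup>2 - 3 * mean t * excess t) * u\<^sup>2 \<le> M * u\<^sup>2"
        using c2 by (intro mult_right_mono) auto
      have "u\<^sup>2 * u\<^sup>2 \<le> S * u\<^sup>2" using S[OF p] by (intro mult_right_mono) (auto simp: u_def)
      then have "u^4 + (u\<^sup>2 + M\<^sup>2 / 4) * u\<^sup>2 + M * u\<^sup>2 \<le> (2 * S + N) * u\<^sup>2"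
        by (simp add: N_def algebra_simps power4_eq_xxxx power2_eq_square)
      then show "u^4 + (3 * mean t - excess t) * u^3
          + (2 * (mean t)\<^sup>2 - 3 * mean t * excess t) * u\<^sup>2 \<le> (2 * S + N) * u\<^sup>2"
        using 2 3 by linarith
    qed (intro continuous_intros cont_dev t)+
    also have "\<dots> = (2 * S + N) * e0" unfolding J_cmult by (simp add: e0_def energy_def)
    also have "\<dots> = 4 * (1 + e0) * e0\<^sup>2 + e1 * (e0 / (1 + e0)) + N * e0"
      using e by (simp add: S_def field_simps power2_eq_square)
    also have "\<dots> \<le> 4 * (1 + e0) * e0\<^sup>2 + e1 * 1 + N * e0"
      using e N by (intro add_mono mult_left_mono) auto
    finally have "energy_rate 0 t + e1 \<le> e0 * (4 * ((1 + e0) * e0) + N)"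
      by (simp add: energy_rate_def e1_def power2_eq_square algebra_simps)
    also have "\<dots> \<le> e0 * (4 * (1 + e0)\<^sup>2 + N * (1 + e0)\<^sup>2)"
    proof (intro mult_left_mono add_mono)
      show "(1 + e0) * e0 \<le> (1 + e0)\<^sup>2" using e by (simp add: power2_eq_square algebra_simps)
      have "N * 1 \<le> N * (1 + e0)\<^sup>2" using e N by (intro mult_left_mono one_le_power) auto
      then show "N \<le> N * (1 + e0)\<^sup>2" by simp
    qed (use e N in auto)
    finally show "energy_rate 0 t + energy 1 t \<le> (1 + energy 0 t)\<^sup>2 * ((4 + N) * energy 0 t)"
      by (simp add: e0_def e1_def algebra_simps)
  qed (use N in auto)
qed

lemma dev_bounded:
  assumes "exp_decay (energy (Suc l))"
  obtains B where "0 \<le> B" "\<And>p t. 0 \<le> t \<Longrightarrow> p \<in> {0..1} \<Longrightarrow> \<bar>dev l p t\<bar> \<le> B"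
proof -
  obtain l0 l1 where l: "0 < l0" "\<And>t. 0 \<le> t \<Longrightarrow> l0 \<le> L t" "\<And>t. 0 \<le> t \<Longrightarrow> L t \<le> l1"
    by (rule length_bounded) blast
  obtain E where E: "0 < E" "\<And>t. 0 \<le> t \<Longrightarrow> energy (Suc l) t \<le> E"
    using exp_decay_bounded[OF assms] by blast
  show ?thesis
  proof (rule that[of "sqrt (l1 * E)"])
    have "0 < l1" using l(1) l(2)[of 0] l(3)[of 0] by simp
    then show "0 \<le> sqrt (l1 * E)" using E(1) by simp
    fix p t :: real assume t: "0 \<le> t" and p: "p \<in> {0..1}"
    have "(dev l p t)\<^sup>2 \<le> L t * energy (Suc l) t" by (rule dev_sup_bound[OF t p])
    also have "\<dots> \<le> l1 * E"
      using l(3)[OF t] E(2)[OF t] energy_nonneg[OF t] L_pos[OF t] by (intro mult_mono) auto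
    finally show "\<bar>dev l p t\<bar> \<le> sqrt (l1 * E)" by (simp add: real_le_rsqrt)
  qed
qed

text \<open>If the energies up to order \<open>m \<ge> 1\<close> decay, an expression of weight \<open>i\<close> is bounded for \<open>i < m\<close>, and decays in
  the square mean for \<open>1 \<le> i \<le> m\<close>: in a product of weight at most \<open>m\<close> one factor may have the critical weight \<open>m\<close>,
  but then the other one has weight zero.\<close>

lemma weighted_bounds:
  assumes "weighted i f" and m: "1 \<le> m" and dec: "\<And>j. j \<le> m \<Longrightarrow> exp_decay (energy j)"
  shows "(i < m \<longrightarrow> (\<exists>B\<ge>0. \<forall>t\<ge>0. \<forall>p\<in>{0..1}. \<bar>f p t\<bar> \<le> B))
    \<and> (1 \<le> i \<and> i \<le> m \<longrightarrow> exp_decay (J (\<lambda>p t. (f p t)\<^sup>2)))"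
  using assms(1)
proof induction
  case (weighted_kap l)
  have "\<exists>B\<ge>0. \<forall>t\<ge>0. \<forall>p\<in>{0..1}. \<bar>kap l p t\<bar> \<le> B" if "l < m"
  proof -
    have "exp_decay (energy (Suc l))" using dec that by simp
    then obtain B where B: "0 \<le> B" "\<And>p t. 0 \<le> t \<Longrightarrow> p \<in> {0..1} \<Longrightarrow> \<bar>dev l p t\<bar> \<le> B"
      by (rule dev_bounded) blast
    obtain B' where B': "0 < B'" "\<And>t. 0 \<le> t \<Longrightarrow> mean t \<le> B'" by (rule mean_bounded) blast
    have "\<bar>kap l p t\<bar> \<le> B + B'" if "0 \<le> t" "p \<in> {0..1}" for p t
      using B(2)[OF that] B'(2)[OF that(1)] mean_nonneg[OF that(1)] B'(1)
      by (cases l) (auto simp: dev_0 dev_Suc)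
    then show ?thesis using B(1) B'(1) by (intro exI[of _ "B + B'"]) auto
  qed
  moreover have "exp_decay (J (\<lambda>p t. (kap l p t)\<^sup>2))" if "1 \<le> l" "l \<le> m"
    using dec[OF that(2)] that(1) by (cases l) (auto simp: energy_def[abs_def] dev_Suc)
  ultimately show ?case by blast
next
  case weighted_V
  have "exp_decay (energy (Suc 0))" using dec m by simp
  then obtain B where B: "0 \<le> B" "\<And>p t. 0 \<le> t \<Longrightarrow> p \<in> {0..1} \<Longrightarrow> \<bar>dev 0 p t\<bar> \<le> B"
    by (rule dev_bounded) blast
  obtain B' where B': "0 < B'" "\<And>t. 0 \<le> t \<Longrightarrow> excess t \<le> B'" by (rule excess_bounded) blast
  have "\<bar>V p t\<bar> \<le> B + B'" if "0 \<le> t" "p \<in> {0..1}" for p t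
    using B(2)[OF that] B'(2)[OF that(1)] excess_nonneg[OF that(1)] unfolding V_eq by linarith
  then show ?case using B(1) B'(1) by (intro conjI impI exI[of _ "B + B'"]) auto
next
  case (weighted_add i f g)
  have "\<exists>B\<ge>0. \<forall>t\<ge>0. \<forall>p\<in>{0..1}. \<bar>f p t + g p t\<bar> \<le> B" if "i < m"
  proof -
    obtain B where B: "0 \<le> B" "\<forall>t\<ge>0. \<forall>p\<in>{0..1}. \<bar>f p t\<bar> \<le> B"
      using weighted_add.IH(1) \<open>i < m\<close> by blast
    obtain B' where B': "0 \<le> B'" "\<forall>t\<ge>0. \<forall>p\<in>{0..1}. \<bar>g p t\<bar> \<le> B'"
      using weighted_add.IH(2) \<open>i < m\<close> by blast
    have "\<bar>f p t + g p t\<bar> \<le> B + B'" if "0 \<le> t" "p \<in> {0..1}" for p t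
      using B(2)[rule_format, OF that] B'(2)[rule_format, OF that] by linarith
    then show ?thesis using B(1) B'(1) by (intro exI[of _ "B + B'"]) auto
  qed
  moreover have "exp_decay (J (\<lambda>p t. (f p t + g p t)\<^sup>2))" if i: "1 \<le> i" "i \<le> m"
  proof (rule exp_decay_mono)
    show "exp_decay (\<lambda>t. 2 * J (\<lambda>p t. (f p t)\<^sup>2) t + 2 * J (\<lambda>p t. (g p t)\<^sup>2) t)"
      using weighted_add.IH i by (intro exp_decay_add exp_decay_cmult) auto
    fix t :: real assume t: "0 \<le> t"
    note c = cont_weighted[OF weighted_add.hyps(1) t] cont_weighted[OF weighted_add.hyps(2) t]
    have "J (\<lambda>p t. (f p t + g p t)\<^sup>2) t \<le> J (\<lambda>p t. 2 * (f p t)\<^sup>2 + 2 * (g p t)\<^sup>2) t"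
    proof (rule J_mono[OF t])
      fix p
      have "0 \<le> (f p t - g p t)\<^sup>2" by simp
      then show "(f p t + g p t)\<^sup>2 \<le> 2 * (f p t)\<^sup>2 + 2 * (g p t)\<^sup>2"
        unfolding power2_sum power2_diff by linarith
    qed (intro continuous_intros c)+
    also have "\<dots> = J (\<lambda>p t. 2 * (f p t)\<^sup>2) t + J (\<lambda>p t. 2 * (g p t)\<^sup>2) t"
      by (intro J_add t continuous_intros c)
    finally show "J (\<lambda>p t. (f p t + g p t)\<^sup>2) t \<le> 2 * J (\<lambda>p t. (f p t)\<^sup>2) t + 2 * J (\<lambda>p t. (g p t)\<^sup>2) t"
      by (simp only: J_cmult[of "\<lambda>_. 2"])
  qed
  ultimately show ?case by blast
next
  case (weighted_mult i f j g)
  have prod: "exp_decay (J (\<lambda>p t. (f p t * g p t)\<^sup>2))"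
    if f: "\<exists>B\<ge>0. \<forall>t\<ge>0. \<forall>p\<in>{0..1}. \<bar>f p t\<bar> \<le> B" and g: "exp_decay (J (\<lambda>p t. (g p t)\<^sup>2))"
      and w: "weighted i f" "weighted j g" for i f j g
  proof -
    obtain B where B: "0 \<le> B" "\<And>p t. 0 \<le> t \<Longrightarrow> p \<in> {0..1} \<Longrightarrow> \<bar>f p t\<bar> \<le> B" using f by blast
    show ?thesis
    proof (rule exp_decay_mono[OF exp_decay_cmult[OF g, of "B\<^sup>2"]])
      fix t :: real assume t: "0 \<le> t"
      note c = cont_weighted[OF w(1) t] cont_weighted[OF w(2) t]
      have "J (\<lambda>p t. (f p t * g p t)\<^sup>2) t \<le> J (\<lambda>p t. (\<lambda>_. B\<^sup>2) t * (g p t)\<^sup>2) t"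
      proof (rule J_mono[OF t])
        fix p :: real assume "p \<in> {0..1}"
        then have "\<bar>f p t\<bar>\<^sup>2 \<le> B\<^sup>2" using B(2)[OF t] by (intro power_mono) auto
        then show "(f p t * g p t)\<^sup>2 \<le> B\<^sup>2 * (g p t)\<^sup>2"
          unfolding power_mult_distrib by (intro mult_right_mono) auto
      qed (intro continuous_intros c)+
      then show "J (\<lambda>p t. (f p t * g p t)\<^sup>2) t \<le> B\<^sup>2 * J (\<lambda>p t. (g p t)\<^sup>2) t"
        unfolding J_cmult .
    qed simp
  qed
  have "\<exists>B\<ge>0. \<forall>t\<ge>0. \<forall>p\<in>{0..1}. \<bar>f p t * g p t\<bar> \<le> B" if "i + j < m"
  proof -
    have ij: "i < m" "j < m" using that by auto
    obtain B where B: "0 \<le> B" "\<forall>t\<ge>0. \<forall>p\<in>{0..1}. \<bar>f p t\<bar> \<le> B"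
      using weighted_mult.IH(1) ij(1) by blast
    obtain B' where B': "0 \<le> B'" "\<forall>t\<ge>0. \<forall>p\<in>{0..1}. \<bar>g p t\<bar> \<le> B'"
      using weighted_mult.IH(2) ij(2) by blast
    have "\<bar>f p t * g p t\<bar> \<le> B * B'" if "0 \<le> t" "p \<in> {0..1}" for p t
      unfolding abs_mult using B(2)[rule_format, OF that] B'(2)[rule_format, OF that] B(1)
      by (intro mult_mono) auto
    then show ?thesis using B(1) B'(1) by (intro exI[of _ "B * B'"]) auto
  qed
  moreover have "exp_decay (J (\<lambda>p t. (f p t * g p t)\<^sup>2))" if ij: "1 \<le> i + j" "i + j \<le> m"
  proof (cases "i < m \<and> 1 \<le> j")
    case True
    then show ?thesis using weighted_mult ij by (intro prod) auto
  next
    case False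
    then have "j < m" "1 \<le> i" "i \<le> m" using ij m by auto
    then have "exp_decay (J (\<lambda>p t. (g p t * f p t)\<^sup>2))" using weighted_mult by (intro prod) auto
    then show ?thesis by (simp add: mult.commute)
  qed
  ultimately show ?case by blast
next
  case (weighted_cong i f g)
  have "J (\<lambda>p t. (g p t)\<^sup>2) t \<le> J (\<lambda>p t. (f p t)\<^sup>2) t" if "0 \<le> t" for t
    using J_cong[OF that, of "\<lambda>p t. (g p t)\<^sup>2" "\<lambda>p t. (f p t)\<^sup>2"] weighted_cong.hyps(2)[OF that] by simp
  then have "exp_decay (J (\<lambda>p t. (g p t)\<^sup>2))" if "exp_decay (J (\<lambda>p t. (f p t)\<^sup>2))"
    using exp_decay_mono[OF that] by simp
  then show ?case using weighted_cong.IH by (simp add: weighted_cong.hyps(2))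
qed

text \<open>For \<open>m \<ge> 1\<close> the remainder has positive weight. In \<open>R 0 = \<kappa>\<^sup>2 V\<close> the smallness comes from \<open>V\<close>, which is the
  curvature deviation up to the excess, while the sup norm of \<open>\<kappa>\<^sup>2\<close> is only controlled by the energy of order one, the
  very quantity to be estimated. This is the origin of the factor \<open>(1 + energy)\<^sup>2\<close>.\<close>

lemma reaction_term_bound:
  assumes dec: "\<And>j. j \<le> m \<Longrightarrow> exp_decay (energy j)"
  obtains r where "exp_decay r" "\<And>t. 0 \<le> t \<Longrightarrow> 0 \<le> r t"
    "\<And>t. 0 \<le> t \<Longrightarrow> J (\<lambda>p t. (R m p t)\<^sup>2) t \<le> (1 + energy (Suc m) t)\<^sup>2 * r t"
proof (cases "1 \<le> m")
  case True
  show ?thesis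
  proof (rule that)
    show "exp_decay (J (\<lambda>p t. (R m p t)\<^sup>2))"
      using weighted_bounds[OF weighted_R True dec] True by simp
    fix t :: real assume t: "0 \<le> t"
    show J0: "0 \<le> J (\<lambda>p t. (R m p t)\<^sup>2) t"
      by (intro J_nonneg t continuous_intros cont_weighted[OF weighted_R]) simp
    have "1 \<le> (1 + energy (Suc m) t)\<^sup>2" using energy_nonneg[OF t, of "Suc m"] by (simp add: one_le_power)
    from mult_right_mono[OF this J0]
    show "J (\<lambda>p t. (R m p t)\<^sup>2) t \<le> (1 + energy (Suc m) t)\<^sup>2 * J (\<lambda>p t. (R m p t)\<^sup>2) t" by simp
  qed
next
  case False
  then have m: "m = 0" by simp
  obtain B where B: "0 < B" "\<And>t. 0 \<le> t \<Longrightarrow> mean t \<le> B" by (rule mean_bounded) blast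
  obtain B' where B': "0 < B'" "\<And>t. 0 \<le> t \<Longrightarrow> excess t \<le> B'" by (rule excess_bounded) blast
  obtain l0 l1 where l: "0 < l0" "\<And>t. 0 \<le> t \<Longrightarrow> l0 \<le> L t" "\<And>t. 0 \<le> t \<Longrightarrow> L t \<le> l1"
    by (rule length_bounded) blast
  define C where "C = 2 * l1 + 2 * B\<^sup>2"
  define q where "q t = 2 * energy 0 t + 2 * (B' * l1) * excess t" for t
  have l1: "0 < l1" using l(1) l(2)[of 0] l(3)[of 0] by simp
  have C: "0 \<le> C" using l1 by (simp add: C_def)
  show ?thesis
  proof (rule that[of "\<lambda>t. C\<^sup>2 * q t"])
    show "exp_decay (\<lambda>t. C\<^sup>2 * q t)"
      unfolding q_def using B'(1) l1 dec
      by (intro exp_decay_cmult exp_decay_add exp_decay_excess) auto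
    fix t :: real assume t: "0 \<le> t"
    show "0 \<le> C\<^sup>2 * q t"
      unfolding q_def using B'(1) l1 energy_nonneg[OF t, of 0] excess_nonneg[OF t] by simp
    define e where "e = energy (Suc 0) t"
    have e: "0 \<le> e" unfolding e_def by (rule energy_nonneg[OF t])
    have "J (\<lambda>p t. (R 0 p t)\<^sup>2) t \<le> J (\<lambda>p t. (\<lambda>_. (C * (1 + e))\<^sup>2) t * (V p t)\<^sup>2) t"
    proof (rule J_mono[OF t])
      fix p :: real assume p: "p \<in> {0..1}"
      have "(dev 0 p t)\<^sup>2 \<le> l1 * e"
        using dev_sup_bound[OF t p, of 0] mult_right_mono[OF l(3)[OF t] e] by (simp add: e_def)
      moreover have "(mean t)\<^sup>2 \<le> B\<^sup>2" using B(2)[OF t] mean_nonneg[OF t] by (intro power_mono) auto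
      moreover have "0 \<le> (dev 0 p t - mean t)\<^sup>2" by simp
      ultimately have "(\<kappa> p t)\<^sup>2 \<le> 2 * l1 * e + 2 * B\<^sup>2"
        unfolding \<kappa>_eq power2_sum power2_diff by linarith
      also have "\<dots> \<le> C * (1 + e)" using e l1 by (simp add: C_def algebra_simps)
      finally have "((\<kappa> p t)\<^sup>2)\<^sup>2 \<le> (C * (1 + e))\<^sup>2" by (intro power_mono) auto
      then show "(R 0 p t)\<^sup>2 \<le> (C * (1 + e))\<^sup>2 * (V p t)\<^sup>2"
        by (simp add: power_mult_distrib[of "(\<kappa> p t)\<^sup>2"] mult_right_mono)
    qed (intro continuous_intros cont_V cont_weighted[OF weighted_R] t)+
    also have "\<dots> = (C * (1 + e))\<^sup>2 * J (\<lambda>p t. (V p t)\<^sup>2) t" by (rule J_cmult)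
    also have "\<dots> \<le> (C * (1 + e))\<^sup>2 * q t"
    proof (rule mult_left_mono)
      have "J (\<lambda>p t. (V p t)\<^sup>2) t \<le> J (\<lambda>p t. 2 * (dev 0 p t)\<^sup>2 + 2 * (excess t)\<^sup>2) t"
      proof (rule J_mono[OF t])
        fix p
        have "0 \<le> (dev 0 p t + excess t)\<^sup>2" by simp
        then show "(V p t)\<^sup>2 \<le> 2 * (dev 0 p t)\<^sup>2 + 2 * (excess t)\<^sup>2"
          unfolding V_eq power2_sum power2_diff by linarith
      qed (intro continuous_intros cont_V cont_dev t)+
      also have "\<dots> = J (\<lambda>p t. 2 * (dev 0 p t)\<^sup>2) t + J (\<lambda>p t. 2 * (excess t)\<^sup>2) t"
        by (intro J_add t continuous_intros cont_dev)
      also have "\<dots> = 2 * energy 0 t + 2 * ((excess t)\<^sup>2 * L t)"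
        unfolding energy_def J_cmult[of "\<lambda>_. 2"] J_const[OF t, of "\<lambda>t. (excess t)\<^sup>2"] ..
      also have "(excess t)\<^sup>2 * L t = (excess t * L t) * excess t" by (simp add: power2_eq_square)
      also have "\<dots> \<le> (B' * l1) * excess t"
        using excess_nonneg[OF t] B'(2)[OF t] l(3)[OF t] L_pos[OF t] B'(1)
        by (intro mult_right_mono mult_mono) auto
      finally show "J (\<lambda>p t. (V p t)\<^sup>2) t \<le> q t" by (simp add: q_def mult.assoc)
    qed simp
    finally show "J (\<lambda>p t. (R m p t)\<^sup>2) t \<le> (1 + energy (Suc m) t)\<^sup>2 * (C\<^sup>2 * q t)"
      unfolding m e_def by (simp add: power_mult_distrib mult_ac)
  qed
qed

text \<open>Again the sup norm of \<open>\<kappa>\<close> is controlled by the energy of order one, which is already bounded for \<open>m \<ge> 1\<close> and is the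
  energy under consideration for \<open>m = 0\<close>.\<close>

lemma curvature_velocity_bound:
  assumes dec: "\<And>j. j \<le> m \<Longrightarrow> exp_decay (energy j)"
  obtains K where "0 \<le> K" "\<And>p t. 0 \<le> t \<Longrightarrow> p \<in> {0..1} \<Longrightarrow>
    \<kappa> p t * V p t \<le> (1 + energy (Suc m) t)\<^sup>2 * K"
proof -
  obtain B where B: "0 < B" "\<And>t. 0 \<le> t \<Longrightarrow> mean t \<le> B" by (rule mean_bounded) blast
  obtain l0 l1 where l: "0 < l0" "\<And>t. 0 \<le> t \<Longrightarrow> l0 \<le> L t" "\<And>t. 0 \<le> t \<Longrightarrow> L t \<le> l1"
    by (rule length_bounded) blast
  obtain B' where B': "0 < B'" "\<And>t. 0 \<le> t \<Longrightarrow> excess t \<le> B'" by (rule excess_bounded) blast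
  have l1: "0 < l1" using l(1) l(2)[of 0] l(3)[of 0] by simp
  obtain E where E: "0 \<le> E" "\<And>t. 0 \<le> t \<Longrightarrow> energy 1 t \<le> E + energy (Suc m) t"
  proof (cases m)
    case 0
    then show ?thesis using that[of 0] by simp
  next
    case (Suc n)
    then obtain E where "0 < E" "\<And>t. 0 \<le> t \<Longrightarrow> energy 1 t \<le> E"
      using exp_decay_bounded[OF dec[of 1]] by auto
    then show ?thesis using that[of E] energy_nonneg by (meson add_increasing2 less_imp_le)
  qed
  define K where "K = 2 * l1 * E + 2 * l1 + B\<^sup>2 + B'\<^sup>2"
  show ?thesis
  proof (rule that[of K])
    show "0 \<le> K" unfolding K_def using l1 E(1) by simp
    fix p t :: real assume t: "0 \<le> t" and p: "p \<in> {0..1}"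
    define e where "e = energy (Suc m) t"
    have e: "0 \<le> e" unfolding e_def by (rule energy_nonneg[OF t])
    have "(dev 0 p t)\<^sup>2 \<le> L t * energy 1 t" using dev_sup_bound[OF t p, of 0] by simp
    also have "\<dots> \<le> l1 * (E + e)"
      using l(3)[OF t] E(2)[OF t] L_pos[OF t] energy_nonneg[OF t] l1 by (intro mult_mono) (auto simp: e_def)
    finally have 1: "(dev 0 p t)\<^sup>2 \<le> l1 * (E + e)" .
    have 2: "(mean t)\<^sup>2 \<le> B\<^sup>2" "(excess t)\<^sup>2 \<le> B'\<^sup>2"
      using B(2)[OF t] mean_nonneg[OF t] B'(2)[OF t] excess_nonneg[OF t] by (auto intro: power_mono)
    have "\<kappa> p t * V p t \<le> 2 * (dev 0 p t)\<^sup>2 + (mean t)\<^sup>2 + (excess t)\<^sup>2"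
    proof -
      have "0 \<le> (\<kappa> p t - V p t)\<^sup>2 + (dev 0 p t - mean t)\<^sup>2 + (dev 0 p t + excess t)\<^sup>2" by simp
      then show ?thesis unfolding V_eq \<kappa>_eq by (simp add: power2_eq_square algebra_simps)
    qed
    also have "\<dots> \<le> 2 * (l1 * (E + e)) + B\<^sup>2 + B'\<^sup>2" using 1 2 by linarith
    also have "\<dots> \<le> (1 + e) * K"
      using e l1 E(1) by (simp add: K_def algebra_simps)
    also have "\<dots> \<le> (1 + e)\<^sup>2 * K"
      using e \<open>0 \<le> K\<close> by (intro mult_right_mono) (auto simp: power2_eq_square)
    finally show "\<kappa> p t * V p t \<le> (1 + energy (Suc m) t)\<^sup>2 * K" by (simp add: e_def)
  qed
qed

lemma dissipation_Suc:
  assumes dec: "\<And>j. j \<le> m \<Longrightarrow> exp_decay (energy j)"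
  obtains K r where "0 \<le> K" "exp_decay r" "\<And>t. 0 \<le> t \<Longrightarrow> 0 \<le> r t"
    "\<And>t. 0 \<le> t \<Longrightarrow> energy_rate (Suc m) t + energy (Suc (Suc m)) t
      \<le> (1 + energy (Suc m) t)\<^sup>2 * (K * energy (Suc m) t + r t)"
proof -
  obtain r where r: "exp_decay r" "\<And>t. 0 \<le> t \<Longrightarrow> 0 \<le> r t"
    "\<And>t. 0 \<le> t \<Longrightarrow> J (\<lambda>p t. (R m p t)\<^sup>2) t \<le> (1 + energy (Suc m) t)\<^sup>2 * r t"
    using reaction_term_bound[OF dec] by blast
  obtain K where K: "0 \<le> K" "\<And>p t. 0 \<le> t \<Longrightarrow> p \<in> {0..1} \<Longrightarrow>
    \<kappa> p t * V p t \<le> (1 + energy (Suc m) t)\<^sup>2 * K"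
    using curvature_velocity_bound[OF dec] by blast
  show ?thesis
  proof (rule that[OF K(1) r(1,2)])
    fix t :: real assume t: "0 \<le> t"
    define k where "k = kap (Suc (Suc m))"
    have ck: "continuous_on {0..1} (\<lambda>p. k p t)" unfolding k_def by (rule cont_kap[OF t])
    note cR = cont_weighted[OF weighted_R t]
    have "0 \<le> J (\<lambda>p t. (k p t + R m p t)\<^sup>2) t"
      by (intro J_nonneg t continuous_intros ck cR) simp
    also have "\<dots> = J (\<lambda>p t. (k p t)\<^sup>2 + (R m p t)\<^sup>2 + 2 * (k p t * R m p t)) t"
      by (rule J_cong[OF t]) (simp add: power2_sum)
    also have "\<dots> = J (\<lambda>p t. (k p t)\<^sup>2 + (R m p t)\<^sup>2) t + J (\<lambda>p t. 2 * (k p t * R m p t)) t"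
      by (intro J_add t continuous_intros ck cR)
    also have "J (\<lambda>p t. (k p t)\<^sup>2 + (R m p t)\<^sup>2) t = J (\<lambda>p t. (k p t)\<^sup>2) t + J (\<lambda>p t. (R m p t)\<^sup>2) t"
      by (intro J_add t continuous_intros ck cR)
    also have "J (\<lambda>p t. 2 * (k p t * R m p t)) t = 2 * J (\<lambda>p t. k p t * R m p t) t" by (rule J_cmult)
    finally have 1: "- 2 * J (\<lambda>p t. k p t * R m p t) t
        \<le> energy (Suc (Suc m)) t + J (\<lambda>p t. (R m p t)\<^sup>2) t"
      by (simp add: energy_def dev_Suc k_def)
    have "J (\<lambda>p t. (kap (Suc m) p t)\<^sup>2 * (\<kappa> p t * V p t)) t
        \<le> J (\<lambda>p t. (\<lambda>t. (1 + energy (Suc m) t)\<^sup>2 * K) t * (kap (Suc m) p t)\<^sup>2) t"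
    proof (rule J_mono[OF t])
      fix p :: real assume "p \<in> {0..1}"
      from mult_left_mono[OF K(2)[OF t this], of "(kap (Suc m) p t)\<^sup>2"]
      show "(kap (Suc m) p t)\<^sup>2 * (\<kappa> p t * V p t) \<le> (1 + energy (Suc m) t)\<^sup>2 * K * (kap (Suc m) p t)\<^sup>2"
        by (simp add: mult_ac)
    qed (intro continuous_intros conts t)+
    also have "\<dots> = (1 + energy (Suc m) t)\<^sup>2 * K * energy (Suc m) t"
      unfolding J_cmult by (simp add: energy_def dev_Suc)
    finally show "energy_rate (Suc m) t + energy (Suc (Suc m)) t
        \<le> (1 + energy (Suc m) t)\<^sup>2 * (K * energy (Suc m) t + r t)"
      using 1 r(3)[OF t] unfolding energy_rate_def k_def by (simp add: algebra_simps)
  qed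
qed

lemma dissipation:
  assumes "\<And>j. j < l \<Longrightarrow> exp_decay (energy j)"
  obtains K r where "0 \<le> K" "exp_decay r" "\<And>t. 0 \<le> t \<Longrightarrow> 0 \<le> r t"
    "\<And>t. 0 \<le> t \<Longrightarrow> energy_rate l t + energy (Suc l) t
      \<le> (1 + energy l t)\<^sup>2 * (K * energy l t + r t)"
proof (cases l)
  case 0
  have "exp_decay (\<lambda>t. 0)" by (rule exp_decayI[of 0 1]) auto
  moreover obtain K where "0 \<le> K"
    "\<And>t. 0 \<le> t \<Longrightarrow> energy_rate 0 t + energy 1 t \<le> (1 + energy 0 t)\<^sup>2 * (K * energy 0 t)"
    using dissipation_0 by blast
  ultimately show ?thesis using that[of K "\<lambda>t. 0"] 0 by simp
next
  case (Suc m)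
  then show ?thesis using dissipation_Suc[of m] assms that by (metis less_Suc_eq_le)
qed

section \<open>Exponential decay of all energies\<close>

text \<open>The quantity consumed at the rate of the energy of order \<open>l\<close> is a multiple of the deficit for \<open>l = 0\<close>, and the energy of order
  \<open>l - 1\<close> for \<open>l \<ge> 1\<close>.\<close>

lemma exp_decay_energy: "exp_decay (energy l)"
proof (induction l rule: less_induct)
  case (less l)
  obtain K r where K: "0 \<le> K" "exp_decay r" "\<And>t. 0 \<le> t \<Longrightarrow> 0 \<le> r t"
    "\<And>t. 0 \<le> t \<Longrightarrow> energy_rate l t + energy (Suc l) t
      \<le> (1 + energy l t)\<^sup>2 * (K * energy l t + r t)"
    using dissipation[OF less.IH] by blast
  obtain E E' s where E: "exp_decay E" "exp_decay s" "\<And>t. 0 \<le> t \<Longrightarrow> 0 \<le> E t" "\<And>t. 0 \<le> t \<Longrightarrow> 0 \<le> s t"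
    "\<And>t. 0 \<le> t \<Longrightarrow> (E has_real_derivative E' t) (at t within {0..})"
    "\<And>t. 0 \<le> t \<Longrightarrow> E' t \<le> - energy l t + s t"
  proof (cases l)
    case 0
    obtain l0 l1 where l: "0 < l0" "\<And>t. 0 \<le> t \<Longrightarrow> l0 \<le> L t" "\<And>t. 0 \<le> t \<Longrightarrow> L t \<le> l1"
      by (rule length_bounded) blast
    show ?thesis
    proof (rule that[of "\<lambda>t. 1 / (2 * l0) * deficit t" "\<lambda>t. 0"
          "\<lambda>t. 1 / (2 * l0) * (- 2 * L t * energy 0 t)"])
      show "exp_decay (\<lambda>t. 1 / (2 * l0) * deficit t)"
        using l(1) by (intro exp_decay_cmult exp_decay_deficit) auto
      show "exp_decay (\<lambda>t. 0)" by (rule exp_decayI[of 0 1]) auto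
      fix t :: real assume t: "0 \<le> t"
      show "0 \<le> 1 / (2 * l0) * deficit t" using l(1) deficit_nonneg[OF t] by simp
      show "((\<lambda>t. 1 / (2 * l0) * deficit t) has_real_derivative
          1 / (2 * l0) * (- 2 * L t * energy 0 t)) (at t within {0..})"
        by (intro DERIV_cmult deficit_has_derivative t)
      have "l0 * energy 0 t \<le> L t * energy 0 t"
        using l(2)[OF t] energy_nonneg[OF t] by (intro mult_right_mono) auto
      then show "1 / (2 * l0) * (- 2 * L t * energy 0 t) \<le> - energy l t + 0"
        using l(1) 0 by (simp add: field_simps)
    qed simp
  next
    case (Suc m)
    obtain K' r' where K': "0 \<le> K'" "exp_decay r'" "\<And>t. 0 \<le> t \<Longrightarrow> 0 \<le> r' t"
      "\<And>t. 0 \<le> t \<Longrightarrow> energy_rate m t + energy (Suc m) t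
        \<le> (1 + energy m t)\<^sup>2 * (K' * energy m t + r' t)"
      using dissipation[of m] less.IH Suc by (metis less_Suc_eq)
    have decm: "exp_decay (energy m)" using less.IH Suc by simp
    obtain B where B: "0 < B" "\<And>t. 0 \<le> t \<Longrightarrow> energy m t \<le> B" using exp_decay_bounded[OF decm] by blast
    show ?thesis
    proof (rule that[OF decm _ energy_nonneg _ energy_has_rate])
      show "exp_decay (\<lambda>t. (1 + B)\<^sup>2 * (K' * energy m t + r' t))"
        using K'(1,2) decm by (intro exp_decay_cmult exp_decay_add) auto
      fix t :: real assume t: "0 \<le> t"
      have n: "0 \<le> K' * energy m t + r' t"
        using K'(1) K'(3)[OF t] energy_nonneg[OF t] by simp
      then show "0 \<le> (1 + B)\<^sup>2 * (K' * energy m t + r' t)" by simp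
      have "(1 + energy m t)\<^sup>2 \<le> (1 + B)\<^sup>2"
        using B(2)[OF t] energy_nonneg[OF t, of m] by (intro power_mono) auto
      from mult_right_mono[OF this n]
      show "energy_rate m t \<le> - energy l t + (1 + B)\<^sup>2 * (K' * energy m t + r' t)"
        using K'(4)[OF t] Suc by simp
    qed assumption+
  qed
  show ?case
  proof (rule exp_decay_of_dissipation[OF energy_has_rate E(5) energy_nonneg E(3) E(1)
        exp_decay_add[OF K(2) E(2)] _ _ K(1)])
    fix t :: real assume t: "0 \<le> t"
    show "E' t \<le> - energy l t + (r t + s t)" using E(6)[OF t] K(3)[OF t] by simp
    have "(1 + energy l t)\<^sup>2 * (K * energy l t + r t)
        \<le> (1 + energy l t)\<^sup>2 * (K * energy l t + (r t + s t))"
      using E(4)[OF t] by (intro mult_left_mono) auto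
    then show "energy_rate l t \<le> (1 + energy l t)\<^sup>2 * (K * energy l t + (r t + s t))"
      using K(4)[OF t] energy_nonneg[OF t, of "Suc l"] by simp
  qed
qed

lemma exp_decay_curvature_energy: "exp_decay (\<lambda>t. curvature_energy l (\<lambda>p. F p t))"
proof -
  obtain l0 l1 where l: "0 < l0" "\<And>t. 0 \<le> t \<Longrightarrow> l0 \<le> L t" "\<And>t. 0 \<le> t \<Longrightarrow> L t \<le> l1"
    by (rule length_bounded) blast
  have l1: "0 < l1" using l(1) l(2)[of 0] l(3)[of 0] by simp
  show ?thesis
  proof (rule exp_decay_mono[OF exp_decay_cmult[OF exp_decay_energy]])
    show "0 \<le> l1 ^ (2 * l + 1)" using l1 by simp
    fix t :: real assume t: "0 \<le> t"
    have "L t ^ (2 * l + 1) \<le> l1 ^ (2 * l + 1)" using l(3)[OF t] L_pos[OF t] by (intro power_mono) auto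
    then show "curvature_energy l (\<lambda>p. F p t) \<le> l1 ^ (2 * l + 1) * energy l t"
      unfolding curvature_energy_energy[OF t] using energy_nonneg[OF t] by (intro mult_right_mono) auto
  qed
qed

end

theorem theorem4p2:
  fixes F :: "real \<Rightarrow> real \<Rightarrow> real^2"
  assumes "global_flow_solution F"
    and "rotation_number (\<lambda>p. F p 0) = 1"
    and "signed_area (\<lambda>p. F p 0) > 0"
  shows "\<forall>l::nat. \<exists>C>0. \<exists>\<mu>>0. \<forall>t\<ge>0.
           curvature_energy l (\<lambda>p. F p t) \<le> C * exp (- \<mu> * t)"
proof
  fix l
  interpret area_length_flow F using assms by unfold_locales
  show "\<exists>C>0. \<exists>\<mu>>0. \<forall>t\<ge>0. curvature_energy l (\<lambda>p. F p t) \<le> C * exp (- \<mu> * t)"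
    using exp_decay_curvature_energy[of l] unfolding exp_decay_def .
qed

end
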